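(* Let $n$ be a positive integer, let $a_1,\ldots,a_n,b_1,\ldots,b_n>0$ be real numbers, and let $u_1,\ldots,u_n\in\mathbb{R}^n$ be linearly independent unit vectors. For every measurable set $A\subseteq\mathbb{R}^{n+1}$ satisfying $\overline{\delta}(A)>0$ there is a positive number $\lambda_0=\lambda_0(A,a_1,\ldots,a_n,b_1,\ldots,b_n,u_1,\ldots,u_n)$ such that for each $\lambda\in[\lambda_0,\infty)$ one can find a point $x\in\mathbb{R}^{n+1}$ and vectors $y_1,\ldots,y_n\in\mathbb{R}^{n+1}$ satisfying \[ \{x,x+y_1,x+y_2,\ldots,x+y_n\}\subseteq A \] and \[ y_k\cdot y_l = (\lambda^{a_k}b_k u_k)\cdot(\lambda^{a_l}b_l u_l)\quad\text{for all } k,l\in\{1,2,\ldots,n\}. \] In other words, for each $\lambda\in[\lambda_0,\infty)$ the set $A$ contains an isometric copy of $\{\mathbf{0},\lambda^{a_1}b_1u_1,\lambda^{a_2}b_2u_2,\ldots,\lambda^{a_n}b_nu_n\}\subset\mathbb{R}^n$.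
   Context: Measurability is with respect to Lebesgue measure, $|\cdot|$ of a set denotes its Lebesgue measure, and $\cdot$ between vectors denotes the standard inner product. For a measurable set $A\subseteq\mathbb{R}^d$ the upper Banach density is \[ \overline{\delta}(A):=\limsup_{R\to\infty}\,\sup_{x\in\mathbb{R}^d}\frac{|A\cap(x+[0,R]^d)|}{R^d}. \] Here $d=n+1$. *)

theory Defs
  imports "HOL-Analysis.Analysis"
begin

definition upper_banach_density :: "(real ^ 'd) set \<Rightarrow> ennreal" where
  "upper_banach_density A =
     Limsup at_top (\<lambda>R::real. SUP x::real ^ 'd.
       emeasure lebesgue (A \<inter> (+) x ` cbox 0 (\<chi> i. R)) / ennreal (R ^ CARD('d)))"

definition contains_isometric_copy :: "'b::metric_space set \<Rightarrow> 'a::metric_space set \<Rightarrow> bool" where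
  "contains_isometric_copy A P \<longleftrightarrow>
     (\<exists>f. f ` P \<subseteq> A \<and> (\<forall>p\<in>P. \<forall>q\<in>P. dist (f p) (f q) = dist p q))"

end

theory Submission
  imports Defs "HOL-Probability.Probability_Measure"
begin

text \<open>
  Embed the \<open>u\<^sub>k\<close> isometrically as \<open>v\<^sub>k\<close> in \<open>(n+1)\<close>-space and let \<open>T\<close> be a random orthogonal map whose law
  is right invariant. With \<open>f\<close> the indicator of \<open>A\<close> inside a huge cube, count copies by the integral of
  \<open>f(x) \<Prod>\<^sub>k f(x + s\<^sub>k T v\<^sub>k)\<close> over \<open>x\<close> and \<open>T\<close>, where \<open>s\<^sub>k = t\<^bsup>a\<^sub>k\<^esup> b\<^sub>k\<close>. Replace \<open>f\<close> in the \<open>k\<close>-th factor by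
  its average over grid cells of side a large multiple of \<open>s\<^sub>k\<close>, one \<open>k\<close> at a time.

  The fluctuation of \<open>f\<close> below a scale much smaller than \<open>s\<^sub>k\<close> is negligible: the vectors \<open>v\<^sub>l\<close> with
  \<open>l \<noteq> k\<close> span a space of codimension 2, so \<open>v\<^sub>k\<close> can be moved along a circle by reflections fixing them.
  By Cauchy-Schwarz and invariance one is left with averages of \<open>f\<close> minus its cell average against the law
  of \<open>T\<close> applied to a random chord of this circle; that law has an integrable density, which is close
  in the mean to functions that are constant on small cells. The fluctuation between the two scales is controlled by the energy decrement of
  cell averages along dyadic scales: for a long lacunary sequence of parameters \<open>t\<close> it is small for at least
  one of them. The remaining main term is bounded below since a positive proportion of \<open>A\<close> lies well inside cells in
  which \<open>A\<close> is not sparse. Hence the parameters \<open>t\<close> for which no copy exists are bounded.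
\<close>

section \<open>Orthogonal invariance and a random orthogonal map\<close>

text \<open>Once the other n - 1 vectors are placed, the image of \<open>v k\<close> is confined to
  a circle, a null set, so cancellation below the scale s_k cannot come from a density of a single
  shift. Squaring the circle average trades the point for the difference of two independent points
  of the circle. Its length is random and its direction is spread by the rotation, and this is what
  produces a density; the price is a square root in the bounds.

  Since the lengths s_k grow at different rates, no single grid serves all factors. Each k has its
  own fine and coarse side, and the decrement must succeed for all k at the same t; energy drops are
  therefore added over k before t is selected.

  Constants are fixed in the order of dependence: the density, the lower bound for the main term,
  the fine-scale threshold, the growth factor and length of the sequence, and only then the cube.
  Every estimate is proportional to the volume of the cube, so the earlier choices survive its
  growth.\<close>

lemma nn_integral_lborel_affine:
  fixes f :: "'a::euclidean_space \<Rightarrow> ennreal"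
  assumes [measurable]: "f \<in> borel_measurable borel" and "c \<noteq> 0"
  shows "(\<integral>\<^sup>+x. f x \<partial>lborel) = ennreal (\<bar>c\<bar> ^ DIM('a)) * (\<integral>\<^sup>+x. f (t + c *\<^sub>R x) \<partial>lborel)"
  by (subst lborel_affine[OF \<open>c \<noteq> 0\<close>, of t])
     (simp add: nn_integral_density nn_integral_distr nn_integral_cmult flip: ennreal_power)

text \<open>Integrating 1_X(x) 1_Y(x - y) against \<open>N\<close> and \<open>lborel\<close> in both
  orders, and substituting x + y for x in between, gives the two products. This is the Fubini proof
  that Haar measure is unique up to a factor.\<close>

lemma translation_invariant_measure_proportional:
  fixes N :: "'a::euclidean_space measure"
  assumes sets [measurable_cong]: "sets N = sets borel" and "sigma_finite_measure N"
    and inv: "\<And>a. distr N borel ((+) a) = N"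
    and X [measurable]: "X \<in> sets borel" and Y [measurable]: "Y \<in> sets borel"
  shows "emeasure N X * emeasure lborel Y = emeasure N Y * emeasure lborel X"
proof -
  interpret N: sigma_finite_measure N by fact
  interpret NL: pair_sigma_finite N lborel ..
  have shift: "(\<integral>\<^sup>+x. f (a + x) \<partial>N) = (\<integral>\<^sup>+x. f x \<partial>N)"
    if [measurable]: "f \<in> borel_measurable borel" for f and a :: 'a
    by (subst (2) inv[of a, symmetric]) (simp add: nn_integral_distr)
  have "emeasure N X * emeasure lborel Y
      = (\<integral>\<^sup>+x. indicator X x * (\<integral>\<^sup>+y. indicator Y (x - y) \<partial>lborel) \<partial>N)"
  proof -
    have "(\<integral>\<^sup>+y. indicator Y (x - y) \<partial>lborel) = emeasure lborel Y" for x
      using nn_integral_lborel_affine[of "indicator Y" "-1" x] by simp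
    then show ?thesis
      by (simp add: nn_integral_multc)
  qed
  also have "\<dots> = (\<integral>\<^sup>+x. (\<integral>\<^sup>+y. indicator X x * indicator Y (x - y) \<partial>lborel) \<partial>N)"
    by (simp add: nn_integral_cmult)
  also have "\<dots> = (\<integral>\<^sup>+y. (\<integral>\<^sup>+x. indicator X x * indicator Y (x - y) \<partial>N) \<partial>lborel)"
    by (rule NL.Fubini'[symmetric]) simp
  also have "\<dots> = (\<integral>\<^sup>+y. (\<integral>\<^sup>+x. indicator X (x + y) * indicator Y x \<partial>N) \<partial>lborel)"
  proof (rule nn_integral_cong)
    fix y :: 'a
    show "(\<integral>\<^sup>+x. indicator X x * indicator Y (x - y) \<partial>N)
        = (\<integral>\<^sup>+x. indicator X (x + y) * indicator Y x \<partial>N)"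
      using shift[of "\<lambda>x. indicator X x * indicator Y (x - y)" y] by (simp add: add.commute)
  qed
  also have "\<dots> = (\<integral>\<^sup>+x. (\<integral>\<^sup>+y. indicator X (x + y) * indicator Y x \<partial>lborel) \<partial>N)"
    by (rule NL.Fubini') simp
  also have "\<dots> = (\<integral>\<^sup>+x. indicator Y x * (\<integral>\<^sup>+y. indicator X (x + y) \<partial>lborel) \<partial>N)"
    by (simp add: nn_integral_cmult mult.commute)
  also have "\<dots> = emeasure N Y * emeasure lborel X"
  proof -
    have "(\<integral>\<^sup>+y. indicator X (x + y) \<partial>lborel) = emeasure lborel X" for x
      using nn_integral_lborel_affine[of "indicator X" "1" x] by simp
    then show ?thesis
      by (simp add: nn_integral_multc)
  qed
  finally show ?thesis .
qed

section \<open>Lebesgue measure under orthogonal maps\<close>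

lemma orthogonal_transformation_borel_measurable:
  fixes f :: "'a::euclidean_space \<Rightarrow> 'a"
  assumes "orthogonal_transformation f"
  shows "f \<in> borel_measurable borel"
  using orthogonal_transformation_linear[OF assms]
  by (intro borel_measurable_continuous_onI linear_continuous_on) (simp add: linear_conv_bounded_linear)

lemma emeasure_lborel_open_nonzero:
  fixes U :: "'a::euclidean_space set"
  assumes "open U" "U \<noteq> {}"
  shows "emeasure lborel U \<noteq> 0"
proof
  assume "emeasure lborel U = 0"
  then have "U \<in> null_sets lborel" using assms by (auto simp: null_sets_def)
  then have "negligible U"
    by (simp add: negligible_iff_null_sets null_sets_completionI)
  then show False using open_not_negligible assms by blast
qed

text \<open>The image measure is again translation invariant, because translation by
  \<open>a\<close> pulls back to translation by the preimage of \<open>a\<close>; hence it is a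
  multiple of \<open>lborel\<close>. The factor is 1 since the unit ball is its own
  preimage.\<close>

lemma lborel_distr_orthogonal:
  fixes f :: "'a::euclidean_space \<Rightarrow> 'a"
  assumes f: "orthogonal_transformation f"
  shows "distr lborel borel f = lborel"
proof -
  note [measurable] = orthogonal_transformation_borel_measurable[OF f]
  let ?N = "distr lborel borel f" and ?B = "ball (0::'a) 1"
  obtain g where g: "orthogonal_transformation g" "\<And>x. f (g x) = x" "\<And>x. g (f x) = x"
  proof
    have b: "bij f" using f by (rule orthogonal_transformation_bij)
    show "orthogonal_transformation (inv f)"
      using f by (rule orthogonal_transformation_inv)
    show "f (inv f x) = x" for x
      using b by (simp add: bij_is_surj surj_f_inv_f)
    show "inv f (f x) = x" for x
      using b by (simp add: bij_is_inj)
  qed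
  note [measurable] = orthogonal_transformation_borel_measurable[OF g(1)]
  have lin: "linear f" using f orthogonal_transformation_linear by blast
  have ball: "f -` ball 0 r = ball 0 r" for r
    using f by (auto simp: orthogonal_transformation)
  have emb: "emeasure ?N (ball 0 r) = emeasure lborel (ball (0::'a) r)" for r
    by (simp add: emeasure_distr ball)
  have "sigma_finite_measure ?N"
  proof
    show "\<exists>A. countable A \<and> A \<subseteq> sets ?N \<and> \<Union> A = space ?N \<and> (\<forall>a\<in>A. emeasure ?N a \<noteq> \<infinity>)"
    proof (intro exI[of _ "range (\<lambda>n::nat. ball 0 (real n))"] conjI ballI)
      show "\<Union> (range (\<lambda>n::nat. ball 0 (real n))) = space ?N"
        by (auto intro: reals_Archimedean2)
      fix a :: "'a set" assume "a \<in> range (\<lambda>n::nat. ball 0 (real n))"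
      then obtain n :: nat where "a = ball 0 (real n)" by auto
      then show "emeasure ?N a \<noteq> \<infinity>"
        unfolding emb using emeasure_bounded_finite[OF bounded_ball, of "0::'a" "real n"]
        by (metis emb infinity_ennreal_def less_irrefl)
    qed auto
  qed
  moreover have "distr ?N borel ((+) a) = ?N" for a
  proof -
    have "distr ?N borel ((+) a) = distr lborel borel (\<lambda>x. f (g a + x))"
      using lin by (simp add: distr_distr comp_def linear_add g)
    also have "\<dots> = distr (distr lborel borel ((+) (g a))) borel f"
      by (simp add: distr_distr comp_def)
    also have "distr lborel borel ((+) (g a)) = (lborel :: 'a measure)"
      by (rule lborel_distr_plus)
    finally show ?thesis .
  qed
  ultimately have eq: "emeasure ?N X * emeasure lborel ?B = emeasure ?N ?B * emeasure lborel X"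
    if "X \<in> sets borel" for X
    using that by (intro translation_invariant_measure_proportional) auto
  have pos: "emeasure lborel ?B \<noteq> 0"
    by (rule emeasure_lborel_open_nonzero) auto
  have fin: "emeasure lborel ?B \<noteq> \<infinity>"
    using emeasure_bounded_finite[OF bounded_ball, of "0::'a" 1] by simp
  show ?thesis
  proof (rule measure_eqI)
    fix X assume "X \<in> sets ?N"
    then show "emeasure ?N X = emeasure lborel X"
      using eq[of X] emb[of 1] pos fin
      by (simp add: mult.commute[of _ "emeasure lborel ?B"] ennreal_mult_cancel_left)
  qed simp
qed

lemma nn_integral_lborel_orthogonal:
  fixes f :: "'a::euclidean_space \<Rightarrow> ennreal" and r :: "'a \<Rightarrow> 'a"
  assumes "orthogonal_transformation r" and [measurable]: "f \<in> borel_measurable borel"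
  shows "(\<integral>\<^sup>+x. f (r x) \<partial>lborel) = (\<integral>\<^sup>+x. f x \<partial>lborel)"
proof -
  note [measurable] = orthogonal_transformation_borel_measurable[OF assms(1)]
  show ?thesis
    by (subst (2) lborel_distr_orthogonal[OF assms(1), symmetric]) (simp add: nn_integral_distr)
qed

text \<open>Dependent input is not excluded: a zero remainder is scaled by 1 / 0 = 0 and yields the
  zero vector. Equivariance and measurability therefore hold for every sequence, and nondegeneracy
  enters only for orthonormality.\<close>

fun gram_schmidt :: "(nat \<Rightarrow> 'a::real_inner) \<Rightarrow> nat \<Rightarrow> 'a" where
  "gram_schmidt g n =
     (let r = g n - (\<Sum>j<n. (g n \<bullet> gram_schmidt g j) *\<^sub>R gram_schmidt g j)
      in (1 / norm r) *\<^sub>R r)"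

declare gram_schmidt.simps [simp del]

definition gs_residual :: "(nat \<Rightarrow> 'a::real_inner) \<Rightarrow> nat \<Rightarrow> 'a" where
  "gs_residual g n = g n - (\<Sum>j<n. (g n \<bullet> gram_schmidt g j) *\<^sub>R gram_schmidt g j)"

lemma gram_schmidt_eq: "gram_schmidt g n = (1 / norm (gs_residual g n)) *\<^sub>R gs_residual g n"
  by (subst gram_schmidt.simps) (simp add: gs_residual_def Let_def)

text \<open>The construction uses only inner products, norms and linear combinations, all respected
  by \<open>r\<close>. This equivariance is the source of the invariance of the random map built
  from it.\<close>

lemma gram_schmidt_orthogonal_transformation:
  fixes g :: "nat \<Rightarrow> 'a::euclidean_space"
  assumes r: "orthogonal_transformation r"
  shows "gram_schmidt (\<lambda>i. r (g i)) n = r (gram_schmidt g n)"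
proof (induction n rule: less_induct)
  case (less n)
  have lin: "linear r" using r orthogonal_transformation_linear by blast
  have "gs_residual (\<lambda>i. r (g i)) n = r (gs_residual g n)"
    using r less by (simp add: gs_residual_def linear_diff[OF lin] linear_sum[OF lin]
        linear_scale[OF lin] orthogonal_transformation_def)
  then show ?case
    using r by (simp add: gram_schmidt_eq orthogonal_transformation linear_scale[OF lin])
qed

lemma gram_schmidt_in_span: "gram_schmidt g n \<in> span (g ` {..n})"
proof (induction n rule: less_induct)
  case (less n)
  have "gram_schmidt g j \<in> span (g ` {..n})" if "j < n" for j
    using less[OF that] that span_mono[of "g ` {..j}" "g ` {..n}"] by fastforce
  then have "gs_residual g n \<in> span (g ` {..n})"
    unfolding gs_residual_def by (intro span_diff span_sum span_scale) (auto intro: span_base)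
  then show ?case unfolding gram_schmidt_eq by (rule span_scale)
qed

lemma gram_schmidt_orthonormal:
  assumes nz: "\<And>i. i < N \<Longrightarrow> gs_residual g i \<noteq> 0"
  shows "i < N \<Longrightarrow> j < N \<Longrightarrow> gram_schmidt g i \<bullet> gram_schmidt g j = (if i = j then 1 else 0)"
proof -
  have norm1: "gram_schmidt g i \<bullet> gram_schmidt g i = 1" if "i < N" for i
    using nz[OF that] by (simp add: gram_schmidt_eq power2_norm_eq_inner[symmetric] power2_eq_square[symmetric] field_simps)
  have orth: "\<forall>j<i. gram_schmidt g i \<bullet> gram_schmidt g j = 0" if "i < N" for i
    using that
  proof (induction i rule: less_induct)
    case (less i)
    have "gs_residual g i \<bullet> gram_schmidt g j = 0" if j: "j < i" for j
    proof -
      have "(\<Sum>l<i. (g i \<bullet> gram_schmidt g l) *\<^sub>R gram_schmidt g l) \<bullet> gram_schmidt g j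
          = (\<Sum>l<i. if l = j then g i \<bullet> gram_schmidt g j else 0)"
        unfolding inner_sum_left
      proof (rule sum.cong)
        fix l assume l: "l \<in> {..<i}"
        have "gram_schmidt g l \<bullet> gram_schmidt g j = 0" if "l \<noteq> j"
          using less.IH[of l] less.IH[of j] l j less.prems that
          by (metis inner_commute lessThan_iff linorder_neqE_nat order.strict_trans)
        then show "((g i \<bullet> gram_schmidt g l) *\<^sub>R gram_schmidt g l) \<bullet> gram_schmidt g j
            = (if l = j then g i \<bullet> gram_schmidt g j else 0)"
          using norm1[of j] j less.prems by auto
      qed simp
      also have "\<dots> = g i \<bullet> gram_schmidt g j" using j by simp
      finally show ?thesis by (simp add: gs_residual_def inner_diff_left)
    qed
    then show ?case by (simp add: gram_schmidt_eq[of g i])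
  qed
  show "i < N \<Longrightarrow> j < N \<Longrightarrow> gram_schmidt g i \<bullet> gram_schmidt g j = (if i = j then 1 else 0)"
    using norm1 orth by (metis inner_commute linorder_neqE_nat)
qed

lemma gram_schmidt_measurable:
  fixes g :: "'w \<Rightarrow> nat \<Rightarrow> 'a::euclidean_space"
  assumes "\<And>i. (\<lambda>w. g w i) \<in> borel_measurable M"
  shows "(\<lambda>w. gram_schmidt (g w) n) \<in> borel_measurable M"
proof (induction n rule: less_induct)
  case (less n)
  have "(\<lambda>w. \<Sum>j<n. (g w n \<bullet> gram_schmidt (g w) j) *\<^sub>R gram_schmidt (g w) j) \<in> borel_measurable M"
    by (rule borel_measurable_sum)
       (use less assms in \<open>auto intro!: borel_measurable_scaleR borel_measurable_inner\<close>)
  then have "(\<lambda>w. gs_residual (g w) n) \<in> borel_measurable M"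
    unfolding gs_residual_def by (rule borel_measurable_diff[OF assms])
  then have "(\<lambda>w. (1 / norm (gs_residual (g w) n)) *\<^sub>R gs_residual (g w) n) \<in> borel_measurable M"
    by measurable
  then show ?case
    by (simp add: gram_schmidt_eq)
qed

text \<open>The last axiom expresses right invariance of the law of \<open>T\<close>; demanding a measure-preserving map
  of the parameter space avoids measures on spaces of maps.\<close>

locale random_orthogonal = prob_space M for M :: "'w measure" +
  fixes T :: "'w \<Rightarrow> real ^ 'd \<Rightarrow> real ^ 'd"
  assumes T_measurable: "(\<lambda>p. T (fst p) (snd p)) \<in> borel_measurable (M \<Otimes>\<^sub>M borel)"
    and T_orthogonal: "w \<in> space M \<Longrightarrow> orthogonal_transformation (T w)"
    and T_invariant: "orthogonal_transformation r \<Longrightarrow>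
      \<exists>S \<in> measurable M M. distr M M S = M \<and> (\<forall>w\<in>space M. \<forall>x. T (S w) x = T w (r x))"

lemma gs_residual_orthogonal_transformation:
  fixes g :: "nat \<Rightarrow> 'a::euclidean_space"
  assumes r: "orthogonal_transformation r"
  shows "gs_residual (\<lambda>i. r (g i)) n = r (gs_residual g n)"
proof -
  have lin: "linear r" using r orthogonal_transformation_linear by blast
  show ?thesis
    using r by (simp add: gs_residual_def linear_diff[OF lin] linear_sum[OF lin]
        linear_scale[OF lin] orthogonal_transformation_def gram_schmidt_orthogonal_transformation)
qed

lemma gs_residual_eq_0_imp_in_span:
  assumes "gs_residual g n = 0"
  shows "g n \<in> span (g ` {..<n})"
proof -
  have "g n = (\<Sum>j<n. (g n \<bullet> gram_schmidt g j) *\<^sub>R gram_schmidt g j)"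
    using assms by (simp add: gs_residual_def)
  moreover have "gram_schmidt g j \<in> span (g ` {..<n})" if "j < n" for j
    using gram_schmidt_in_span[of g j] that span_mono[of "g ` {..j}" "g ` {..<n}"] by fastforce
  then have "(\<Sum>j<n. (g n \<bullet> gram_schmidt g j) *\<^sub>R gram_schmidt g j) \<in> span (g ` {..<n})"
    by (intro span_sum span_scale) auto
  ultimately show ?thesis by simp
qed

lemma gs_residual_measurable:
  fixes g :: "'w \<Rightarrow> nat \<Rightarrow> 'a::euclidean_space"
  assumes [measurable]: "\<And>i. (\<lambda>w. g w i) \<in> borel_measurable M"
  shows "(\<lambda>w. gs_residual (g w) n) \<in> borel_measurable M"
proof -
  note [measurable] = gram_schmidt_measurable[of g, OF assms]
  show ?thesis unfolding gs_residual_def by measurable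
qed

lemma det_eq_0_row_in_span:
  fixes A :: "real ^ 'n ^ 'n"
  assumes "row i A \<in> span {row j A |j. j \<noteq> i}"
  shows "det A = 0"
proof -
  have "- row i A \<in> vec.span {row j A |j. j \<noteq> i}"
    using assms by (simp add: span_vec_eq span_neg)
  from det_row_span[OF this]
  have "det A = det (\<chi> k. if k = i then 0 else row k A)"
    by (simp cong: if_cong)
  also have "\<dots> = 0"
    by (rule det_zero_row(2)[of i]) (simp add: row_def vec_eq_iff)
  finally show ?thesis .
qed

text \<open>Orthonormalising the rows of a uniformly random matrix from a ball gives
  \<open>Q w\<close>. Applying one orthogonal map to all rows is an orthogonal map of the matrix
  space, so it preserves the ball and Lebesgue measure, and by equivariance it multiplies
  \<open>Q w\<close> on the right.\<close>

theorem ex_random_orthogonal: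
  "\<exists>(M :: (real ^ 'd ^ 'd) measure) (T :: real ^ 'd ^ 'd \<Rightarrow> real ^ 'd \<Rightarrow> real ^ 'd). random_orthogonal M T"
proof -
  let ?d = "CARD('d)"
  obtain idx :: "nat \<Rightarrow> 'd" where idx: "bij_betw idx {..<?d} UNIV"
    using ex_bij_betw_nat_finite[of "UNIV :: 'd set"] by (auto simp: atLeast0LessThan)
  define pos where "pos = the_inv_into {..<?d} idx"
  have pos_less: "pos i < ?d" and idx_pos: "idx (pos i) = i" for i
    using idx f_the_inv_into_f_bij_betw[OF idx] the_inv_into_into[of idx "{..<?d}" i "{..<?d}"]
    by (auto simp: pos_def bij_betw_def)
  have pos_idx: "pos (idx m) = m" if "m < ?d" for m
    using idx that by (simp add: pos_def the_inv_into_f_f bij_betw_def)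
  have pos_inj: "pos i = pos j \<longleftrightarrow> i = j" for i j
    by (metis idx_pos)
  define G where "G = (\<lambda>(w :: real ^ 'd ^ 'd) m. w $ idx m)"
  define Q where "Q = (\<lambda>w. \<chi> i. gram_schmidt (G w) (pos i))"
  define T where "T = (\<lambda>w (x :: real ^ 'd). Q w *v x)"
  \<comment> \<open>The ball is centred at 0 to be invariant, and its radius exceeds the norm of the
    identity matrix so that it contains an open set of invertible matrices. Degenerate matrices are
    removed to make \<open>T w\<close> orthogonal for every \<open>w\<close>, not just almost every
    one.\<close>
  define good where "good = {w \<in> ball 0 (norm (mat 1 :: real ^ 'd ^ 'd) + 1). \<forall>m<?d. gs_residual (G w) m \<noteq> 0}"
  define M where "M = restrict_space (uniform_measure lborel good) good"
  have G_meas [measurable]: "(\<lambda>w. G w m) \<in> borel_measurable borel" for m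
    by (simp add: G_def borel_measurable_continuous_onI continuous_intros)
  note [measurable] = gs_residual_measurable[of G, OF G_meas] gram_schmidt_measurable[of G, OF G_meas]
  have good_meas [measurable]: "good \<in> sets borel"
    unfolding good_def by measurable
  have det_good: "w \<in> good" if "det w \<noteq> 0" "w \<in> ball 0 (norm (mat 1 :: real ^ 'd ^ 'd) + 1)" for w
  proof -
    have "gs_residual (G w) m \<noteq> 0" if m: "m < ?d" for m
    proof
      assume "gs_residual (G w) m = 0"
      then have "row (idx m) w \<in> span (G w ` {..<m})"
        using gs_residual_eq_0_imp_in_span[of "G w" m] by (simp add: G_def row_def)
      moreover have "G w ` {..<m} \<subseteq> {row j w |j. j \<noteq> idx m}"
      proof
        fix x assume "x \<in> G w ` {..<m}"
        then obtain j where "j < m" "x = row (idx j) w"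
          by (auto simp: G_def row_def)
        moreover from this have "idx j \<noteq> idx m"
          using m pos_idx[of j] pos_idx[of m] by auto
        ultimately show "x \<in> {row j w |j. j \<noteq> idx m}" by blast
      qed
      ultimately have "row (idx m) w \<in> span {row j w |j. j \<noteq> idx m}"
        using span_mono by blast
      then show False using det_eq_0_row_in_span \<open>det w \<noteq> 0\<close> by blast
    qed
    then show ?thesis using that by (simp add: good_def)
  qed
  have "emeasure lborel good \<noteq> 0"
  proof -
    let ?U = "{w :: real ^ 'd ^ 'd. det w \<noteq> 0} \<inter> ball 0 (norm (mat 1 :: real ^ 'd ^ 'd) + 1)"
    have "continuous_on UNIV (\<lambda>w :: real ^ 'd ^ 'd. det w)"
      unfolding det_def by (intro continuous_intros)
    then have "open ?U"
      by (intro open_Int open_ball open_Collect_neq) (auto intro: continuous_intros)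
    moreover have "mat 1 \<in> ?U" by (simp add: det_I)
    ultimately have "emeasure lborel ?U \<noteq> 0"
      using emeasure_lborel_open_nonzero[of ?U] by blast
    moreover have "emeasure lborel ?U \<le> emeasure lborel good"
      using det_good by (intro emeasure_mono) auto
    ultimately show ?thesis by auto
  qed
  moreover have fin: "emeasure lborel good \<noteq> \<infinity>"
  proof -
    have "bounded good"
      by (rule bounded_subset[OF bounded_ball[of 0 "norm (mat 1 :: real ^ 'd ^ 'd) + 1"]]) (auto simp: good_def)
    then show ?thesis using emeasure_bounded_finite[of good] by simp
  qed
  ultimately have "prob_space (uniform_measure lborel good)" and nz: "emeasure lborel good \<noteq> 0"
    by (auto intro: prob_space_uniform_measure)
  then have prob: "prob_space M"
    unfolding M_def
    by (intro prob_space_restrict_space) (use nz fin in \<open>auto simp: ennreal_divide_self less_top\<close>)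
  have space: "space M = good"
    by (simp add: M_def space_restrict_space)
  have orthQ: "orthogonal_matrix (Q w)" if "w \<in> good" for w
  proof -
    have "gram_schmidt (G w) (pos i) \<bullet> gram_schmidt (G w) (pos j) = (if i = j then 1 else 0)" for i j
      using gram_schmidt_orthonormal[of ?d "G w" "pos i" "pos j"] that pos_less
      by (simp add: good_def pos_inj)
    then show ?thesis
      unfolding orthogonal_matrix_orthonormal_rows
      by (simp add: Q_def row_def norm_eq_1 orthogonal_def vec_lambda_eta)
  qed
  have meas: "(\<lambda>p. T (fst p) (snd p)) \<in> borel_measurable (M \<Otimes>\<^sub>M borel)"
  proof -
    have [measurable]: "(\<lambda>w. gram_schmidt (G w) m) \<in> borel_measurable M" for m
      unfolding M_def by (intro measurable_restrict_space1) measurable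
    have "T w x = (\<Sum>i\<in>UNIV. (gram_schmidt (G w) (pos i) \<bullet> x) *\<^sub>R axis i 1)" for w x
      by (auto simp: T_def Q_def vec_eq_iff matrix_vector_mul_component axis_def if_distrib cong: if_cong)
    then show ?thesis by simp
  qed
  show ?thesis
  proof (intro exI random_orthogonal.intro random_orthogonal_axioms.intro)
    show "prob_space M" by fact
    show "(\<lambda>p. T (fst p) (snd p)) \<in> borel_measurable (M \<Otimes>\<^sub>M borel)" by fact
    show "orthogonal_transformation (T w)" if "w \<in> space M" for w
      using orthQ[of w] that
      by (simp add: space T_def orthogonal_transformation_matrix matrix_of_matrix_vector_mul)
    fix r :: "real ^ 'd \<Rightarrow> real ^ 'd" assume r: "orthogonal_transformation r"
    define r' where "r' = inv r"
    have r': "orthogonal_transformation r'" and rr': "r' (r x) = x" for x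
      using orthogonal_transformation_inv[OF r] orthogonal_transformation_bij[OF r]
      by (auto simp: r'_def bij_is_inj)
    have lin': "linear r'" using r' orthogonal_transformation_linear by blast
    \<comment> \<open>\<open>T w\<close> pairs its argument with the rows of \<open>Q w\<close>, so
      precomposing with \<open>r\<close> means applying the inverse of \<open>r\<close> to every
      row.\<close>
    define S where "S = (\<lambda>w :: real ^ 'd ^ 'd. \<chi> i. r' (w $ i))"
    have S: "orthogonal_transformation S"
      unfolding orthogonal_transformation_def
    proof (intro conjI allI)
      show "linear S"
        by (rule linearI) (simp_all add: S_def vec_eq_iff linear_add[OF lin'] linear_scale[OF lin'])
      show "S v \<bullet> S w = v \<bullet> w" for v w
        using r' by (simp add: S_def inner_vec_def[where 'a="real ^ 'd"] orthogonal_transformation_def)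
    qed
    note [measurable] = orthogonal_transformation_borel_measurable[OF S]
    have GS: "G (S w) = (\<lambda>m. r' (G w m))" for w
      by (simp add: G_def S_def)
    have S_good: "S w \<in> good \<longleftrightarrow> w \<in> good" for w
    proof -
      have "norm (S w) = norm w" using S by (simp add: orthogonal_transformation)
      moreover have "r' x = 0 \<longleftrightarrow> x = 0" for x
        using r' by (metis norm_eq_zero orthogonal_transformation)
      ultimately show ?thesis
        by (simp add: good_def GS gs_residual_orthogonal_transformation[OF r'])
    qed
    have TS: "T (S w) x = T w (r x)" for w x
    proof -
      have "r' a \<bullet> x = a \<bullet> r x" for a
        using r' rr'[of x] by (metis orthogonal_transformation_def)
      then show ?thesis
        by (simp add: T_def Q_def GS gram_schmidt_orthogonal_transformation[OF r'] vec_eq_iff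
            matrix_vector_mul_component)
    qed
    have SM: "S \<in> measurable M M"
      unfolding M_def by (rule measurable_restrict_space3) (auto simp: S_good)
    have "distr M M S = M"
    proof (rule measure_eqI)
      fix X assume "X \<in> sets (distr M M S)"
      then have X: "X \<in> sets M" by simp
      then have Xg: "X \<subseteq> good" and [measurable]: "X \<in> sets borel"
        using sets.sets_into_space[OF X] space by (auto simp: M_def sets_restrict_space_iff)
      have emM: "emeasure M Y = emeasure lborel Y / emeasure lborel good"
        if "Y \<subseteq> good" "Y \<in> sets borel" for Y
        using that by (simp add: M_def emeasure_restrict_space Int_absorb1)
      have "S -` X \<inter> space M = S -` X"
        using Xg S_good by (auto simp: space)
      then have "emeasure (distr M M S) X = emeasure M (S -` X)"
        using SM X by (simp add: emeasure_distr)
      also have "\<dots> = emeasure lborel (S -` X) / emeasure lborel good"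
        by (rule emM) (use Xg S_good measurable_sets_borel[of S borel X] in auto)
      also have "emeasure lborel (S -` X) = emeasure (distr lborel borel S) X"
        by (simp add: emeasure_distr)
      also have "\<dots> = emeasure lborel X"
        by (simp add: lborel_distr_orthogonal[OF S])
      also have "\<dots> / emeasure lborel good = emeasure M X"
        using Xg by (simp add: emM)
      finally show "emeasure (distr M M S) X = emeasure M X" .
    qed simp
    with SM TS show "\<exists>S\<in>M \<rightarrow>\<^sub>M M. distr M M S = M \<and> (\<forall>w\<in>space M. \<forall>x. T (S w) x = T w (r x))"
      by blast
  qed
qed

section \<open>Averages over grid cells\<close>

text \<open>The corner \<open>p\<close> of the grid is a parameter because
  \<open>balanced_affine\<close> translates and rescales grids; the final argument takes
  \<open>p\<close> = 0.\<close>

definition cell_index :: "real ^ 'd \<Rightarrow> real \<Rightarrow> real ^ 'd \<Rightarrow> 'd \<Rightarrow> int" where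
  "cell_index p L x = (\<lambda>i. \<lfloor>(x $ i - p $ i) / L\<rfloor>)"

definition cell :: "real ^ 'd \<Rightarrow> real \<Rightarrow> real ^ 'd \<Rightarrow> (real ^ 'd) set" where
  "cell p L x = {y. cell_index p L y = cell_index p L x}"

text \<open>Conditional expectation on the sigma-algebra of the grid, as an explicit quotient that
  has a value at every point.\<close>

definition cell_average :: "real ^ 'd \<Rightarrow> real \<Rightarrow> (real ^ 'd \<Rightarrow> real) \<Rightarrow> real ^ 'd \<Rightarrow> real" where
  "cell_average p L f x = (\<integral>y. indicator (cell p L x) y * f y \<partial>lborel) / L ^ CARD('d)"

lemma self_in_cell [simp]: "x \<in> cell p L x"
  by (simp add: cell_def)

lemma cell_sym: "y \<in> cell p L x \<longleftrightarrow> x \<in> cell p L y"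
  by (auto simp: cell_def)

lemma cell_eq: "y \<in> cell p L x \<Longrightarrow> cell p L y = cell p L x"
  by (auto simp: cell_def)

lemma indicator_cell_sym: "indicator (cell p L x) y = indicator (cell p L y) x"
  using cell_sym[of y p L x] by (simp add: indicator_def)

lemma cell_index_measurable [measurable]:
  fixes p :: "real ^ 'd"
  shows "(\<lambda>x. cell_index p L x i) \<in> measurable borel (count_space UNIV)"
proof -
  have [measurable]: "(\<lambda>x::real ^ 'd. x $ i) \<in> borel_measurable borel"
    by (intro borel_measurable_continuous_onI continuous_intros)
  show ?thesis unfolding cell_index_def by measurable
qed

lemma indicator_cell_measurable [measurable (raw)]:
  assumes [measurable]: "g \<in> borel_measurable M" "h \<in> borel_measurable M"
  shows "(\<lambda>w. indicator (cell p L (g w)) (h w) :: real) \<in> borel_measurable M"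
proof -
  have "indicator (cell p L x) y = (\<Prod>i\<in>UNIV. if cell_index p L y i = cell_index p L x i then 1 else (0::real))" for x y
    by (auto simp: cell_def indicator_def fun_eq_iff)
  then show ?thesis by simp
qed

lemma cell_measurable [measurable]: "cell p L x \<in> sets borel"
proof -
  have "(\<lambda>y. indicator (cell p L x) y :: real) \<in> borel_measurable borel" by measurable
  then show ?thesis by (simp add: borel_measurable_indicator_iff)
qed

text \<open>The grid has only countably many cells, so any union of cells is Borel.\<close>

lemma cell_invariant_borel:
  assumes "\<And>x y. x \<in> Z \<Longrightarrow> y \<in> cell p L x \<Longrightarrow> y \<in> Z"
  shows "Z \<in> sets borel"
proof -
  have "Z = (\<Union>m\<in>cell_index p L ` Z. {y. cell_index p L y = m})"
    using assms by (auto simp: cell_def)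
  moreover have "{y. cell_index p L y = m} \<in> sets borel" for m
  proof (cases "\<exists>x. cell_index p L x = m")
    case True
    then obtain x where "{y. cell_index p L y = m} = cell p L x" by (auto simp: cell_def)
    then show ?thesis by simp
  qed auto
  then have "(\<Union>m\<in>cell_index p L ` Z. {y. cell_index p L y = m}) \<in> sets borel"
    by (intro sets.countable_UN'' countableI_type) auto
  ultimately show ?thesis by simp
qed

text \<open>Nested floors: at side \<open>N\<close> times \<open>L\<close> the index is the integer
  quotient by \<open>N\<close> of the index at side \<open>L\<close>. Integer ratios thus give
  nested grids, which is why the scales are dyadic later.\<close>

lemma cell_subset_refine:
  assumes L: "0 < L" and N: "0 < N" and L': "L' = real N * L"
  shows "cell p L x \<subseteq> cell p L' x"
proof
  fix y assume y: "y \<in> cell p L x"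
  have "cell_index p L' z i = cell_index p L z i div int N" for z i
    using floor_divide_real_eq_div[of "int N" "(z $ i - p $ i) / L"] N
    by (simp add: cell_index_def L' mult.commute)
  with y show "y \<in> cell p L' x"
    by (auto simp: cell_def fun_eq_iff)
qed

lemma cell_eq_box:
  assumes "0 < L"
  shows "cell p L x = {y. \<forall>i. p $ i + L * cell_index p L x i \<le> y $ i \<and> y $ i < p $ i + L * cell_index p L x i + L}"
proof -
  have "cell_index p L y i = m \<longleftrightarrow> p $ i + L * m \<le> y $ i \<and> y $ i < p $ i + L * m + L" for y i m
    using assms by (simp add: cell_index_def floor_eq_iff field_simps)
  then show ?thesis
    unfolding cell_def fun_eq_iff by blast
qed

lemma emeasure_halfopen_box_cart:
  fixes a b :: "real ^ 'd"
  assumes "\<And>i. a $ i \<le> b $ i" and S: "box a b \<subseteq> S" "S \<subseteq> cbox a b" "S \<in> sets borel"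
  shows "emeasure lborel S = ennreal (\<Prod>i\<in>UNIV. b $ i - a $ i)"
proof -
  have ab: "\<And>j. j \<in> Basis \<Longrightarrow> a \<bullet> j \<le> b \<bullet> j"
    using assms by (auto simp: Basis_vec_def inner_axis)
  have eq: "(\<Prod>j\<in>Basis. (b - a) \<bullet> j) = (\<Prod>i\<in>UNIV. b $ i - a $ i)"
  proof -
    have "inj (\<lambda>i::'d. axis i (1::real))" by (simp add: inj_def axis_eq_axis)
    then show ?thesis
      by (simp add: Basis_vec_def UNION_singleton_eq_range prod.reindex inner_axis)
  qed
  have "emeasure lborel (box a b) \<le> emeasure lborel S" "emeasure lborel S \<le> emeasure lborel (cbox a b)"
    using S by (auto intro!: emeasure_mono)
  then show ?thesis
    using emeasure_lborel_box[OF ab] emeasure_lborel_cbox[OF ab] eq by simp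
qed

lemma emeasure_cell:
  fixes x :: "real ^ 'd"
  assumes "0 < L"
  shows "emeasure lborel (cell p L x) = ennreal (L ^ CARD('d))"
proof -
  let ?a = "\<chi> i. p $ i + L * cell_index p L x i" and ?b = "\<chi> i. p $ i + L * cell_index p L x i + L"
  have "emeasure lborel (cell p L x) = ennreal (\<Prod>i\<in>UNIV. ?b $ i - ?a $ i)"
    by (rule emeasure_halfopen_box_cart)
       (use assms in \<open>auto simp: cell_eq_box mem_box_cart less_imp_le\<close>)
  then show ?thesis by simp
qed

lemma measure_cell: "0 < L \<Longrightarrow> measure lborel (cell p L (x :: real ^ 'd)) = L ^ CARD('d)"
  using emeasure_cell[of L p x] by (simp add: measure_def)

lemma integrable_indicator_cell_mult:
  fixes f :: "real ^ 'd \<Rightarrow> real"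
  assumes "0 < L" and [measurable]: "f \<in> borel_measurable borel" and f: "\<And>y. \<bar>f y\<bar> \<le> C"
  shows "integrable lborel (\<lambda>y. indicator (cell p L x) y * f y)"
proof (rule Bochner_Integration.integrable_bound)
  show "integrable lborel (\<lambda>y. indicator (cell p L x) y * C)"
    using assms(1) emeasure_cell[of L p x] by (intro integrable_mult_left) (simp add: integrable_indicator_iff)
  show "AE y in lborel. norm (indicator (cell p L x) y * f y) \<le> norm (indicator (cell p L x) y * C)"
    using f order_trans[OF f abs_ge_self] by (auto simp: indicator_def abs_mult)
qed measurable

lemma cell_average_measurable [measurable]:
  assumes [measurable]: "f \<in> borel_measurable borel"
  shows "cell_average p L f \<in> borel_measurable borel"
  unfolding cell_average_def[abs_def] by measurable

lemma cell_average_cell: "y \<in> cell p L x \<Longrightarrow> cell_average p L f y = cell_average p L f x"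
  by (simp add: cell_average_def cell_eq)

lemma cell_average_bound:
  assumes "0 < L" and [measurable]: "f \<in> borel_measurable borel" and f: "\<And>y. \<bar>f y\<bar> \<le> C"
  shows "\<bar>cell_average p L f x\<bar> \<le> C"
proof -
  have "\<bar>\<integral>y. indicator (cell p L x) y * f y \<partial>lborel\<bar> \<le> (\<integral>y. indicator (cell p L x) y * C \<partial>lborel)"
    using integrable_indicator_cell_mult[OF assms(1), of "\<lambda>_. C" "\<bar>C\<bar>" p x] f
    by (intro integral_abs_bound_integral integrable_indicator_cell_mult[OF assms])
       (auto simp: indicator_def)
  also have "\<dots> = C * L ^ CARD('a)"
    using measure_cell[OF assms(1), of p x] by simp
  finally show ?thesis
    using assms(1) by (simp add: cell_average_def field_simps)
qed

lemma cell_average_nonneg: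
  assumes "0 < L" "\<And>y. 0 \<le> f y"
  shows "0 \<le> cell_average p L f x"
  using assms by (simp add: cell_average_def)

lemma cell_average_pullout:
  assumes "\<And>y. y \<in> cell p L x \<Longrightarrow> g y = g x"
  shows "cell_average p L (\<lambda>y. g y * f y) x = g x * cell_average p L f x"
proof -
  have "indicator (cell p L x) y * (g y * f y) = g x * (indicator (cell p L x) y * f y)" for y
    by (cases "y \<in> cell p L x") (simp_all add: assms[of y])
  then have "(\<lambda>y. indicator (cell p L x) y * (g y * f y)) = (\<lambda>y. g x * (indicator (cell p L x) y * f y))"
    by blast
  then show ?thesis by (simp only: cell_average_def) simp
qed

lemma cell_average_one: "0 < L \<Longrightarrow> cell_average p L (\<lambda>_. 1) x = 1"
  using measure_cell[of L p x] by (simp add: cell_average_def)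

lemma cell_average_cell_constant:
  assumes "0 < L" "\<And>y. y \<in> cell p L x \<Longrightarrow> g y = g x"
  shows "cell_average p L g x = g x"
proof -
  have "cell_average p L (\<lambda>y. g y * 1) x = g x * cell_average p L (\<lambda>_. 1) x"
    by (rule cell_average_pullout) (rule assms(2))
  then show ?thesis using cell_average_one[OF assms(1), of p x] by simp
qed

lemma cell_average_diff:
  assumes "0 < L" and [measurable]: "f \<in> borel_measurable borel" "g \<in> borel_measurable borel"
    and "\<And>y. \<bar>f y\<bar> \<le> C" "\<And>y. \<bar>g y\<bar> \<le> D"
  shows "cell_average p L (\<lambda>y. f y - g y) x = cell_average p L f x - cell_average p L g x"
  using integrable_indicator_cell_mult[OF assms(1,2,4), of p x] integrable_indicator_cell_mult[OF assms(1,3,5), of p x]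
  by (simp add: cell_average_def right_diff_distrib diff_divide_distrib)

lemma cell_average_kernel_integrable:
  fixes f g :: "real ^ 'd \<Rightarrow> real"
  assumes "0 < L" and g: "integrable lborel g"
    and [measurable]: "f \<in> borel_measurable borel" and f: "\<And>y. \<bar>f y\<bar> \<le> C"
  shows "integrable (lborel \<Otimes>\<^sub>M lborel) (\<lambda>(x, y). g x * (indicator (cell p L x) y * f y))"
proof -
  have [measurable]: "g \<in> borel_measurable borel" using g by simp
  have C: "0 \<le> C" using f[of 0] by simp
  have "integrable (lborel \<Otimes>\<^sub>M lborel) (\<lambda>(x, y). g x * (indicator (cell p L x) y * C))"
  proof (rule lborel_pair.Fubini_integrable)
    have "(\<integral>y. \<bar>g x * (indicator (cell p L x) y * C)\<bar> \<partial>lborel) = \<bar>g x\<bar> * (C * L ^ CARD('d))" for x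
      using measure_cell[OF assms(1), of p x] C by (simp add: abs_mult)
    then show "integrable lborel (\<lambda>x. \<integral>y. norm (case (x, y) of (x, y) \<Rightarrow> g x * (indicator (cell p L x) y * C)) \<partial>lborel)"
      using g by simp
    show "AE x in lborel. integrable lborel (\<lambda>y. case (x, y) of (x, y) \<Rightarrow> g x * (indicator (cell p L x) y * C))"
      using integrable_indicator_cell_mult[OF assms(1), of "\<lambda>_. C" "\<bar>C\<bar>" p] by (intro AE_I2) auto
  qed measurable
  then show ?thesis
  proof (rule Bochner_Integration.integrable_bound)
    show "AE q in lborel \<Otimes>\<^sub>M lborel. norm (case q of (x, y) \<Rightarrow> g x * (indicator (cell p L x) y * f y))
        \<le> norm (case q of (x, y) \<Rightarrow> g x * (indicator (cell p L x) y * C))"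
      using f C by (intro AE_I2) (auto simp: abs_mult indicator_def intro!: mult_left_mono)
  qed measurable
qed

lemma integrable_cell_average:
  assumes "0 < L" and f: "integrable lborel f"
  shows "integrable lborel (cell_average p L f)"
proof -
  have "integrable lborel (\<lambda>y. \<integral>x. f x * (indicator (cell p L x) y * 1) \<partial>lborel)"
    by (rule lborel_pair.integrable_snd[OF cell_average_kernel_integrable[OF assms, of _ 1]]) auto
  also have "(\<lambda>y. \<integral>x. f x * (indicator (cell p L x) y * 1) \<partial>lborel)
      = (\<lambda>y. \<integral>x. indicator (cell p L y) x * f x \<partial>lborel)"
    by (simp add: indicator_cell_sym[of p L _ "_ :: real ^ 'a"] mult.commute)
  finally show ?thesis
    unfolding cell_average_def[abs_def] by simp
qed

text \<open>The kernel \<open>indicator (cell p L x) y\<close> is symmetric in x and y, so Fubini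
  makes averaging self-adjoint. Suitable test functions turn this into the tower law, the energy
  identities, preservation of the integral and the later reductions to whole cells.\<close>

lemma cell_average_adjoint:
  assumes "0 < L" and g: "integrable lborel g"
    and f: "f \<in> borel_measurable borel" "\<And>y. \<bar>f y\<bar> \<le> C"
  shows "(\<integral>x. g x * cell_average p L f x \<partial>lborel) = (\<integral>y. cell_average p L g y * f y \<partial>lborel)"
proof -
  let ?c = "L ^ CARD('a)"
  have "(\<integral>x. g x * cell_average p L f x \<partial>lborel)
      = (\<integral>x. (\<integral>y. g x * (indicator (cell p L x) y * f y) \<partial>lborel) \<partial>lborel) / ?c"
    by (simp add: cell_average_def)
  also have "(\<integral>x. (\<integral>y. g x * (indicator (cell p L x) y * f y) \<partial>lborel) \<partial>lborel)
      = (\<integral>y. (\<integral>x. g x * (indicator (cell p L x) y * f y) \<partial>lborel) \<partial>lborel)"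
    by (rule lborel_pair.Fubini_integral[symmetric]) (rule cell_average_kernel_integrable[OF assms])
  also have "\<dots> = (\<integral>y. (\<integral>x. (indicator (cell p L y) x * g x) * f y \<partial>lborel) \<partial>lborel)"
    by (intro Bochner_Integration.integral_cong refl) (simp add: indicator_cell_sym mult_ac)
  also have "\<dots> = (\<integral>y. (\<integral>x. indicator (cell p L y) x * g x \<partial>lborel) * f y \<partial>lborel)"
    by simp
  also have "\<dots> / ?c = (\<integral>y. cell_average p L g y * f y \<partial>lborel)"
    by (simp add: cell_average_def)
  finally show ?thesis .
qed

text \<open>The indicator of a large cell is constant on small cells, hence its own average at side
  \<open>L\<close>; adjointness moves the inner average onto it. With \<open>N\<close> = 1 this is
  idempotence.\<close>

lemma cell_average_tower:
  assumes L: "0 < L" and N: "0 < N" and L': "L' = real N * L"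
    and f: "f \<in> borel_measurable borel" "\<And>y. \<bar>f y\<bar> \<le> C"
  shows "cell_average p L' (cell_average p L f) x = cell_average p L' f x"
proof -
  have "0 < L'" using assms by simp
  have "cell_average p L (indicator (cell p L' x)) y = indicator (cell p L' x) y" for y
  proof (rule cell_average_cell_constant[OF L])
    fix z assume "z \<in> cell p L y"
    then have "z \<in> cell p L' y" using cell_subset_refine[OF L N L'] by blast
    then show "indicator (cell p L' x) z = indicator (cell p L' x) y"
      by (simp add: indicator_def cell_def)
  qed
  then have "(\<integral>y. indicator (cell p L' x) y * cell_average p L f y \<partial>lborel)
      = (\<integral>y. indicator (cell p L' x) y * f y \<partial>lborel)"
    using cell_average_adjoint[OF L _ f, of "indicator (cell p L' x)" p] emeasure_cell[OF \<open>0 < L'\<close>, of p x]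
    by (simp add: integrable_indicator_iff)
  then show ?thesis by (simp add: cell_average_def)
qed

lemma cell_average_centered:
  assumes L: "0 < L" and f [measurable]: "f \<in> borel_measurable borel" and "\<And>y. \<bar>f y\<bar> \<le> C"
  shows "cell_average p L (\<lambda>y. f y - cell_average p L f y) x = 0"
proof -
  have "cell_average p L (\<lambda>y. f y - cell_average p L f y) x
      = cell_average p L f x - cell_average p L (cell_average p L f) x"
    by (rule cell_average_diff[OF L f _ assms(3) cell_average_bound[OF L f assms(3)]]) measurable
  also have "cell_average p L (cell_average p L f) x = cell_average p L f x"
    by (rule cell_average_tower[OF L, of 1]) (use assms in auto)
  finally show ?thesis by simp
qed

lemma integrable_mult_bounded:
  fixes f g :: "'a \<Rightarrow> real"
  assumes "integrable M f" and [measurable]: "g \<in> borel_measurable M" and "\<And>x. \<bar>g x\<bar> \<le> C"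
  shows "integrable M (\<lambda>x. f x * g x)" "integrable M (\<lambda>x. g x * f x)"
proof -
  have [measurable]: "f \<in> borel_measurable M" using assms by simp
  show *: "integrable M (\<lambda>x. f x * g x)"
    by (rule Bochner_Integration.integrable_bound[of _ "\<lambda>x. f x * C"])
       (use assms order_trans[OF assms(3) abs_ge_self] in \<open>auto simp: abs_mult intro!: mult_left_mono\<close>)
  then show "integrable M (\<lambda>x. g x * f x)" by (simp add: mult.commute)
qed

text \<open>Pythagoras: the coarse average is the orthogonal projection of the fine one, so the
  cross term equals the coarse energy.\<close>

lemma
  fixes f :: "real ^ 'd \<Rightarrow> real"
  assumes L: "0 < L" and N: "0 < N" and L': "L' = real N * L"
    and f: "integrable lborel f" "\<And>y. \<bar>f y\<bar> \<le> C"
  shows cell_average_energy_diff: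
    "(\<integral>x. (cell_average p L f x - cell_average p L' f x)\<^sup>2 \<partial>lborel)
      = (\<integral>x. (cell_average p L f x)\<^sup>2 \<partial>lborel) - (\<integral>x. (cell_average p L' f x)\<^sup>2 \<partial>lborel)" (is ?diff)
    and cell_average_energy_eq:
    "(\<integral>x. (cell_average p L f x)\<^sup>2 \<partial>lborel) = (\<integral>x. cell_average p L f x * f x \<partial>lborel)" (is ?eq)
proof -
  have f_meas [measurable]: "f \<in> borel_measurable borel" using f by simp
  have L'0: "0 < L'" using assms by simp
  let ?E = "cell_average p L f" and ?E' = "cell_average p L' f"
  have iE: "integrable lborel ?E" and iE': "integrable lborel ?E'"
    using integrable_cell_average L L'0 f by blast+
  have bE: "\<bar>?E x\<bar> \<le> C" and bE': "\<bar>?E' x\<bar> \<le> C" for x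
    using cell_average_bound L L'0 f f_meas by blast+
  have EE': "(\<integral>x. ?E x * ?E' x \<partial>lborel) = (\<integral>x. ?E' x * f x \<partial>lborel)"
    using cell_average_adjoint[OF L'0 iE f_meas f(2)] by (simp add: cell_average_tower[OF assms(1-3) f_meas f(2)])
  have EE: "(\<integral>x. ?E x * ?E x \<partial>lborel) = (\<integral>x. ?E x * f x \<partial>lborel)"
    using cell_average_adjoint[OF L iE f_meas f(2)] cell_average_tower[OF L, of 1 L f C p] f_meas f(2) by simp
  have E'E': "(\<integral>x. ?E' x * ?E' x \<partial>lborel) = (\<integral>x. ?E' x * f x \<partial>lborel)"
    using cell_average_adjoint[OF L'0 iE' f_meas f(2)] cell_average_tower[OF L'0, of 1 L' f C p] f_meas f(2) by simp
  have int: "integrable lborel (\<lambda>x. ?E x * ?E x)" "integrable lborel (\<lambda>x. ?E x * ?E' x)"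
    "integrable lborel (\<lambda>x. ?E' x * ?E' x)"
    using integrable_mult_bounded[OF iE _ bE] integrable_mult_bounded[OF iE _ bE'] integrable_mult_bounded[OF iE' _ bE']
    by auto
  show ?eq using EE by (simp add: power2_eq_square)
  have "(\<integral>x. (?E x - ?E' x)\<^sup>2 \<partial>lborel) = (\<integral>x. ?E x * ?E x - 2 * (?E x * ?E' x) + ?E' x * ?E' x \<partial>lborel)"
    by (intro Bochner_Integration.integral_cong refl) (simp add: power2_eq_square algebra_simps)
  also have "\<dots> = (\<integral>x. ?E x * ?E x \<partial>lborel) - 2 * (\<integral>x. ?E x * ?E' x \<partial>lborel) + (\<integral>x. ?E' x * ?E' x \<partial>lborel)"
    using int by simp
  finally show ?diff
    using EE' E'E' by (simp add: power2_eq_square)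
qed

section \<open>Cell-balanced functions\<close>

lemma cell_coordinate_le:
  fixes x :: "real ^ 'd"
  assumes "0 < L" "y \<in> cell p L x"
  shows "\<bar>x $ i - y $ i\<bar> \<le> L"
proof -
  have "x \<in> cell p L x" by simp
  then have "p $ i + L * cell_index p L x i \<le> x $ i \<and> x $ i < p $ i + L * cell_index p L x i + L"
    and "p $ i + L * cell_index p L x i \<le> y $ i \<and> y $ i < p $ i + L * cell_index p L x i + L"
    using assms unfolding cell_eq_box[OF assms(1)] by blast+
  then show ?thesis by linarith
qed

lemma dist_cell_le:
  fixes x :: "real ^ 'd"
  assumes "0 < L" "y \<in> cell p L x"
  shows "dist x y \<le> L * CARD('d)"
proof -
  have "(\<Sum>i\<in>UNIV. \<bar>(x - y) $ i\<bar>) \<le> (\<Sum>i\<in>(UNIV::'d set). L)"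
    using cell_coordinate_le[OF assms] by (intro sum_mono) simp
  then show ?thesis
    using norm_le_l1_cart[of "x - y"] by (simp add: dist_norm mult.commute)
qed

text \<open>Abstracts the fluctuation \<open>f - cell_average p L f\<close> of a function with
  values in [0,1]. The class is stable under translation and dilation when the grid moves
  along.\<close>

definition balanced :: "real ^ 'd \<Rightarrow> real \<Rightarrow> (real ^ 'd \<Rightarrow> real) \<Rightarrow> bool" where
  "balanced p L h \<longleftrightarrow> h \<in> borel_measurable borel \<and> (\<forall>x. \<bar>h x\<bar> \<le> 1) \<and> (\<forall>x. cell_average p L h x = 0)"

section \<open>Regularity, and balanced functions integrated against a fixed weight\<close>

lemma finite_measure_inner_compact_outer_open:
  fixes A :: "'a::euclidean_space set"
  assumes A [measurable]: "A \<in> sets borel" and fin: "emeasure lborel A < \<infinity>" and "0 < (e::real)"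
  obtains K U where "compact K" "open U" "K \<subseteq> A" "A \<subseteq> U" "emeasure lborel (U - K) < ennreal e"
proof -
  obtain U where U: "open U" "A \<subseteq> U" "emeasure lborel (U - A) < ennreal (e / 2)"
    using outer_regular_lborel[OF A, of "e / 2"] \<open>0 < e\<close> by auto
  let ?M = "density lborel (indicator A)"
  have em: "emeasure ?M X = emeasure lborel (A \<inter> X)" if "X \<in> sets borel" for X
    using that by (simp add: emeasure_density indicator_inter_arith[symmetric])
  have "emeasure lborel A = emeasure ?M A" by (simp add: em)
  also have "\<dots> = (SUP K \<in> {K. K \<subseteq> A \<and> compact K}. emeasure ?M K)"
    by (rule inner_regular) (use fin in \<open>auto simp: em\<close>)
  finally have sup: "emeasure lborel A = (SUP K \<in> {K. K \<subseteq> A \<and> compact K}. emeasure ?M K)" .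
  obtain K where K: "K \<subseteq> A" "compact K" "emeasure lborel A < emeasure lborel K + ennreal (e / 2)"
  proof (cases "emeasure lborel A = 0")
    case True
    then show ?thesis using that[of "{}"] \<open>0 < e\<close> by simp
  next
    case False
    define m where "m = measure lborel A"
    have m1: "emeasure lborel A = ennreal m"
      unfolding m_def by (rule emeasure_eq_ennreal_measure) (use fin in auto)
    then have "m \<noteq> 0" using False by auto
    then have m: "emeasure lborel A = ennreal m" "0 < m"
      using m1 by (auto simp: m_def zero_less_measure_iff)
    then have "ennreal (m - e / 2) < emeasure lborel A"
      using \<open>0 < e\<close> by (simp add: ennreal_lessI)
    then obtain K where K: "K \<subseteq> A" "compact K" "ennreal (m - e / 2) < emeasure ?M K"
      by (subst (asm) sup) (auto simp: less_SUP_iff)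
    define k where "k = measure lborel K"
    have "emeasure lborel K \<le> emeasure lborel A" using K by (intro emeasure_mono) auto
    then have k: "emeasure lborel K = ennreal k"
      unfolding k_def using fin by (intro emeasure_eq_ennreal_measure) (auto simp: top_unique)
    have "emeasure ?M K = ennreal k"
      using K k by (simp add: em borel_compact Int_absorb1)
    then have "m - e / 2 < k"
      using K(3) by (metis ennreal_leI linorder_not_le)
    then have "ennreal m < ennreal (k + e / 2)"
      using m by (intro ennreal_lessI) auto
    also have "\<dots> = ennreal k + ennreal (e / 2)"
      using \<open>0 < e\<close> by (simp add: k_def)
    finally show ?thesis using that[of K] K m k by simp
  qed
  have [measurable]: "K \<in> sets borel" "U \<in> sets borel"
    using K U by (auto simp: borel_compact)
  have KA: "emeasure lborel K \<le> emeasure lborel A" using K by (intro emeasure_mono) auto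
  have "emeasure lborel K + emeasure lborel (A - K) = emeasure lborel A"
    using K(1) by (subst plus_emeasure) (auto intro: arg_cong[where f="emeasure lborel"])
  then have AK: "emeasure lborel (A - K) < ennreal (e / 2)"
    using K(3) by (metis ennreal_add_left_cancel_less)
  have "U - K = (U - A) \<union> (A - K)" using K U by auto
  then have "emeasure lborel (U - K) \<le> emeasure lborel (U - A) + emeasure lborel (A - K)"
    by (simp add: emeasure_subadditive)
  also have "\<dots> < ennreal (e / 2) + ennreal (e / 2)"
    using U(3) AK by (intro add_strict_mono) auto
  also have "\<dots> = ennreal e"
    using \<open>0 < e\<close> by (simp flip: ennreal_plus)
  finally show ?thesis using that K U by blast
qed

text \<open>\<open>W\<close> is a union of cells, so its indicator is its own average, and
  adjointness puts the average on \<open>h\<close>, where it vanishes.\<close>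

lemma balanced_integral_cell_invariant:
  fixes W :: "(real ^ 'd) set"
  assumes L: "0 < L" and h: "balanced p L h"
    and W: "\<And>x y. x \<in> W \<Longrightarrow> y \<in> cell p L x \<Longrightarrow> y \<in> W" and fin: "emeasure lborel W < \<infinity>"
  shows "(\<integral>z. indicator W z * h z \<partial>lborel) = 0"
proof -
  have [measurable]: "W \<in> sets borel" using W by (rule cell_invariant_borel)
  have "cell_average p L (indicator W) y = indicator W y" for y
  proof (rule cell_average_cell_constant[OF L])
    fix z assume z: "z \<in> cell p L y"
    then have "z \<in> W \<longleftrightarrow> y \<in> W" using W[of y z] W[of z y] cell_sym[of z p L y] by blast
    then show "indicator W z = indicator W y" by (simp add: indicator_def)
  qed
  moreover have "integrable lborel (indicator W :: real ^ 'd \<Rightarrow> real)"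
    using fin by (simp add: integrable_indicator_iff)
  ultimately show ?thesis
    using cell_average_adjoint[OF L, of "indicator W" h 1 p] h by (simp add: balanced_def)
qed

text \<open>An oscillation lemma of Riemann-Lebesgue type, uniform in the grid and in
  \<open>h\<close>. For an indicator, a union of fine cells fits between a compact and an open
  approximation of the set, and \<open>h\<close> integrates to 0 over that union. Linearity and L1
  limits give the rest.\<close>

lemma balanced_integral_small:
  fixes \<phi> :: "real ^ 'd \<Rightarrow> real"
  assumes "integrable lborel \<phi>" and "0 < \<epsilon>"
  shows "\<exists>\<eta>>0. \<forall>L p h. 0 < L \<longrightarrow> L \<le> \<eta> \<longrightarrow> balanced p L h \<longrightarrow> \<bar>\<integral>z. h z * \<phi> z \<partial>lborel\<bar> \<le> \<epsilon>"
  using assms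
proof (induction \<phi> arbitrary: \<epsilon> rule: integrable_induct)
  case (base A c)
  have [measurable]: "A \<in> sets borel" using base by simp
  define e where "e = \<epsilon> / (\<bar>c\<bar> + 1)"
  have "0 < e" using base by (simp add: e_def)
  have fin: "emeasure lborel A < \<infinity>" using base by simp
  obtain K U where KU: "compact K" "open U" "K \<subseteq> A" "A \<subseteq> U" "emeasure lborel (U - K) < ennreal e"
    using finite_measure_inner_compact_outer_open[OF _ fin \<open>0 < e\<close>] by auto
  have [measurable]: "K \<in> sets borel" "U \<in> sets borel" using KU by (auto simp: borel_compact)
  obtain r where r: "0 < r" "(\<Union>x\<in>K. ball x r) \<subseteq> U"
    using compact_subset_open_imp_ball_epsilon_subset[of K U] KU by blast
  have "\<bar>\<integral>z. h z * (indicator A z *\<^sub>R c) \<partial>lborel\<bar> \<le> \<epsilon>"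
    if L: "0 < L" "L \<le> r / (2 * CARD('d))" and h: "balanced p L h" for L p and h :: "real ^ 'd \<Rightarrow> real"
  proof -
    have [measurable]: "h \<in> borel_measurable borel" and h1: "\<And>x. \<bar>h x\<bar> \<le> 1"
      using h by (auto simp: balanced_def)
    define W where "W = {y. cell p L y \<inter> K \<noteq> {}}"
    have Winv: "y \<in> W" if "x \<in> W" "y \<in> cell p L x" for x y
      using that by (simp add: W_def cell_eq)
    have [measurable]: "W \<in> sets borel" using Winv by (rule cell_invariant_borel)
    \<comment> \<open>\<open>W\<close> collects the cells that touch \<open>K\<close>. A cell has
      diameter at most \<open>L * CARD('d)\<close>, here at most \<open>r / 2\<close>, so none of
      them leaves \<open>U\<close>, and the indicators of \<open>A\<close> and \<open>W\<close>
      differ only on \<open>U - K\<close>.\<close>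
    have KW: "K \<subseteq> W" unfolding W_def using self_in_cell by blast
    have WU: "W \<subseteq> U"
    proof
      fix y assume "y \<in> W"
      then obtain x where x: "x \<in> K" "x \<in> cell p L y" by (auto simp: W_def)
      then have "dist y x \<le> L * CARD('d)" using dist_cell_le[OF L(1)] by blast
      also have "\<dots> \<le> r / 2" using L(2) by (simp add: field_simps)
      also have "\<dots> < r" using r by simp
      finally have "y \<in> ball x r" by (simp add: dist_commute)
      then show "y \<in> U" using r(2) x by blast
    qed
    have UKfin: "emeasure lborel (U - K) < \<infinity>" using KU(5) by (metis infinity_ennreal_def order_less_trans ennreal_less_top)
    have "emeasure lborel W \<le> emeasure lborel (A \<union> (U - K))"
      using WU KU by (intro emeasure_mono) auto
    also have "\<dots> \<le> emeasure lborel A + emeasure lborel (U - K)"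
      by (intro emeasure_subadditive) auto
    also have "\<dots> < \<infinity>" using fin UKfin by (simp add: ennreal_add_less_top)
    finally have Wfin: "emeasure lborel W < \<infinity>" .
    have iA: "integrable lborel (\<lambda>z. indicator A z * h z)" and iW: "integrable lborel (\<lambda>z. indicator W z * h z)"
      by (rule integrable_mult_bounded[where C=1]; use fin Wfin h1 in \<open>simp add: integrable_indicator_iff\<close>)+
    have iUK: "integrable lborel (indicator (U - K) :: real ^ 'd \<Rightarrow> real)"
      using UKfin by (simp add: integrable_indicator_iff)
    have "(\<integral>z. indicator A z * h z \<partial>lborel) = (\<integral>z. indicator A z * h z \<partial>lborel) - (\<integral>z. indicator W z * h z \<partial>lborel)"
      using balanced_integral_cell_invariant[OF L(1) h Winv Wfin] by simp
    also have "\<dots> = (\<integral>z. indicator A z * h z - indicator W z * h z \<partial>lborel)"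
      using iA iW by simp
    also have "\<bar>\<dots>\<bar> \<le> (\<integral>z. indicator (U - K) z \<partial>lborel)"
    proof (rule integral_abs_bound_integral)
      show "\<bar>indicator A z * h z - indicator W z * h z\<bar> \<le> indicator (U - K) z" for z
        using h1[of z] KW WU KU(3,4) by (auto simp: indicator_def)
    qed (use iA iW iUK in auto)
    also have "\<dots> = measure lborel (U - K)" by simp
    also have "\<dots> \<le> e"
      using KU(5) \<open>0 < e\<close> by (simp add: measure_def enn2real_leI less_imp_le)
    finally have le: "\<bar>\<integral>z. indicator A z * h z \<partial>lborel\<bar> \<le> e" .
    have "(\<integral>z. h z * (indicator A z *\<^sub>R c) \<partial>lborel) = (\<integral>z. indicator A z * h z \<partial>lborel) * c"
      by (subst integral_mult_left_zero[symmetric]) (simp add: mult_ac)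
    then have "\<bar>\<integral>z. h z * (indicator A z *\<^sub>R c) \<partial>lborel\<bar> \<le> e * \<bar>c\<bar>"
      using le by (simp add: abs_mult mult_right_mono)
    also have "\<dots> \<le> e * (\<bar>c\<bar> + 1)" using \<open>0 < e\<close> by simp
    also have "\<dots> = \<epsilon>" by (simp add: e_def)
    finally show ?thesis .
  qed
  moreover have "0 < r / (2 * CARD('d))" using r by simp
  ultimately show ?case by blast
next
  case (add f g)
  have half: "0 < \<epsilon> / 2" using \<open>0 < \<epsilon>\<close> by simp
  obtain \<eta> where \<eta>: "\<eta> > 0" "\<And>L p h. 0 < L \<Longrightarrow> L \<le> \<eta> \<Longrightarrow> balanced p L h \<Longrightarrow> \<bar>\<integral>z. h z * f z \<partial>lborel\<bar> \<le> \<epsilon> / 2"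
    using add.IH(1)[OF half] by blast
  obtain \<eta>' where \<eta>': "\<eta>' > 0" "\<And>L p h. 0 < L \<Longrightarrow> L \<le> \<eta>' \<Longrightarrow> balanced p L h \<Longrightarrow> \<bar>\<integral>z. h z * g z \<partial>lborel\<bar> \<le> \<epsilon> / 2"
    using add.IH(2)[OF half] by blast
  have "\<bar>\<integral>z. h z * (f z + g z) \<partial>lborel\<bar> \<le> \<epsilon>"
    if L: "0 < L" "L \<le> min \<eta> \<eta>'" and h: "balanced p L h" for L p h
  proof -
    have h': "h \<in> borel_measurable lborel" "\<And>x. \<bar>h x\<bar> \<le> 1" using h by (auto simp: balanced_def)
    have "(\<integral>z. h z * (f z + g z) \<partial>lborel) = (\<integral>z. h z * f z \<partial>lborel) + (\<integral>z. h z * g z \<partial>lborel)"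
      using integrable_mult_bounded(2)[OF add(1) h'] integrable_mult_bounded(2)[OF add(2) h']
      by (simp add: distrib_left)
    moreover have "\<bar>\<integral>z. h z * f z \<partial>lborel\<bar> \<le> \<epsilon> / 2" "\<bar>\<integral>z. h z * g z \<partial>lborel\<bar> \<le> \<epsilon> / 2"
      using \<eta>(2)[of L p h] \<eta>'(2)[of L p h] L h by auto
    ultimately show ?thesis by linarith
  qed
  then show ?case using \<eta>(1) \<eta>'(1) by (intro exI[of _ "min \<eta> \<eta>'"]) auto
next
  case (lim f s)
  have "(\<lambda>i. \<integral>z. norm (s i z - f z) \<partial>lborel) \<longlonglongrightarrow> (\<integral>z. 0 \<partial>(lborel :: (real ^ 'd) measure))"
  proof (rule integral_dominated_convergence[where w="\<lambda>z. 3 * norm (f z)"])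
    show "AE z in lborel. (\<lambda>i. norm (s i z - f z)) \<longlonglongrightarrow> 0"
      by (intro AE_I2 tendsto_norm_zero LIM_zero) (use lim(2) in auto)
    show "AE z in lborel. norm (norm (s i z - f z)) \<le> 3 * norm (f z)" for i
    proof (rule AE_I2)
      fix z :: "real ^ 'd"
      have "norm (s i z - f z) \<le> norm (s i z) + norm (f z)" by (rule norm_triangle_ineq4)
      then show "norm (norm (s i z - f z)) \<le> 3 * norm (f z)"
        using lim(3)[of z i] by simp
    qed
  qed (use lim(1,4) in auto)
  then have "eventually (\<lambda>i. (\<integral>z. norm (s i z - f z) \<partial>lborel) < \<epsilon> / 2) sequentially"
    using \<open>0 < \<epsilon>\<close> by (intro order_tendstoD) auto
  then obtain i where i: "(\<integral>z. norm (s i z - f z) \<partial>lborel) < \<epsilon> / 2"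
    by (auto simp: eventually_sequentially)
  obtain \<eta> where \<eta>: "\<eta> > 0" "\<And>L p h. 0 < L \<Longrightarrow> L \<le> \<eta> \<Longrightarrow> balanced p L h \<Longrightarrow> \<bar>\<integral>z. h z * s i z \<partial>lborel\<bar> \<le> \<epsilon> / 2"
    using lim.IH[of "\<epsilon> / 2" i] \<open>0 < \<epsilon>\<close> by auto
  have "\<bar>\<integral>z. h z * f z \<partial>lborel\<bar> \<le> \<epsilon>"
    if L: "0 < L" "L \<le> \<eta>" and h: "balanced p L h" for L p h
  proof -
    have h': "h \<in> borel_measurable lborel" "\<And>x. \<bar>h x\<bar> \<le> 1" using h by (auto simp: balanced_def)
    note int = integrable_mult_bounded(2)[OF lim(4) h'] integrable_mult_bounded(2)[OF lim(1) h']
    have "(\<integral>z. h z * f z \<partial>lborel) - (\<integral>z. h z * s i z \<partial>lborel) = (\<integral>z. h z * f z - h z * s i z \<partial>lborel)"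
      using int by simp
    also have "\<bar>\<dots>\<bar> \<le> (\<integral>z. norm (s i z - f z) \<partial>lborel)"
    proof (rule integral_abs_bound_integral)
      fix z
      have "\<bar>h z * f z - h z * s i z\<bar> = \<bar>h z\<bar> * \<bar>s i z - f z\<bar>"
        by (metis abs_minus_commute abs_mult right_diff_distrib)
      also have "\<dots> \<le> 1 * \<bar>s i z - f z\<bar>" using h'(2) by (intro mult_right_mono) auto
      finally show "\<bar>h z * f z - h z * s i z\<bar> \<le> norm (s i z - f z)" by simp
    qed (use int lim(1,4) in auto)
    finally have "\<bar>(\<integral>z. h z * f z \<partial>lborel) - (\<integral>z. h z * s i z \<partial>lborel)\<bar> \<le> (\<integral>z. norm (s i z - f z) \<partial>lborel)" .
    moreover have "\<bar>\<integral>z. h z * s i z \<partial>lborel\<bar> \<le> \<epsilon> / 2" using \<eta>(2)[OF L h] .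
    ultimately show ?thesis using i by linarith
  qed
  then show ?case using \<eta>(1) by blast
qed

lemma lborel_integral_affine:
  fixes f :: "'a::euclidean_space \<Rightarrow> real"
  assumes [measurable]: "f \<in> borel_measurable borel" and "c \<noteq> 0"
  shows "(\<integral>x. f x \<partial>lborel) = \<bar>c\<bar> ^ DIM('a) * (\<integral>x. f (t + c *\<^sub>R x) \<partial>lborel)"
  by (subst lborel_affine[OF \<open>c \<noteq> 0\<close>, of t]) (simp add: integral_density integral_distr)

lemma balanced_affine:
  fixes x :: "real ^ 'd"
  assumes s: "0 < s" and L: "0 < L" and h: "balanced p L h"
  shows "balanced ((1 / s) *\<^sub>R (p - x)) (L / s) (\<lambda>z. h (x + s *\<^sub>R z))"
proof -
  let ?p = "(1 / s) *\<^sub>R (p - x)"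
  have [measurable]: "h \<in> borel_measurable borel" using h by (simp add: balanced_def)
  have idx: "cell_index ?p (L / s) z = cell_index p L (x + s *\<^sub>R z)" for z
  proof
    fix i
    have "(z $ i - (1 / s) * (p $ i - x $ i)) / (L / s) = (x $ i + s * z $ i - p $ i) / L"
      using s L by (simp add: field_simps)
    then show "cell_index ?p (L / s) z i = cell_index p L (x + s *\<^sub>R z) i"
      using L s by (simp add: cell_index_def)
  qed
  have "cell_average ?p (L / s) (\<lambda>z. h (x + s *\<^sub>R z)) z = 0" for z
  proof -
    let ?G = "\<lambda>y. indicator (cell p L (x + s *\<^sub>R z)) y * h y"
    have "(\<integral>y. ?G y \<partial>lborel) = 0"
      using h L by (simp add: balanced_def cell_average_def)
    then have "(\<integral>y. ?G (x + s *\<^sub>R y) \<partial>lborel) = 0"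
      using lborel_integral_affine[of ?G s x] s by simp
    moreover have "indicator (cell ?p (L / s) z) y = (indicator (cell p L (x + s *\<^sub>R z)) (x + s *\<^sub>R y) :: real)" for y
      by (simp add: indicator_def cell_def idx)
    ultimately show ?thesis by (simp add: cell_average_def)
  qed
  then show ?thesis using h by (simp add: balanced_def)
qed

text \<open>Substituting x + s z moves shift and dilation into the grid, and
  \<open>balanced_integral_small\<close>, applied to the density of \<open>N\<close>, is uniform
  over grids. Hence only \<open>L / s\<close> matters, and one \<eta> serves all
  \<open>x\<close>.\<close>

lemma balanced_expectation_small:
  fixes N :: "(real ^ 'd) measure"
  assumes "prob_space N" "sets N = sets borel" "absolutely_continuous lborel N" and "0 < \<epsilon>"
  obtains \<eta> where "\<eta> > 0"
    "\<And>s x L p h. 0 < s \<Longrightarrow> 0 < L \<Longrightarrow> L \<le> \<eta> * s \<Longrightarrow> balanced p L h \<Longrightarrow> \<bar>\<integral>z. h (x + s *\<^sub>R z) \<partial>N\<bar> \<le> \<epsilon>"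
proof -
  interpret N: prob_space N by fact
  obtain D where D: "D \<in> borel_measurable lborel" "AE x in lborel. RN_deriv lborel N x = ennreal (D x)"
    "\<And>x. 0 \<le> D x"
    by (rule sigma_finite_measure.real_RN_deriv[OF sigma_finite_lborel N.finite_measure_axioms assms(3)])
       (use assms(2) in auto)
  have [measurable]: "D \<in> borel_measurable borel" using D by simp
  have "density lborel (RN_deriv lborel N) = N"
    using assms by (intro sigma_finite_measure.density_RN_deriv sigma_finite_lborel) auto
  moreover have "density lborel (RN_deriv lborel N) = density lborel (\<lambda>x. ennreal (D x))"
    using D by (intro density_cong) auto
  ultimately have N: "N = density lborel (\<lambda>x. ennreal (D x))" by simp
  have "emeasure N (space N) = 1" by (rule N.emeasure_space_1)
  then have "(\<integral>\<^sup>+x. ennreal (D x) \<partial>lborel) = 1"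
    by (simp add: N emeasure_density)
  then have "integrable lborel D"
    using D by (intro integrableI_nonneg) auto
  from balanced_integral_small[OF this \<open>0 < \<epsilon>\<close>] obtain \<eta> where \<eta>: "\<eta> > 0"
    "\<And>L p h. 0 < L \<Longrightarrow> L \<le> \<eta> \<Longrightarrow> balanced p L h \<Longrightarrow> \<bar>\<integral>z. h z * D z \<partial>lborel\<bar> \<le> \<epsilon>" by blast
  show ?thesis
  proof (rule that[OF \<eta>(1)])
    fix s L :: real and x p :: "real ^ 'd" and h
    assume s: "0 < s" and L: "0 < L" "L \<le> \<eta> * s" and h: "balanced p L h"
    note b = balanced_affine[OF s L(1) h, of x]
    then have [measurable]: "(\<lambda>z. h (x + s *\<^sub>R z)) \<in> borel_measurable borel" by (simp add: balanced_def)
    have "(\<integral>z. h (x + s *\<^sub>R z) \<partial>N) = (\<integral>z. h (x + s *\<^sub>R z) * D z \<partial>lborel)"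
      using D(3) by (simp add: N integral_density mult.commute)
    then show "\<bar>\<integral>z. h (x + s *\<^sub>R z) \<partial>N\<bar> \<le> \<epsilon>"
      using \<eta>(2)[OF _ _ b] s L by (simp add: field_simps)
  qed
qed

section \<open>The law of a rotated chord\<close>

definition reflection :: "'a::real_inner \<Rightarrow> 'a \<Rightarrow> 'a" where
  "reflection e x = x - (2 * (x \<bullet> e)) *\<^sub>R e"

lemma orthogonal_transformation_reflection:
  assumes "norm e = 1"
  shows "orthogonal_transformation (reflection e)"
  unfolding orthogonal_transformation_def
proof (intro conjI allI)
  show "linear (reflection e)"
    by (rule linearI) (simp_all add: reflection_def inner_simps algebra_simps)
  have "e \<bullet> e = 1" using assms by (simp add: norm_eq_1)
  then show "reflection e v \<bullet> reflection e w = v \<bullet> w" for v w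
    by (simp add: reflection_def inner_simps inner_commute algebra_simps)
qed

lemma reflection_fixes: "x \<bullet> e = 0 \<Longrightarrow> reflection e x = x"
  by (simp add: reflection_def)

definition circle_point :: "'a::real_inner \<Rightarrow> 'a \<Rightarrow> real \<Rightarrow> 'a" where
  "circle_point e1 e2 \<theta> = cos \<theta> *\<^sub>R e1 + sin \<theta> *\<^sub>R e2"

lemma inner_circle_points:
  assumes "norm e1 = 1" "norm e2 = 1" "e1 \<bullet> e2 = 0"
  shows "circle_point e1 e2 a \<bullet> circle_point e1 e2 b = cos (a - b)"
proof -
  have "e1 \<bullet> e1 = 1" "e2 \<bullet> e2 = 1" "e2 \<bullet> e1 = 0" using assms by (simp_all add: norm_eq_1 inner_commute)
  then show ?thesis using assms by (simp add: circle_point_def inner_simps cos_diff)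
qed

lemma norm_circle_point:
  assumes "norm e1 = 1" "norm e2 = 1" "e1 \<bullet> e2 = 0"
  shows "norm (circle_point e1 e2 \<theta>) = 1"
  using inner_circle_points[OF assms, of \<theta> \<theta>] by (simp add: norm_eq_1)

text \<open>With c = \<open>v \<bullet> e1\<close>, the reflection with normal
  \<open>circle_point e1 e2 \<theta>\<close> sends the planar part c e1 of \<open>v\<close> to the
  point of signed radius c at angle 2\<theta> + pi. Two such points end a chord that subtends the
  angle 2(b - a).\<close>

lemma norm_reflection_diff:
  assumes e: "norm e1 = 1" "norm e2 = 1" "e1 \<bullet> e2 = 0" and v: "v \<bullet> e2 = 0"
  shows "norm (reflection (circle_point e1 e2 b) v - reflection (circle_point e1 e2 a) v)
    = \<bar>2 * (v \<bullet> e1) * sin (b - a)\<bar>" (is "norm ?D = _")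
proof -
  let ?c = "v \<bullet> e1"
  have D: "?D = (2 * ?c * cos a) *\<^sub>R circle_point e1 e2 a - (2 * ?c * cos b) *\<^sub>R circle_point e1 e2 b"
    using v by (simp add: reflection_def circle_point_def inner_simps mult_ac)
  have "?D \<bullet> ?D = 4 * ?c\<^sup>2 * ((cos a)\<^sup>2 + (cos b)\<^sup>2 - 2 * cos a * cos b * cos (b - a))"
    unfolding D
    using inner_circle_points[OF e, of a a] inner_circle_points[OF e, of b b]
      inner_circle_points[OF e, of a b] inner_circle_points[OF e, of b a] cos_minus[of "a - b"]
    by (simp add: inner_simps power2_eq_square algebra_simps)
  also have "(cos a)\<^sup>2 + (cos b)\<^sup>2 - 2 * cos a * cos b * cos (b - a) = (sin (b - a))\<^sup>2"
  proof -
    have "(sin a)\<^sup>2 = 1 - (cos a)\<^sup>2" "(sin b)\<^sup>2 = 1 - (cos b)\<^sup>2" by (simp_all add: sin_squared_eq)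
    then show ?thesis by (simp add: cos_diff sin_diff power2_diff power_mult_distrib) (simp add: algebra_simps power2_eq_square)
  qed
  finally have "(norm ?D)\<^sup>2 = (2 * ?c * sin (b - a))\<^sup>2"
    by (simp add: power2_norm_eq_inner power_mult_distrib)
  then show ?thesis by (intro power2_eq_imp_eq[of "norm ?D"]) auto
qed

text \<open>The law of the angle. Differences of two angles from [0,1] lie in [-1,1], inside (-pi/2,
  pi/2), where sin has the differentiable inverse used in
  \<open>negligible_sin_preimage\<close>.\<close>

definition unit_uniform :: "real measure" where
  "unit_uniform = uniform_measure lborel {0..1}"

lemma prob_space_unit_uniform: "prob_space unit_uniform"
  unfolding unit_uniform_def by (rule prob_space_uniform_measure) auto

lemma sets_unit_uniform [simp, measurable_cong]: "sets unit_uniform = sets borel"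
  by (simp add: unit_uniform_def)

lemma AE_unit_uniform:
  assumes "\<And>\<theta>. 0 \<le> \<theta> \<Longrightarrow> \<theta> \<le> 1 \<Longrightarrow> \<theta> \<notin> Z \<Longrightarrow> P \<theta>" "negligible Z"
  shows "AE \<theta> in unit_uniform. P \<theta>"
proof -
  obtain Z' where Z': "Z' \<in> null_sets lborel" "Z \<subseteq> Z'"
    using assms(2) by (auto simp: negligible_iff_null_sets null_sets_completion_iff2)
  from Z'(1) have "AE \<theta> in lborel. \<theta> \<notin> Z'" by (rule AE_not_in)
  then have "AE \<theta> in lborel. \<theta> \<in> {0..1} \<longrightarrow> P \<theta>"
    by eventually_elim (use assms(1) Z' in auto)
  then show ?thesis
    unfolding unit_uniform_def by (rule AE_uniform_measureI[rotated]) auto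
qed

text \<open>The map \<open>\<alpha> + arcsin (y / (2 * c))\<close> recovers \<theta> from the signed
  chord length y and is differentiable for |y| < 2c, so it carries the part of \<open>B\<close> in
  that interval to a null set.\<close>

lemma negligible_sin_preimage:
  fixes B :: "real set"
  assumes B: "negligible B" and c: "0 < c" and \<alpha>: "0 \<le> \<alpha>" "\<alpha> \<le> 1"
  shows "negligible {\<theta> \<in> {0..1}. 2 * c * sin (\<theta> - \<alpha>) \<in> B}"
proof -
  let ?S = "B \<inter> {-(2*c)<..<2*c}"
  have "(\<lambda>y. \<alpha> + arcsin (y / (2 * c))) differentiable_on ?S"
  proof (rule differentiable_at_imp_differentiable_on)
    fix y assume "y \<in> ?S"
    then have "-1 < y / (2 * c)" "y / (2 * c) < 1" using c by (auto simp: field_simps)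
    then have "((\<lambda>y. \<alpha> + arcsin (y / (2 * c))) has_real_derivative
        inverse (sqrt (1 - (y / (2 * c))\<^sup>2)) * (1 / (2 * c))) (at y)"
      using c by (auto intro!: derivative_eq_intros)
    then show "(\<lambda>y. \<alpha> + arcsin (y / (2 * c))) differentiable (at y)"
      unfolding real_differentiable_def by blast
  qed
  moreover have "negligible ?S" using B by (rule negligible_subset) auto
  ultimately have "negligible ((\<lambda>y. \<alpha> + arcsin (y / (2 * c))) ` ?S)"
    by (intro negligible_differentiable_image_negligible) auto
  moreover have "{\<theta> \<in> {0..1}. 2 * c * sin (\<theta> - \<alpha>) \<in> B} \<subseteq> (\<lambda>y. \<alpha> + arcsin (y / (2 * c))) ` ?S"
  proof
    fix \<theta> assume \<theta>: "\<theta> \<in> {\<theta> \<in> {0..1}. 2 * c * sin (\<theta> - \<alpha>) \<in> B}"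
    have "0 \<le> \<theta>" "\<theta> \<le> 1" using \<theta> by auto
    then have pi: "- (pi / 2) < \<theta> - \<alpha>" "\<theta> - \<alpha> < pi / 2" using \<alpha> pi_gt3 by linarith+
    then have "-1 < sin (\<theta> - \<alpha>)" "sin (\<theta> - \<alpha>) < 1"
      using sin_monotone_2pi[of "-(pi/2)" "\<theta> - \<alpha>"] sin_monotone_2pi[of "\<theta> - \<alpha>" "pi/2"]
      by (simp_all add: less_imp_le)
    then have "2 * c * (- 1) < 2 * c * sin (\<theta> - \<alpha>)" "2 * c * sin (\<theta> - \<alpha>) < 2 * c * 1"
      using c by (intro mult_strict_left_mono; simp)+
    then have "2 * c * sin (\<theta> - \<alpha>) \<in> ?S"
      using \<theta> by simp
    moreover have "\<theta> = \<alpha> + arcsin (2 * c * sin (\<theta> - \<alpha>) / (2 * c))"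
      using c pi by (simp add: arcsin_sin)
    ultimately show "\<theta> \<in> (\<lambda>y. \<alpha> + arcsin (y / (2 * c))) ` ?S" by blast
  qed
  ultimately show ?thesis by (rule negligible_subset)
qed

context random_orthogonal
begin

lemma T_measurable' [measurable (raw)]:
  assumes [measurable]: "f \<in> measurable N M" "g \<in> borel_measurable N"
  shows "(\<lambda>x. T (f x) (g x)) \<in> borel_measurable N"
  using measurable_compose[OF measurable_Pair[OF assms] T_measurable] by simp

lemma T_hit_orthogonal:
  assumes r: "orthogonal_transformation r" and [measurable]: "Z \<in> sets borel"
  shows "(\<integral>\<^sup>+w. indicator Z (T w (r x)) \<partial>M) = (\<integral>\<^sup>+w. indicator Z (T w x) \<partial>M)"
proof -
  obtain S where S [measurable]: "S \<in> measurable M M" and "distr M M S = M" "\<forall>w\<in>space M. \<forall>x. T (S w) x = T w (r x)"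
    using T_invariant[OF r] by blast
  have "(\<integral>\<^sup>+w. indicator Z (T w x) \<partial>M) = (\<integral>\<^sup>+w. indicator Z (T w x) \<partial>distr M M S)"
    using \<open>distr M M S = M\<close> by simp
  also have "\<dots> = (\<integral>\<^sup>+w. indicator Z (T (S w) x) \<partial>M)"
    by (rule nn_integral_distr) measurable
  also have "\<dots> = (\<integral>\<^sup>+w. indicator Z (T w (r x)) \<partial>M)"
    by (rule nn_integral_cong) (simp add: \<open>\<forall>w\<in>space M. \<forall>x. T (S w) x = T w (r x)\<close>)
  finally show ?thesis by simp
qed

text \<open>Orthogonal maps act transitively on spheres, so by invariance the probability of hitting
  \<open>Z\<close> is a radial function of the vector.\<close>

lemma T_hit_norm:
  assumes "norm x = norm y" "Z \<in> sets borel"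
  shows "(\<integral>\<^sup>+w. indicator Z (T w x) \<partial>M) = (\<integral>\<^sup>+w. indicator Z (T w y) \<partial>M)"
proof -
  obtain r where r: "orthogonal_transformation r" "r y = x"
    using orthogonal_transformation_exists[of y x] assms(1) by metis
  then show ?thesis using T_hit_orthogonal[OF r(1) assms(2), of y] by simp
qed

text \<open>The law of the image of a fixed vector is singular, but it only depends on the length of that
  vector, and averaging it over the length makes it absolutely continuous.\<close>

lemma AE_T_hit_null:
  assumes Z: "Z \<in> null_sets lborel" and e: "norm e = 1"
  shows "AE t in lborel. (\<integral>\<^sup>+w. indicator Z (T w (t *\<^sub>R e)) \<partial>M) = 0"
proof -
  have [measurable]: "Z \<in> sets borel" using Z by auto
  interpret WL: pair_sigma_finite M "lborel :: (real ^ 'd) measure" ..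
  let ?\<Psi> = "\<lambda>x. \<integral>\<^sup>+w. indicator Z (T w x) \<partial>M"
  have "(\<integral>\<^sup>+x. ?\<Psi> x \<partial>lborel) = (\<integral>\<^sup>+w. (\<integral>\<^sup>+x. indicator Z (T w x) \<partial>lborel) \<partial>M)"
    by (rule WL.Fubini') measurable
  also have "\<dots> = (\<integral>\<^sup>+w. 0 \<partial>M)"
  proof (rule nn_integral_cong)
    fix w assume "w \<in> space M"
    then show "(\<integral>\<^sup>+x. indicator Z (T w x) \<partial>lborel) = 0"
      using Z nn_integral_lborel_orthogonal[OF T_orthogonal, of w "indicator Z"] by (simp add: null_setsD1)
  qed
  finally have zero: "(\<integral>\<^sup>+x. ?\<Psi> x \<partial>lborel) = 0" by simp
  have "(\<integral>\<^sup>+x. (\<integral>\<^sup>+t. ?\<Psi> (t *\<^sub>R x) \<partial>lborel) \<partial>lborel) = (\<integral>\<^sup>+t. (\<integral>\<^sup>+x. ?\<Psi> (t *\<^sub>R x) \<partial>lborel) \<partial>(lborel :: real measure))"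
    by (rule lborel_pair.Fubini'[symmetric]) measurable
  also have "\<dots> = (\<integral>\<^sup>+t. 0 \<partial>(lborel :: real measure))"
  proof (rule nn_integral_cong_AE)
    have "AE t::real in lborel. t \<noteq> 0" by (rule AE_lborel_singleton)
    then show "AE t in lborel. (\<integral>\<^sup>+x. ?\<Psi> (t *\<^sub>R x) \<partial>lborel) = 0"
    proof eventually_elim
      case (elim t)
      then show ?case
        using nn_integral_lborel_affine[of ?\<Psi> t 0] zero by (simp add: ennreal_zero_less_mult_iff)
    qed
  qed
  finally have "(\<integral>\<^sup>+x. (\<integral>\<^sup>+t. ?\<Psi> (t *\<^sub>R x) \<partial>lborel) \<partial>lborel) = 0" by simp
  \<comment> \<open>The double integral vanished because every nonzero dilate of
    \<open>?\<Psi>\<close> still integrates to 0. So along almost every ray almost all lengths are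
    good; one such ray suffices, as \<open>?\<Psi>\<close> is radial.\<close>
  then have "AE x in lborel. (\<integral>\<^sup>+t. ?\<Psi> (t *\<^sub>R x) \<partial>lborel) = 0"
    by (subst (asm) nn_integral_0_iff_AE) auto
  moreover have "AE x::real ^ 'd in lborel. x \<noteq> 0" by (rule AE_lborel_singleton)
  ultimately have "AE x in lborel. (\<integral>\<^sup>+t. ?\<Psi> (t *\<^sub>R x) \<partial>lborel) = 0 \<and> x \<noteq> 0" by eventually_elim simp
  moreover have "ae_filter (lborel :: (real ^ 'd) measure) \<noteq> bot"
    by (simp add: ae_filter_eq_bot_iff)
  ultimately obtain x where x: "(\<integral>\<^sup>+t. ?\<Psi> (t *\<^sub>R x) \<partial>lborel) = 0" "x \<noteq> 0"
    using eventually_happens' by blast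
  have "?\<Psi> (t *\<^sub>R x) = ?\<Psi> ((norm x * t) *\<^sub>R e)" for t
    by (rule T_hit_norm) (simp_all add: e abs_mult)
  then have "AE t in lborel. ?\<Psi> ((norm x * t) *\<^sub>R e) = 0"
    using x(1) by (subst (asm) nn_integral_0_iff_AE) auto
  from AE_borel_affine[OF _ _ this, of "1 / norm x" 0] x(2)
  show ?thesis by (simp add: Measurable.pred_def)
qed

end

section \<open>Integrability of products with a shifted factor\<close>

lemma integrable_lborel_shift:
  fixes h :: "'a::euclidean_space \<Rightarrow> real"
  assumes "integrable lborel h"
  shows "integrable lborel (\<lambda>x. h (x + a))"
proof -
  have "integrable (distr lborel borel ((+) a)) h" using assms by (simp add: lborel_distr_plus)
  then have "integrable lborel (\<lambda>x. h (a + x))" by (rule integrable_distr[rotated]) simp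
  then show ?thesis by (simp add: add.commute)
qed

lemma lborel_integral_shift:
  fixes h :: "'a::euclidean_space \<Rightarrow> real"
  assumes [measurable]: "h \<in> borel_measurable borel"
  shows "(\<integral>x. h (x + a) \<partial>lborel) = (\<integral>x. h x \<partial>lborel)"
  using lborel_integral_affine[of h 1 a] by (simp add: add.commute)

text \<open>For each parameter the shift preserves the L1 norm of \<open>h\<close>, and the
  parameter measure is finite. The counting integrals fit this pattern: one integrable factor, the
  rest bounded by 1.\<close>

lemma integrable_shift_mult_bounded:
  fixes h :: "'a::euclidean_space \<Rightarrow> real" and b :: "'a \<times> 'k \<Rightarrow> real"
  assumes "finite_measure K" and h: "integrable lborel h" and [measurable]: "a \<in> borel_measurable K"
    and b: "b \<in> borel_measurable (lborel \<Otimes>\<^sub>M K)" "\<And>q. \<bar>b q\<bar> \<le> 1"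
  shows "integrable (lborel \<Otimes>\<^sub>M K) (\<lambda>(x, k). h (x + a k) * b (x, k))"
proof -
  interpret K: finite_measure K by fact
  interpret KL: pair_sigma_finite K "lborel :: 'a measure" ..
  interpret LK: pair_sigma_finite "lborel :: 'a measure" K ..
  have [measurable]: "h \<in> borel_measurable borel" using h by simp
  have "integrable (K \<Otimes>\<^sub>M lborel) (\<lambda>(k, x). h (x + a k))"
  proof (rule KL.Fubini_integrable)
    have "(\<integral>x. \<bar>h (x + a k)\<bar> \<partial>lborel) = (\<integral>x. \<bar>h x\<bar> \<partial>lborel)" for k
      by (rule lborel_integral_shift) measurable
    then show "integrable K (\<lambda>k. \<integral>x. norm (case (k, x) of (k, x) \<Rightarrow> h (x + a k)) \<partial>lborel)"
      by simp
    show "AE k in K. integrable lborel (\<lambda>x. case (k, x) of (k, x) \<Rightarrow> h (x + a k))"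
      using integrable_lborel_shift[OF h] by simp
  qed measurable
  from KL.integrable_product_swap[OF this]
  have "integrable (lborel \<Otimes>\<^sub>M K) (\<lambda>q. h (fst q + a (snd q)))"
    by (simp add: case_prod_unfold)
  from integrable_mult_bounded(1)[OF this b]
  show ?thesis by (simp add: case_prod_unfold)
qed

context random_orthogonal
begin

text \<open>Difference of two independent points on one rotated circle; it arises when the square of
  a circle average is written as a double integral.\<close>

definition chord :: "real ^ 'd \<Rightarrow> real ^ 'd \<Rightarrow> real ^ 'd \<Rightarrow> 'w \<times> real \<times> real \<Rightarrow> real ^ 'd" where
  "chord e1 e2 v = (\<lambda>(w, a, b). T w (reflection (circle_point e1 e2 b) v - reflection (circle_point e1 e2 a) v))"

definition chord_law :: "real ^ 'd \<Rightarrow> real ^ 'd \<Rightarrow> real ^ 'd \<Rightarrow> (real ^ 'd) measure" where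
  "chord_law e1 e2 v = distr (M \<Otimes>\<^sub>M (unit_uniform \<Otimes>\<^sub>M unit_uniform)) borel (chord e1 e2 v)"

lemma reflection_circle_point_measurable [measurable]:
  "(\<lambda>a. reflection (circle_point e1 e2 a) (v :: real ^ 'd)) \<in> borel_measurable borel"
  unfolding reflection_def circle_point_def
  by (intro borel_measurable_continuous_onI continuous_intros)

lemma chord_measurable [measurable]:
  "chord e1 e2 v \<in> borel_measurable (M \<Otimes>\<^sub>M (unit_uniform \<Otimes>\<^sub>M unit_uniform))"
  unfolding chord_def case_prod_beta by measurable

lemma prob_space_param: "prob_space (M \<Otimes>\<^sub>M (unit_uniform \<Otimes>\<^sub>M unit_uniform))"
proof -
  interpret U: prob_space unit_uniform by (rule prob_space_unit_uniform)
  interpret UU: pair_prob_space unit_uniform unit_uniform ..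
  interpret P: pair_prob_space M "unit_uniform \<Otimes>\<^sub>M unit_uniform" ..
  show ?thesis by (rule P.prob_space_axioms)
qed

text \<open>For null \<open>Z\<close> the probability that a rotated vector hits \<open>Z\<close>
  depends only on its length and vanishes off a null set \<open>B\<close> of lengths. For each angle
  a, the signed chord length 2c sin(b - a) avoids \<open>B\<close> for almost every b.\<close>

lemma chord_law_absolutely_continuous:
  assumes e: "norm e1 = 1" "norm e2 = 1" "e1 \<bullet> e2 = 0" and v: "v \<bullet> e2 = 0" "0 < v \<bullet> e1"
  shows "absolutely_continuous lborel (chord_law e1 e2 v)"
  unfolding absolutely_continuous_def
proof
  fix Z assume Z: "Z \<in> null_sets (lborel :: (real ^ 'd) measure)"
  then have [measurable]: "Z \<in> sets borel" by auto
  interpret U: prob_space unit_uniform by (rule prob_space_unit_uniform)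
  interpret UU: pair_prob_space unit_uniform unit_uniform ..
  interpret P: pair_prob_space M "unit_uniform \<Otimes>\<^sub>M unit_uniform" ..
  let ?\<Psi> = "\<lambda>x. \<integral>\<^sup>+w. indicator Z (T w x) \<partial>M"
  let ?R = "\<lambda>a. reflection (circle_point e1 e2 a) v"
  let ?c = "v \<bullet> e1"
  have "AE t in lborel. ?\<Psi> (t *\<^sub>R e1) = 0"
    by (rule AE_T_hit_null[OF Z e(1)])
  then obtain B where B: "B \<in> null_sets lborel" "{t. ?\<Psi> (t *\<^sub>R e1) \<noteq> 0} \<subseteq> B"
    by (auto elim!: AE_E simp: null_sets_def)
  then have negB: "negligible B" by (simp add: negligible_iff_null_sets null_sets_completionI)
  have inner0: "AE b in unit_uniform. ?\<Psi> (?R b - ?R a) = 0" if a: "0 \<le> a" "a \<le> 1" for a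
  proof (rule AE_unit_uniform[OF _ negligible_sin_preimage[OF negB v(2) a]])
    fix \<theta> :: real assume "0 \<le> \<theta>" "\<theta> \<le> 1" "\<theta> \<notin> {\<theta> \<in> {0..1}. 2 * ?c * sin (\<theta> - a) \<in> B}"
    then have "?\<Psi> ((2 * ?c * sin (\<theta> - a)) *\<^sub>R e1) = 0" using B(2) by auto
    moreover have "?\<Psi> (?R \<theta> - ?R a) = ?\<Psi> ((2 * ?c * sin (\<theta> - a)) *\<^sub>R e1)"
      by (rule T_hit_norm) (simp_all add: norm_reflection_diff[OF e v(1)] e(1))
    ultimately show "?\<Psi> (?R \<theta> - ?R a) = 0" by simp
  qed
  have "emeasure (chord_law e1 e2 v) Z
      = (\<integral>\<^sup>+q. indicator Z (chord e1 e2 v q) \<partial>(M \<Otimes>\<^sub>M (unit_uniform \<Otimes>\<^sub>M unit_uniform)))"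
    by (subst nn_integral_indicator[symmetric]) (simp_all add: chord_law_def nn_integral_distr del: nn_integral_indicator)
  also have "\<dots> = (\<integral>\<^sup>+r. (\<integral>\<^sup>+w. indicator Z (chord e1 e2 v (w, r)) \<partial>M) \<partial>(unit_uniform \<Otimes>\<^sub>M unit_uniform))"
    by (rule P.nn_integral_snd[symmetric]) measurable
  also have "\<dots> = (\<integral>\<^sup>+r. ?\<Psi> (?R (snd r) - ?R (fst r)) \<partial>(unit_uniform \<Otimes>\<^sub>M unit_uniform))"
    by (simp add: chord_def case_prod_beta)
  also have "\<dots> = (\<integral>\<^sup>+a. (\<integral>\<^sup>+b. ?\<Psi> (?R b - ?R a) \<partial>unit_uniform) \<partial>unit_uniform)"
    by (subst U.nn_integral_fst[symmetric]) simp_all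
  also have "\<dots> = (\<integral>\<^sup>+a. 0 \<partial>unit_uniform)"
  proof (rule nn_integral_cong_AE, rule AE_unit_uniform[of "{}"])
    fix a :: real assume a: "0 \<le> a" "a \<le> 1"
    show "(\<integral>\<^sup>+b. ?\<Psi> (?R b - ?R a) \<partial>unit_uniform) = 0"
      by (subst nn_integral_0_iff_AE) (use inner0[OF a] in \<open>auto simp: measurable_cong_sets[OF sets_unit_uniform refl]\<close>)
  qed simp
  finally show "Z \<in> null_sets (chord_law e1 e2 v)"
    by (simp add: null_sets_def chord_law_def)
qed

text \<open>Expanding the square produces both ends of a chord; moving \<open>x\<close> to one end
  leaves h(x) h(x + s z) with z distributed by the chord law. Integrating over z first brings in
  \<open>small\<close>, and one factor |h| survives.\<close>

lemma circle_average_bound: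
  fixes h :: "real ^ 'd \<Rightarrow> real"
  assumes h: "integrable lborel h" "\<And>x. \<bar>h x\<bar> \<le> 1"
    and small: "\<And>x. \<bar>\<integral>z. h (x + s *\<^sub>R z) \<partial>chord_law e1 e2 v\<bar> \<le> \<delta>"
  defines "H \<equiv> \<lambda>x w. \<integral>a. h (x + s *\<^sub>R T w (reflection (circle_point e1 e2 a) v)) \<partial>unit_uniform"
  shows "integrable lborel (\<lambda>x. \<integral>w. (H x w)\<^sup>2 \<partial>M)"
    and "(\<integral>x. (\<integral>w. (H x w)\<^sup>2 \<partial>M) \<partial>lborel) \<le> \<delta> * (\<integral>x. \<bar>h x\<bar> \<partial>lborel)"
proof -
  interpret U: prob_space unit_uniform by (rule prob_space_unit_uniform)
  interpret UU: pair_prob_space unit_uniform unit_uniform ..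
  interpret P: pair_prob_space M "unit_uniform \<Otimes>\<^sub>M unit_uniform" ..
  let ?K = "M \<Otimes>\<^sub>M (unit_uniform \<Otimes>\<^sub>M unit_uniform)"
  interpret LK: pair_sigma_finite "lborel :: (real ^ 'd) measure" ?K ..
  let ?R = "\<lambda>a. reflection (circle_point e1 e2 a) v"
  have [measurable]: "h \<in> borel_measurable borel" using h by simp
  define g where "g = (\<lambda>x (q :: 'w \<times> real \<times> real).
    h (x + s *\<^sub>R T (fst q) (?R (fst (snd q)))) * h (x + s *\<^sub>R T (fst q) (?R (snd (snd q)))))"
  have gm [measurable]: "(\<lambda>p. g (fst p) (snd p)) \<in> borel_measurable (lborel \<Otimes>\<^sub>M ?K)"
    unfolding g_def by measurable
  have hh: "\<bar>h x * h y\<bar> \<le> 1" for x y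
    using mult_mono[OF h(2)[of x] h(2)[of y]] by (simp add: abs_mult)
  have int_g: "integrable (lborel \<Otimes>\<^sub>M ?K) (case_prod g)"
  proof -
    have "integrable (lborel \<Otimes>\<^sub>M ?K) (\<lambda>(x, q). h (x + s *\<^sub>R T (fst q) (?R (fst (snd q))))
        * (\<lambda>p. h (fst p + s *\<^sub>R T (fst (snd p)) (?R (snd (snd (snd p)))))) (x, q))"
      by (rule integrable_shift_mult_bounded[OF P.finite_measure_axioms h(1)]) (use h(2) in simp_all)
    then show ?thesis by (simp add: g_def)
  qed
  have sq: "(\<integral>w. (H x w)\<^sup>2 \<partial>M) = (\<integral>q. g x q \<partial>?K)" for x
  proof -
    have "(\<integral>q. g x q \<partial>?K) = (\<integral>w. (\<integral>r. g x (w, r) \<partial>(unit_uniform \<Otimes>\<^sub>M unit_uniform)) \<partial>M)"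
      by (rule P.integral_fst'[symmetric], rule P.integrable_const_bound[where B=1])
         (use hh in \<open>auto simp: g_def\<close>)
    also have "\<dots> = (\<integral>w. (H x w)\<^sup>2 \<partial>M)"
    proof (rule Bochner_Integration.integral_cong[OF refl])
      fix w assume w [measurable]: "w \<in> space M"
      have "(\<integral>r. g x (w, r) \<partial>(unit_uniform \<Otimes>\<^sub>M unit_uniform))
          = (\<integral>a. (\<integral>b. g x (w, a, b) \<partial>unit_uniform) \<partial>unit_uniform)"
        by (rule UU.integral_fst'[symmetric], rule UU.integrable_const_bound[where B=1])
           (use hh in \<open>auto simp: g_def\<close>)
      also have "\<dots> = (\<integral>a. h (x + s *\<^sub>R T w (?R a)) * H x w \<partial>unit_uniform)"
        by (simp add: g_def H_def)
      also have "\<dots> = (H x w)\<^sup>2"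
        by (simp add: H_def power2_eq_square)
      finally show "(\<integral>r. g x (w, r) \<partial>(unit_uniform \<Otimes>\<^sub>M unit_uniform)) = (H x w)\<^sup>2" .
    qed
    finally show ?thesis by simp
  qed
  show "integrable lborel (\<lambda>x. \<integral>w. (H x w)\<^sup>2 \<partial>M)"
    unfolding sq by (rule LK.integrable_fst[OF int_g])
  have int2: "integrable (lborel \<Otimes>\<^sub>M ?K) (\<lambda>(x, q). h (x + s *\<^sub>R chord e1 e2 v q) * h x)"
  proof -
    have "integrable (lborel \<Otimes>\<^sub>M ?K) (\<lambda>(x, q). h (x + s *\<^sub>R chord e1 e2 v q) * (\<lambda>p. h (fst p)) (x, q))"
      by (rule integrable_shift_mult_bounded[OF P.finite_measure_axioms h(1)]) (use h(2) in simp_all)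
    then show ?thesis by simp
  qed
  have "(\<integral>x. (\<integral>w. (H x w)\<^sup>2 \<partial>M) \<partial>lborel) = (\<integral>x. (\<integral>q. g x q \<partial>?K) \<partial>lborel)"
    by (simp add: sq)
  also have "\<dots> = (\<integral>q. (\<integral>x. g x q \<partial>lborel) \<partial>?K)"
    by (rule LK.Fubini_integral[OF int_g, symmetric])
  also have "\<dots> = (\<integral>q. (\<integral>x. h (x + s *\<^sub>R chord e1 e2 v q) * h x \<partial>lborel) \<partial>?K)"
  proof (rule Bochner_Integration.integral_cong[OF refl])
    fix q assume "q \<in> space ?K"
    then have w: "fst q \<in> space M" by (auto simp: space_pair_measure)
    then have lin: "linear (T (fst q))" using T_orthogonal orthogonal_transformation_linear by blast
    let ?a = "s *\<^sub>R T (fst q) (?R (fst (snd q)))"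
    let ?f = "\<lambda>x. h (x + s *\<^sub>R chord e1 e2 v q) * h x"
    have "?a + s *\<^sub>R chord e1 e2 v q = s *\<^sub>R T (fst q) (?R (snd (snd q)))"
      using lin by (simp add: chord_def case_prod_beta linear_diff algebra_simps)
    then have "g x q = ?f (x + ?a)" for x
      by (simp add: g_def mult.commute add.assoc)
    then show "(\<integral>x. g x q \<partial>lborel) = (\<integral>x. ?f x \<partial>lborel)"
      using lborel_integral_shift[of ?f ?a] by simp
  qed
  also have "\<dots> = (\<integral>x. (\<integral>q. h (x + s *\<^sub>R chord e1 e2 v q) * h x \<partial>?K) \<partial>lborel)"
    by (rule LK.Fubini_integral[OF int2])
  also have "\<dots> = (\<integral>x. (\<integral>z. h (x + s *\<^sub>R z) \<partial>chord_law e1 e2 v) * h x \<partial>lborel)"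
    by (simp add: chord_law_def integral_distr)
  also have "\<dots> \<le> (\<integral>x. \<delta> * \<bar>h x\<bar> \<partial>lborel)"
  proof (rule integral_mono)
    show "integrable lborel (\<lambda>x. (\<integral>z. h (x + s *\<^sub>R z) \<partial>chord_law e1 e2 v) * h x)"
      using LK.integrable_fst[OF int2] by (simp add: chord_law_def integral_distr)
    show "integrable lborel (\<lambda>x. \<delta> * \<bar>h x\<bar>)" using h by simp
    show "(\<integral>z. h (x + s *\<^sub>R z) \<partial>chord_law e1 e2 v) * h x \<le> \<delta> * \<bar>h x\<bar>" for x
      using mult_right_mono[OF small[of x], of "\<bar>h x\<bar>"] by (simp add: abs_mult[symmetric])
  qed
  finally show "(\<integral>x. (\<integral>w. (H x w)\<^sup>2 \<partial>M) \<partial>lborel) \<le> \<delta> * (\<integral>x. \<bar>h x\<bar> \<partial>lborel)"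
    by simp
qed

end

section \<open>Replacing a factor by its cell average\<close>

text \<open>Weighted AM-GM, used pointwise where Cauchy-Schwarz would be used for integrals; each
  application picks the weight.\<close>

lemma two_abs_mult_le:
  fixes x y \<epsilon> :: real
  assumes "0 < \<epsilon>"
  shows "\<bar>x * y\<bar> \<le> (\<epsilon> * x\<^sup>2 + y\<^sup>2 / \<epsilon>) / 2"
proof -
  have "0 \<le> (\<epsilon> * \<bar>x\<bar> - \<bar>y\<bar>)\<^sup>2 / \<epsilon>" using assms by simp
  also have "\<dots> = \<epsilon> * x\<^sup>2 + y\<^sup>2 / \<epsilon> - 2 * \<bar>x * y\<bar>"
    using assms by (simp add: power2_diff power_mult_distrib abs_mult field_simps power2_eq_square)
  finally show ?thesis by simp
qed

lemma abs_integral_le_integral: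
  fixes f g :: "'a \<Rightarrow> real"
  assumes "integrable M f" "integrable M g" "\<And>x. x \<in> space M \<Longrightarrow> \<bar>f x\<bar> \<le> g x"
  shows "\<bar>\<integral>x. f x \<partial>M\<bar> \<le> (\<integral>x. g x \<partial>M)"
  using assms by (intro order_trans[OF integral_abs_bound integral_mono]) auto

context random_orthogonal
begin

text \<open>Substituting the measure-preserving map that realises the reflection moves
  \<open>v\<close> along its circle and leaves \<open>G\<close> unchanged. \<open>inv\<close> speaks
  of arbitrary pairs \<open>w\<close>, \<open>w'\<close> because that map is known only through its
  effect on \<open>T\<close>.\<close>

lemma integral_invariant_reflection:
  fixes G :: "'w \<Rightarrow> real" and h :: "real ^ 'd \<Rightarrow> real"
  assumes e: "norm e1 = 1" "norm e2 = 1" "e1 \<bullet> e2 = 0"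
    and [measurable]: "G \<in> borel_measurable M" and h [measurable]: "h \<in> borel_measurable borel"
    and inv: "\<And>w w' \<theta>. w \<in> space M \<Longrightarrow> w' \<in> space M \<Longrightarrow>
      (\<And>y. T w' y = T w (reflection (circle_point e1 e2 \<theta>) y)) \<Longrightarrow> G w' = G w"
  shows "(\<integral>w. G w * h (x + s *\<^sub>R T w v) \<partial>M)
    = (\<integral>w. G w * h (x + s *\<^sub>R T w (reflection (circle_point e1 e2 a) v)) \<partial>M)"
proof -
  let ?r = "reflection (circle_point e1 e2 a)"
  have "orthogonal_transformation ?r"
    by (rule orthogonal_transformation_reflection) (rule norm_circle_point[OF e])
  from T_invariant[OF this] obtain S where S [measurable]: "S \<in> measurable M M" and d: "distr M M S = M"
    and TS: "\<And>w y. w \<in> space M \<Longrightarrow> T (S w) y = T w (?r y)"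
    by blast
  have "(\<integral>w. G w * h (x + s *\<^sub>R T w v) \<partial>M) = (\<integral>w. G w * h (x + s *\<^sub>R T w v) \<partial>distr M M S)"
    by (simp add: d)
  also have "\<dots> = (\<integral>w. G (S w) * h (x + s *\<^sub>R T (S w) v) \<partial>M)"
    by (rule integral_distr) measurable
  also have "\<dots> = (\<integral>w. G w * h (x + s *\<^sub>R T w (?r v)) \<partial>M)"
  proof (rule Bochner_Integration.integral_cong[OF refl])
    fix w assume w: "w \<in> space M"
    then have "S w \<in> space M" using measurable_space[OF S] by blast
    then have "G (S w) = G w" using inv[of w "S w" a] TS w by blast
    then show "G (S w) * h (x + s *\<^sub>R T (S w) v) = G w * h (x + s *\<^sub>R T w (?r v))"
      using TS[OF w] by simp
  qed
  finally show ?thesis .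
qed

text \<open>By invariance the shifted factor may be replaced by its circle average. Weighted AM-GM
  separates it from \<open>F\<close>: the part of \<open>F\<close> is at most the volume of
  \<open>B\<close>, and the mean square of the circle average is small by the chord law.\<close>

lemma fine_scale_estimate:
  assumes e: "norm e1 = 1" "norm e2 = 1" "e1 \<bullet> e2 = 0" and v: "v \<bullet> e2 = 0" "0 < v \<bullet> e1" and "0 < \<epsilon>"
  obtains \<eta> where "\<eta> > 0"
    "\<And>s L p h F B. 0 < s \<Longrightarrow> 0 < L \<Longrightarrow> L \<le> \<eta> * s \<Longrightarrow> balanced p L h \<Longrightarrow> integrable lborel h \<Longrightarrow>
      (\<lambda>q. F (fst q) (snd q)) \<in> borel_measurable (lborel \<Otimes>\<^sub>M M) \<Longrightarrow> B \<in> sets borel \<Longrightarrow>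
      emeasure lborel B < \<infinity> \<Longrightarrow> (\<And>x w. \<bar>F x w\<bar> \<le> indicator B x) \<Longrightarrow>
      (\<And>x w w' \<theta>. w \<in> space M \<Longrightarrow> w' \<in> space M \<Longrightarrow>
        (\<And>y. T w' y = T w (reflection (circle_point e1 e2 \<theta>) y)) \<Longrightarrow> F x w' = F x w) \<Longrightarrow>
      \<bar>\<integral>q. F (fst q) (snd q) * h (fst q + s *\<^sub>R T (snd q) v) \<partial>(lborel \<Otimes>\<^sub>M M)\<bar>
        \<le> \<epsilon> * (measure lborel B + (\<integral>x. \<bar>h x\<bar> \<partial>lborel))"
proof -
  interpret U: prob_space unit_uniform by (rule prob_space_unit_uniform)
  interpret K: prob_space "M \<Otimes>\<^sub>M (unit_uniform \<Otimes>\<^sub>M unit_uniform)" by (rule prob_space_param)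
  interpret UM: pair_prob_space unit_uniform M ..
  interpret LM: pair_sigma_finite "lborel :: (real ^ 'd) measure" M ..
  have "prob_space (chord_law e1 e2 v)"
    unfolding chord_law_def by (rule K.prob_space_distr) measurable
  moreover have "sets (chord_law e1 e2 v) = sets borel" by (simp add: chord_law_def)
  moreover note chord_law_absolutely_continuous[OF e v]
  \<comment> \<open>Squared, because the mean square of the circle average gets divided by
    \<epsilon> in the AM-GM step.\<close>
  moreover have "0 < \<epsilon>\<^sup>2" using \<open>0 < \<epsilon>\<close> by simp
  ultimately obtain \<eta> where \<eta>: "\<eta> > 0"
    "\<And>s x L p h. 0 < s \<Longrightarrow> 0 < L \<Longrightarrow> L \<le> \<eta> * s \<Longrightarrow> balanced p L h \<Longrightarrow>
      \<bar>\<integral>z. h (x + s *\<^sub>R z) \<partial>chord_law e1 e2 v\<bar> \<le> \<epsilon>\<^sup>2"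
    by (rule balanced_expectation_small) blast
  show ?thesis
  proof (rule that[OF \<eta>(1)])
    fix s L p B and h :: "real ^ 'd \<Rightarrow> real" and F :: "real ^ 'd \<Rightarrow> 'w \<Rightarrow> real"
    assume s: "0 < s" and L: "0 < L" "L \<le> \<eta> * s" and h: "balanced p L h" "integrable lborel h"
      and F [measurable]: "(\<lambda>q. F (fst q) (snd q)) \<in> borel_measurable (lborel \<Otimes>\<^sub>M M)"
      and B [measurable]: "B \<in> sets borel" "emeasure lborel B < \<infinity>"
      and FB: "\<And>x w. \<bar>F x w\<bar> \<le> indicator B x"
      and inv: "\<And>x w w' \<theta>. w \<in> space M \<Longrightarrow> w' \<in> space M \<Longrightarrow>
        (\<And>y. T w' y = T w (reflection (circle_point e1 e2 \<theta>) y)) \<Longrightarrow> F x w' = F x w"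
    have [measurable]: "h \<in> borel_measurable borel" and h1: "\<And>x. \<bar>h x\<bar> \<le> 1"
      using h by (auto simp: balanced_def)
    have [measurable]: "F x \<in> borel_measurable M" for x
      using measurable_compose[OF measurable_Pair1' F, of x] by simp
    have F1: "\<bar>F x w\<bar> \<le> 1" for x w
      using FB[of x w] by (cases "x \<in> B") auto
    define H where "H = (\<lambda>x w. \<integral>a. h (x + s *\<^sub>R T w (reflection (circle_point e1 e2 a) v)) \<partial>unit_uniform)"
    define I where "I = (\<lambda>x. \<integral>w. F x w * h (x + s *\<^sub>R T w v) \<partial>M)"
    have H_meas [measurable]: "H x \<in> borel_measurable M" for x
      unfolding H_def by measurable
    have H1: "\<bar>H x w\<bar> \<le> 1" if [measurable]: "w \<in> space M" for x w
    proof -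
      have "\<bar>H x w\<bar> \<le> (\<integral>a. 1 \<partial>unit_uniform)"
        unfolding H_def
        by (rule abs_integral_le_integral) (use h1 in \<open>auto intro!: U.integrable_const_bound[where B=1]\<close>)
      then show ?thesis using U.prob_space by simp
    qed
    have I_eq: "I x = (\<integral>w. F x w * H x w \<partial>M)" for x
    proof -
      \<comment> \<open>The reflected integral is the same for each angle, so averaging it over the
        angle changes nothing; exchanging the integrals produces \<open>H\<close>.\<close>
      have "I x = (\<integral>a. (\<integral>w. F x w * h (x + s *\<^sub>R T w (reflection (circle_point e1 e2 a) v)) \<partial>M) \<partial>unit_uniform)"
        using integral_invariant_reflection[OF e, of "F x" h x s v] inv U.prob_space by (simp add: I_def)
      also have "\<dots> = (\<integral>w. (\<integral>a. F x w * h (x + s *\<^sub>R T w (reflection (circle_point e1 e2 a) v)) \<partial>unit_uniform) \<partial>M)"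
      proof (rule UM.Fubini_integral[symmetric], rule UM.integrable_const_bound[where B=1])
        have "\<bar>F x w * h y\<bar> \<le> 1" for w y
          using mult_mono[OF F1[of x w] h1[of y]] by (simp add: abs_mult)
        then show "AE q in unit_uniform \<Otimes>\<^sub>M M. norm (case q of (a, w) \<Rightarrow>
            F x w * h (x + s *\<^sub>R T w (reflection (circle_point e1 e2 a) v))) \<le> 1"
          by (auto simp: case_prod_beta)
      qed measurable
      finally show ?thesis by (simp add: H_def)
    qed
    have int_H: "integrable lborel (\<lambda>x. \<integral>w. (H x w)\<^sup>2 \<partial>M)"
      and H_le: "(\<integral>x. (\<integral>w. (H x w)\<^sup>2 \<partial>M) \<partial>lborel) \<le> \<epsilon>\<^sup>2 * (\<integral>x. \<bar>h x\<bar> \<partial>lborel)"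
      using circle_average_bound[OF h(2) h1 \<eta>(2)[OF s L h(1)]] by (simp_all add: H_def)
    let ?g = "\<lambda>x. (\<epsilon> * indicator B x + (\<integral>w. (H x w)\<^sup>2 \<partial>M) / \<epsilon>) / 2"
    have int_B: "integrable lborel (indicator B :: real ^ 'd \<Rightarrow> real)"
      using B by (simp add: integrable_indicator_iff)
    have int_g: "integrable lborel ?g" using int_H int_B by simp
    have I_le: "\<bar>I x\<bar> \<le> ?g x" for x
    proof -
      have int_H2: "integrable M (\<lambda>w. (H x w)\<^sup>2)"
        by (rule integrable_const_bound[where B=1])
           (use H1 in \<open>auto simp: abs_square_le_1\<close>)
      have "\<bar>I x\<bar> \<le> (\<integral>w. (\<epsilon> * indicator B x + (H x w)\<^sup>2 / \<epsilon>) / 2 \<partial>M)"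
        unfolding I_eq
      proof (rule abs_integral_le_integral)
        show "integrable M (\<lambda>w. F x w * H x w)"
          by (rule integrable_const_bound[where B=1])
             (use F1 H1 in \<open>auto simp: abs_mult intro!: mult_le_one\<close>)
        show "integrable M (\<lambda>w. (\<epsilon> * indicator B x + (H x w)\<^sup>2 / \<epsilon>) / 2)"
          using int_H2 by simp
        fix w
        have "(F x w)\<^sup>2 \<le> indicator B x"
          using FB[of x w] F1[of x w] by (cases "x \<in> B") (auto simp: abs_square_le_1)
        then have "\<epsilon> * (F x w)\<^sup>2 \<le> \<epsilon> * indicator B x"
          using \<open>0 < \<epsilon>\<close> by (intro mult_left_mono) auto
        then show "\<bar>F x w * H x w\<bar> \<le> (\<epsilon> * indicator B x + (H x w)\<^sup>2 / \<epsilon>) / 2"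
          by (intro order_trans[OF two_abs_mult_le[OF \<open>0 < \<epsilon>\<close>]] divide_right_mono add_right_mono) auto
      qed
      also have "\<dots> = ?g x" using int_H2 prob_space by simp
      finally show ?thesis .
    qed
    have "integrable (lborel \<Otimes>\<^sub>M M) (\<lambda>q. F (fst q) (snd q) * h (fst q + s *\<^sub>R T (snd q) v))"
      using integrable_shift_mult_bounded[OF finite_measure_axioms h(2), of "\<lambda>w. s *\<^sub>R T w v" "\<lambda>q. F (fst q) (snd q)"] F1
      by (simp add: case_prod_unfold mult.commute)
    from LM.integral_fst'[OF this] LM.integrable_fst'[OF this]
    have eq: "(\<integral>q. F (fst q) (snd q) * h (fst q + s *\<^sub>R T (snd q) v) \<partial>(lborel \<Otimes>\<^sub>M M)) = (\<integral>x. I x \<partial>lborel)"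
      and int_I: "integrable lborel I"
      by (simp_all add: I_def)
    have "\<bar>\<integral>x. I x \<partial>lborel\<bar> \<le> (\<integral>x. ?g x \<partial>lborel)"
      by (rule abs_integral_le_integral[OF int_I int_g I_le])
    also have "\<dots> = (\<epsilon> * measure lborel B + (\<integral>x. (\<integral>w. (H x w)\<^sup>2 \<partial>M) \<partial>lborel) / \<epsilon>) / 2"
      using int_H int_B by simp
    also have "\<dots> \<le> (\<epsilon> * measure lborel B + \<epsilon> * (\<integral>x. \<bar>h x\<bar> \<partial>lborel)) / 2"
      using H_le \<open>0 < \<epsilon>\<close> by (simp add: field_simps power2_eq_square)
    also have "\<dots> \<le> \<epsilon> * (measure lborel B + (\<integral>x. \<bar>h x\<bar> \<partial>lborel))"
      using \<open>0 < \<epsilon>\<close> by (simp add: distrib_left)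
    finally show "\<bar>\<integral>q. F (fst q) (snd q) * h (fst q + s *\<^sub>R T (snd q) v) \<partial>(lborel \<Otimes>\<^sub>M M)\<bar>
        \<le> \<epsilon> * (measure lborel B + (\<integral>x. \<bar>h x\<bar> \<partial>lborel))"
      unfolding eq .
  qed
qed

text \<open>The crude bound for the range between fine and coarse side: no cancellation, only that
  shifts preserve the L1 norm and \<open>M\<close> has mass 1.\<close>

lemma shifted_integral_le:
  fixes m :: "real ^ 'd \<Rightarrow> real" and F :: "(real ^ 'd) \<times> 'w \<Rightarrow> real"
  assumes m: "integrable lborel m" and [measurable]: "F \<in> borel_measurable (lborel \<Otimes>\<^sub>M M)" and F: "\<And>q. \<bar>F q\<bar> \<le> 1"
  shows "\<bar>\<integral>q. F q * m (fst q + s *\<^sub>R T (snd q) v) \<partial>(lborel \<Otimes>\<^sub>M M)\<bar> \<le> (\<integral>x. \<bar>m x\<bar> \<partial>lborel)"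
proof -
  interpret LM: pair_sigma_finite "lborel :: (real ^ 'd) measure" M ..
  have [measurable]: "m \<in> borel_measurable borel" using m by simp
  have i: "integrable (lborel \<Otimes>\<^sub>M M) (\<lambda>q. F q * m (fst q + s *\<^sub>R T (snd q) v))"
    using integrable_shift_mult_bounded[OF finite_measure_axioms m, of "\<lambda>w. s *\<^sub>R T w v" F] F
    by (simp add: case_prod_unfold mult.commute)
  have i': "integrable (lborel \<Otimes>\<^sub>M M) (\<lambda>(x, w). \<bar>m (x + s *\<^sub>R T w v)\<bar>)"
    using integrable_shift_mult_bounded[OF finite_measure_axioms integrable_abs[OF m], of "\<lambda>w. s *\<^sub>R T w v" "\<lambda>_. 1"]
    by simp
  have "\<bar>\<integral>q. F q * m (fst q + s *\<^sub>R T (snd q) v) \<partial>(lborel \<Otimes>\<^sub>M M)\<bar>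
      \<le> (\<integral>q. (case q of (x, w) \<Rightarrow> \<bar>m (x + s *\<^sub>R T w v)\<bar>) \<partial>(lborel \<Otimes>\<^sub>M M))"
  proof (rule abs_integral_le_integral[OF i i'])
    show "\<bar>F q * m (fst q + s *\<^sub>R T (snd q) v)\<bar> \<le> (case q of (x, w) \<Rightarrow> \<bar>m (x + s *\<^sub>R T w v)\<bar>)" for q
      using mult_right_mono[OF F[of q], of "\<bar>m (fst q + s *\<^sub>R T (snd q) v)\<bar>"]
      by (simp add: case_prod_unfold abs_mult)
  qed
  also have "\<dots> = (\<integral>w. (\<integral>x. \<bar>m (x + s *\<^sub>R T w v)\<bar> \<partial>lborel) \<partial>M)"
    by (rule LM.integral_snd[OF i', symmetric])
  also have "\<dots> = (\<integral>w. (\<integral>x. \<bar>m x\<bar> \<partial>lborel) \<partial>M)"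
  proof -
    have "(\<integral>x. \<bar>m (x + a)\<bar> \<partial>lborel) = (\<integral>x. \<bar>m x\<bar> \<partial>lborel)" for a
      by (rule lborel_integral_shift) measurable
    then show ?thesis by simp
  qed
  also have "\<dots> = (\<integral>x. \<bar>m x\<bar> \<partial>lborel)" using prob_space by simp
  finally show ?thesis .
qed

end

lemma cell_average_unit_interval:
  assumes "0 < L" "f \<in> borel_measurable borel" "\<And>x. 0 \<le> f x" "\<And>x. f x \<le> 1"
  shows "0 \<le> cell_average p L f x" "cell_average p L f x \<le> 1"
proof -
  show "0 \<le> cell_average p L f x" using assms(1,3) by (rule cell_average_nonneg)
  have "\<bar>cell_average p L f x\<bar> \<le> 1"
    by (rule cell_average_bound) (use assms in auto)
  then show "cell_average p L f x \<le> 1" by simp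
qed

lemma integral_cell_average:
  assumes "0 < L" "integrable lborel f"
  shows "(\<integral>x. cell_average p L f x \<partial>lborel) = (\<integral>x. f x \<partial>lborel)"
  using cell_average_adjoint[OF assms, of "\<lambda>_. 1" 1 p] by (simp add: cell_average_one[OF assms(1)])

lemma abs_prod_le_1:
  fixes g :: "'i \<Rightarrow> real"
  assumes "\<And>i. i \<in> I \<Longrightarrow> \<bar>g i\<bar> \<le> 1"
  shows "\<bar>\<Prod>i\<in>I. g i\<bar> \<le> 1"
  using prod_mono[of I "\<lambda>i. \<bar>g i\<bar>" "\<lambda>_. 1"] assms by (simp add: abs_prod)

context random_orthogonal
begin

section \<open>The counting form and the replacement of its factors\<close>

definition count_form ::
  "('n::finite \<Rightarrow> real ^ 'd) \<Rightarrow> ('n \<Rightarrow> real) \<Rightarrow> (real ^ 'd \<Rightarrow> real) \<Rightarrow> ('n \<Rightarrow> real ^ 'd \<Rightarrow> real) \<Rightarrow> real" where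
  "count_form v s f \<Phi> =
    (\<integral>q. f (fst q) * (\<Prod>l\<in>UNIV. \<Phi> l (fst q + s l *\<^sub>R T (snd q) (v l))) \<partial>(lborel \<Otimes>\<^sub>M M))"

definition replacement_error ::
  "('n::finite \<Rightarrow> real ^ 'd) \<Rightarrow> ('n \<Rightarrow> real) \<Rightarrow> (real ^ 'd \<Rightarrow> real) \<Rightarrow> ('n \<Rightarrow> real ^ 'd \<Rightarrow> real) \<Rightarrow> 'n \<Rightarrow> (real ^ 'd \<Rightarrow> real) \<Rightarrow> real" where
  "replacement_error v s f \<Phi> k h =
    (\<integral>q. (f (fst q) * (\<Prod>l\<in>UNIV - {k}. \<Phi> l (fst q + s l *\<^sub>R T (snd q) (v l))))
      * h (fst q + s k *\<^sub>R T (snd q) (v k)) \<partial>(lborel \<Otimes>\<^sub>M M))"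

lemma integrable_first_factor:
  assumes f: "integrable lborel (f :: real ^ 'd \<Rightarrow> real)" and b: "b \<in> borel_measurable (lborel \<Otimes>\<^sub>M M)" "\<And>q. \<bar>b q\<bar> \<le> 1"
  shows "integrable (lborel \<Otimes>\<^sub>M M) (\<lambda>q. f (fst q) * b q)"
  using integrable_shift_mult_bounded[OF finite_measure_axioms f, of "\<lambda>_. 0" b] b by (simp add: case_prod_unfold)

lemma count_form_replace:
  fixes v :: "'n::finite \<Rightarrow> real ^ 'd"
  assumes f: "integrable lborel f"
    and \<Phi> [measurable]: "\<And>l. \<Phi> l \<in> borel_measurable borel" and \<Phi>1: "\<And>l x. \<bar>\<Phi> l x\<bar> \<le> 1"
    and g [measurable]: "g \<in> borel_measurable borel" and g1: "\<And>x. \<bar>g x\<bar> \<le> 1"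
  shows "count_form v s f \<Phi> - count_form v s f (\<Phi>(k := g)) = replacement_error v s f \<Phi> k (\<lambda>x. \<Phi> k x - g x)"
proof -
  let ?y = "\<lambda>l q. fst q + s l *\<^sub>R T (snd q) (v l)"
  have [measurable]: "f \<in> borel_measurable borel" using f by simp
  have upd: "(\<Prod>l\<in>UNIV. (\<Phi>(k := g)) l (?y l q)) = (\<Prod>l\<in>UNIV - {k}. \<Phi> l (?y l q)) * g (?y k q)"
    and old: "(\<Prod>l\<in>UNIV. \<Phi> l (?y l q)) = (\<Prod>l\<in>UNIV - {k}. \<Phi> l (?y l q)) * \<Phi> k (?y k q)" for q
    by (simp_all add: prod.remove[of UNIV k] mult.commute)
  have i1: "integrable (lborel \<Otimes>\<^sub>M M) (\<lambda>q. f (fst q) * (\<Prod>l\<in>UNIV. \<Phi> l (?y l q)))"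
    by (rule integrable_first_factor[OF f]) (use \<Phi>1 in \<open>auto intro!: abs_prod_le_1\<close>)
  have i2: "integrable (lborel \<Otimes>\<^sub>M M) (\<lambda>q. f (fst q) * (\<Prod>l\<in>UNIV. (\<Phi>(k := g)) l (?y l q)))"
  proof (rule integrable_first_factor[OF f])
    show "(\<lambda>q. \<Prod>l\<in>UNIV. (\<Phi>(k := g)) l (?y l q)) \<in> borel_measurable (lborel \<Otimes>\<^sub>M M)"
      unfolding upd by measurable
    show "\<bar>\<Prod>l\<in>UNIV. (\<Phi>(k := g)) l (?y l q)\<bar> \<le> 1" for q
      by (rule abs_prod_le_1) (use \<Phi>1 g1 in auto)
  qed
  have "count_form v s f \<Phi> - count_form v s f (\<Phi>(k := g))
      = (\<integral>q. f (fst q) * (\<Prod>l\<in>UNIV. \<Phi> l (?y l q)) - f (fst q) * (\<Prod>l\<in>UNIV. (\<Phi>(k := g)) l (?y l q)) \<partial>(lborel \<Otimes>\<^sub>M M))"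
    unfolding count_form_def using i1 i2 by (rule Bochner_Integration.integral_diff[symmetric])
  also have "\<dots> = replacement_error v s f \<Phi> k (\<lambda>x. \<Phi> k x - g x)"
    unfolding replacement_error_def upd old by (simp add: algebra_simps)
  finally show ?thesis .
qed

text \<open>Passing from \<open>f\<close> to \<open>g\<close> one factor at a time goes through
  hybrids with some factors already replaced, so \<open>err\<close> is required for arbitrary \<Phi>
  with values in [0,1]. The unshifted factor stays \<open>f\<close> throughout.\<close>

lemma count_form_telescope:
  fixes v :: "'n::finite \<Rightarrow> real ^ 'd"
  assumes f: "integrable lborel f" "\<And>x. 0 \<le> f x" "\<And>x. f x \<le> 1"
    and g: "\<And>k. g k \<in> borel_measurable borel" "\<And>k x. 0 \<le> g k x" "\<And>k x. g k x \<le> 1"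
    and err: "\<And>k \<Phi>. (\<And>l. \<Phi> l \<in> borel_measurable borel) \<Longrightarrow> (\<And>l x. 0 \<le> \<Phi> l x) \<Longrightarrow> (\<And>l x. \<Phi> l x \<le> 1) \<Longrightarrow>
      \<bar>replacement_error v s f \<Phi> k (\<lambda>x. f x - g k x)\<bar> \<le> E k"
  shows "\<bar>count_form v s f (\<lambda>_. f) - count_form v s f g\<bar> \<le> (\<Sum>k\<in>UNIV. E k)"
proof -
  have fm: "f \<in> borel_measurable borel" using f by simp
  define \<Phi> where "\<Phi> = (\<lambda>S l. if l \<in> S then g l else f)"
  have \<Phi>: "\<Phi> S l \<in> borel_measurable borel" "0 \<le> \<Phi> S l x" "\<Phi> S l x \<le> 1" for S l x
    using f g fm by (auto simp: \<Phi>_def)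
  have "\<bar>count_form v s f (\<lambda>_. f) - count_form v s f (\<Phi> S)\<bar> \<le> (\<Sum>k\<in>S. E k)" if "finite S" for S :: "'n set"
    using that
  proof induction
    case empty
    then show ?case by (simp add: \<Phi>_def)
  next
    case (insert k S)
    have "\<Phi> (insert k S) = (\<Phi> S)(k := g k)" by (auto simp: \<Phi>_def)
    then have "count_form v s f (\<Phi> S) - count_form v s f (\<Phi> (insert k S))
        = replacement_error v s f (\<Phi> S) k (\<lambda>x. \<Phi> S k x - g k x)"
      using count_form_replace[OF f(1), of "\<Phi> S" "g k" v s k] \<Phi> g
      by (simp add: abs_le_iff order_trans[OF _ \<Phi>(2)] order_trans[OF _ g(2)])
    also have "(\<lambda>x. \<Phi> S k x - g k x) = (\<lambda>x. f x - g k x)"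
      using insert by (simp add: \<Phi>_def)
    finally have "\<bar>count_form v s f (\<Phi> S) - count_form v s f (\<Phi> (insert k S))\<bar> \<le> E k"
      using err[of "\<Phi> S" k] \<Phi> by simp
    then show ?case using insert by simp
  qed
  from this[of UNIV] show ?thesis by (simp add: \<Phi>_def)
qed

text \<open>The order of quantifiers is the point: one \<eta> works for all lengths, grids,
  functions and supports. It can thus enter the choice of the lacunary sequence, which precedes the
  choice of the cube.\<close>

definition replacement_scale :: "('n::finite \<Rightarrow> real ^ 'd) \<Rightarrow> 'n \<Rightarrow> real \<Rightarrow> real \<Rightarrow> bool" where
  "replacement_scale v k \<epsilon> \<eta> \<longleftrightarrow> (\<forall>s p L N L' f \<Phi> B. 0 < s k \<longrightarrow> 0 < L \<longrightarrow> L \<le> \<eta> * s k \<longrightarrow>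
    0 < N \<longrightarrow> L' = real N * L \<longrightarrow>
    integrable lborel f \<longrightarrow> (\<forall>x. 0 \<le> f x) \<longrightarrow> (\<forall>x. f x \<le> indicator B x) \<longrightarrow>
    B \<in> sets borel \<longrightarrow> emeasure lborel B < \<infinity> \<longrightarrow>
    (\<forall>l. \<Phi> l \<in> borel_measurable borel) \<longrightarrow> (\<forall>l x. 0 \<le> \<Phi> l x) \<longrightarrow> (\<forall>l x. \<Phi> l x \<le> 1) \<longrightarrow>
    \<bar>replacement_error v s f \<Phi> k (\<lambda>x. f x - cell_average p L' f x)\<bar>
      \<le> 3 * \<epsilon> * measure lborel B + (\<integral>x. \<bar>cell_average p L f x - cell_average p L' f x\<bar> \<partial>lborel))"

text \<open>With E and E' the averages at sides \<open>L\<close> and \<open>L'\<close>, the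
  difference f - E' splits into the balanced part f - E, left to the fine-scale estimate, and E -
  E', bounded in L1. The factor 3 is 1 + 2, as f - E has L1 norm at most twice the measure of
  \<open>B\<close>.\<close>

lemma ex_replacement_scale:
  fixes v :: "'n::finite \<Rightarrow> real ^ 'd"
  assumes e: "norm e1 = 1" "norm e2 = 1" "e1 \<bullet> e2 = 0"
    and vk: "v k \<bullet> e2 = 0" "0 < v k \<bullet> e1" and vl: "\<And>l. l \<noteq> k \<Longrightarrow> v l \<bullet> e1 = 0" "\<And>l. l \<noteq> k \<Longrightarrow> v l \<bullet> e2 = 0"
    and "0 < \<epsilon>"
  shows "\<exists>\<eta>>0. replacement_scale v k \<epsilon> \<eta>"
proof -
  obtain \<eta> where \<eta>: "\<eta> > 0"
    "\<And>s L p h F B. 0 < s \<Longrightarrow> 0 < L \<Longrightarrow> L \<le> \<eta> * s \<Longrightarrow> balanced p L h \<Longrightarrow> integrable lborel h \<Longrightarrow>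
      (\<lambda>q. F (fst q) (snd q)) \<in> borel_measurable (lborel \<Otimes>\<^sub>M M) \<Longrightarrow> B \<in> sets borel \<Longrightarrow>
      emeasure lborel B < \<infinity> \<Longrightarrow> (\<And>x w. \<bar>F x w\<bar> \<le> indicator B x) \<Longrightarrow>
      (\<And>x w w' \<theta>. w \<in> space M \<Longrightarrow> w' \<in> space M \<Longrightarrow>
        (\<And>y. T w' y = T w (reflection (circle_point e1 e2 \<theta>) y)) \<Longrightarrow> F x w' = F x w) \<Longrightarrow>
      \<bar>\<integral>q. F (fst q) (snd q) * h (fst q + s *\<^sub>R T (snd q) (v k)) \<partial>(lborel \<Otimes>\<^sub>M M)\<bar>
        \<le> \<epsilon> * (measure lborel B + (\<integral>x. \<bar>h x\<bar> \<partial>lborel))"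
    using fine_scale_estimate[OF e vk \<open>0 < \<epsilon>\<close>] by blast
  show ?thesis
    unfolding replacement_scale_def
  proof (intro exI[of _ \<eta>] conjI allI impI)
    show "0 < \<eta>" by fact
    fix s :: "'n \<Rightarrow> real" and p L L' B and f :: "real ^ 'd \<Rightarrow> real" and \<Phi> :: "'n \<Rightarrow> real ^ 'd \<Rightarrow> real" and N :: nat
    assume s: "0 < s k" and L: "0 < L" "L \<le> \<eta> * s k" and N: "0 < N" "L' = real N * L"
      and if': "integrable lborel f" and fB: "\<forall>x. 0 \<le> f x" "\<forall>x. f x \<le> indicator B x"
      and B [measurable]: "B \<in> sets borel" and Bfin: "emeasure lborel B < \<infinity>"
      and \<Phi>_ass: "\<forall>l. \<Phi> l \<in> borel_measurable borel" "\<forall>l x. 0 \<le> \<Phi> l x" "\<forall>l x. \<Phi> l x \<le> 1"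
    have f: "integrable lborel f" "\<And>x. 0 \<le> f x" "\<And>x. f x \<le> indicator B x"
      and \<Phi> [measurable]: "\<And>l. \<Phi> l \<in> borel_measurable borel"
      and \<Phi>01: "\<And>l x. 0 \<le> \<Phi> l x" "\<And>l x. \<Phi> l x \<le> 1"
      using if' fB \<Phi>_ass by blast+
    have fm [measurable]: "f \<in> borel_measurable borel" using f by simp
    have f1: "f x \<le> 1" for x using f(3)[of x] by (cases "x \<in> B") auto
    have L': "0 < L'" using L N by simp
    let ?E = "cell_average p L f" and ?E' = "cell_average p L' f"
    have E01: "0 \<le> ?E x" "?E x \<le> 1" for x
      using cell_average_unit_interval[OF L(1) fm f(2) f1] by auto
    have iE: "integrable lborel ?E" "integrable lborel ?E'"
      using integrable_cell_average f(1) L(1) L' by blast+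
    define h where "h = (\<lambda>x. f x - ?E x)"
    define m where "m = (\<lambda>x. ?E x - ?E' x)"
    define F where "F = (\<lambda>x w. f x * (\<Prod>l\<in>UNIV - {k}. \<Phi> l (x + s l *\<^sub>R T w (v l))))"
    have ih: "integrable lborel h" and im: "integrable lborel m" using f iE by (simp_all add: h_def m_def)
    have [measurable]: "h \<in> borel_measurable borel" "m \<in> borel_measurable borel" using ih im by simp_all
    have F_meas [measurable]: "(\<lambda>q. F (fst q) (snd q)) \<in> borel_measurable (lborel \<Otimes>\<^sub>M M)"
      unfolding F_def by measurable
    have FB: "\<bar>F x w\<bar> \<le> indicator B x" for x w
    proof -
      have "\<bar>F x w\<bar> = f x * \<bar>\<Prod>l\<in>UNIV - {k}. \<Phi> l (x + s l *\<^sub>R T w (v l))\<bar>"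
        using f(2) by (simp add: F_def abs_mult)
      also have "\<dots> \<le> f x * 1"
        using f(2) \<Phi>01 by (intro mult_left_mono abs_prod_le_1) (auto simp: abs_le_iff intro: order_trans[OF _ \<Phi>01(1)])
      finally show ?thesis using f(3)[of x] by simp
    qed
    have F1: "\<bar>F x w\<bar> \<le> 1" for x w
      using FB[of x w] by (cases "x \<in> B") auto
    have bal: "balanced p L h"
      unfolding balanced_def h_def
    proof (intro conjI allI)
      show "cell_average p L (\<lambda>x. f x - ?E x) x = 0" for x
        by (rule cell_average_centered[OF L(1) fm, of 1]) (use f1 f(2) in auto)
      show "\<bar>f x - ?E x\<bar> \<le> 1" for x
        using f(2)[of x] f1[of x] E01[of x] by (auto simp: abs_le_iff)
    qed measurable
    have inv: "F x w' = F x w" if "\<And>y. T w' y = T w (reflection (circle_point e1 e2 \<theta>) y)" for x w w' \<theta>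
    proof -
      \<comment> \<open>The other vectors are orthogonal to the plane of \<open>e1\<close> and
        \<open>e2\<close>, so a reflection with normal in that plane fixes them.\<close>
      have "T w' (v l) = T w (v l)" if "l \<noteq> k" for l
        using \<open>\<And>y. T w' y = T w (reflection (circle_point e1 e2 \<theta>) y)\<close>[of "v l"] vl[OF that]
        by (simp add: reflection_fixes circle_point_def inner_simps)
      then show ?thesis unfolding F_def by (intro arg_cong2[where f="(*)"] refl prod.cong) auto
    qed
    have "f x \<le> indicator B x" for x using f(3) .
    then have int_f: "(\<integral>x. f x \<partial>lborel) \<le> measure lborel B"
      using integral_mono[OF f(1), of "indicator B"] Bfin by (simp add: integrable_indicator_iff)
    have "(\<integral>x. \<bar>h x\<bar> \<partial>lborel) \<le> (\<integral>x. f x + ?E x \<partial>lborel)"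
    proof (rule integral_mono)
      show "\<bar>h x\<bar> \<le> f x + ?E x" for x
        using f(2)[of x] E01[of x] by (auto simp: h_def)
    qed (use ih f iE in auto)
    also have "\<dots> = 2 * (\<integral>x. f x \<partial>lborel)"
      using f(1) iE integral_cell_average[OF L(1) f(1), of p] by simp
    finally have int_h: "(\<integral>x. \<bar>h x\<bar> \<partial>lborel) \<le> 2 * measure lborel B" using int_f by simp
    have fine: "\<bar>\<integral>q. F (fst q) (snd q) * h (fst q + s k *\<^sub>R T (snd q) (v k)) \<partial>(lborel \<Otimes>\<^sub>M M)\<bar>
        \<le> \<epsilon> * (measure lborel B + (\<integral>x. \<bar>h x\<bar> \<partial>lborel))"
      by (rule \<eta>(2)[OF s L bal ih F_meas B Bfin FB inv])
    also have "\<dots> \<le> \<epsilon> * (measure lborel B + 2 * measure lborel B)"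
      using int_h \<open>0 < \<epsilon>\<close> by (intro mult_left_mono) auto
    finally have fine: "\<bar>\<integral>q. F (fst q) (snd q) * h (fst q + s k *\<^sub>R T (snd q) (v k)) \<partial>(lborel \<Otimes>\<^sub>M M)\<bar>
        \<le> 3 * \<epsilon> * measure lborel B" by simp
    have mid: "\<bar>\<integral>q. F (fst q) (snd q) * m (fst q + s k *\<^sub>R T (snd q) (v k)) \<partial>(lborel \<Otimes>\<^sub>M M)\<bar>
        \<le> (\<integral>x. \<bar>m x\<bar> \<partial>lborel)"
      using shifted_integral_le[OF im F_meas] F1 by simp
    have ints: "integrable (lborel \<Otimes>\<^sub>M M) (\<lambda>q. F (fst q) (snd q) * g (fst q + s k *\<^sub>R T (snd q) (v k)))"
      if "integrable lborel g" for g
      using integrable_shift_mult_bounded[OF finite_measure_axioms that, of "\<lambda>w. s k *\<^sub>R T w (v k)" "\<lambda>q. F (fst q) (snd q)"] F1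
      by (simp add: case_prod_unfold mult.commute)
    have "replacement_error v s f \<Phi> k (\<lambda>x. f x - ?E' x)
        = (\<integral>q. F (fst q) (snd q) * h (fst q + s k *\<^sub>R T (snd q) (v k))
             + F (fst q) (snd q) * m (fst q + s k *\<^sub>R T (snd q) (v k)) \<partial>(lborel \<Otimes>\<^sub>M M))"
      unfolding replacement_error_def F_def h_def m_def by (simp add: algebra_simps)
    also have "\<dots> = (\<integral>q. F (fst q) (snd q) * h (fst q + s k *\<^sub>R T (snd q) (v k)) \<partial>(lborel \<Otimes>\<^sub>M M))
        + (\<integral>q. F (fst q) (snd q) * m (fst q + s k *\<^sub>R T (snd q) (v k)) \<partial>(lborel \<Otimes>\<^sub>M M))"
      by (rule Bochner_Integration.integral_add[OF ints[OF ih] ints[OF im]])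
    finally show "\<bar>replacement_error v s f \<Phi> k (\<lambda>x. f x - ?E' x)\<bar>
        \<le> 3 * \<epsilon> * measure lborel B + (\<integral>x. \<bar>?E x - ?E' x\<bar> \<partial>lborel)"
      using fine mid by (simp add: m_def)
  qed
qed

end

section \<open>Lower bound for the main term\<close>

abbreviation cube :: "real ^ 'd \<Rightarrow> real \<Rightarrow> (real ^ 'd) set" where
  "cube q R \<equiv> cbox q (q + (\<chi> i. R))"

text \<open>Extends the cube by \<open>R\<close> on every side, hence contains each cell of side at
  most \<open>R\<close> that meets the cube. The factors \<open>3 ^ CARD('d)\<close> come from
  here.\<close>

abbreviation big_cube :: "real ^ 'd \<Rightarrow> real \<Rightarrow> (real ^ 'd) set" where
  "big_cube q R \<equiv> cube (q - (\<chi> i. R)) (3 * R)"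

lemma emeasure_cube: "0 \<le> R \<Longrightarrow> emeasure lborel (cube q R) = ennreal (R ^ CARD('d))" for q :: "real ^ 'd"
  by (subst emeasure_halfopen_box_cart[of q "q + (\<chi> i. R)"]) (auto simp: box_subset_cbox)

lemma measure_cube: "0 \<le> R \<Longrightarrow> measure lborel (cube q R) = R ^ CARD('d)" for q :: "real ^ 'd"
  using emeasure_cube[of R q] by (simp add: measure_def)

lemma integrable_indicator_cube: "integrable lborel (indicator (cube q R) :: real ^ 'd \<Rightarrow> real)"
  by (simp add: integrable_indicator_iff emeasure_lborel_cbox_eq)

lemma cell_meets_cube:
  fixes x :: "real ^ 'd"
  assumes "0 < L" "L \<le> R" "y \<in> cell p L x" "y \<in> cube q R"
  shows "x \<in> big_cube q R"
  unfolding mem_box_cart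
proof
  fix i
  have "\<bar>x $ i - y $ i\<bar> \<le> L" using cell_coordinate_le assms by blast
  moreover have "q $ i \<le> y $ i" "y $ i \<le> q $ i + R" using assms(4) by (auto simp: mem_box_cart)
  ultimately show "(q - (\<chi> i. R)) $ i \<le> x $ i \<and> x $ i \<le> (q - (\<chi> i. R) + (\<chi> i. 3 * R)) $ i"
    using \<open>L \<le> R\<close> by (auto simp: abs_le_iff)
qed

lemma cell_average_outside:
  assumes "0 < L" "L \<le> R" and f: "\<And>y. y \<notin> cube q R \<Longrightarrow> f y = 0" and x: "x \<notin> big_cube q R"
  shows "cell_average p L f x = 0"
proof -
  have "indicator (cell p L x) y * f y = 0" for y
    using cell_meets_cube[OF assms(1,2), of y p x q] f[of y] x by (auto simp: indicator_def)
  then have "(\<lambda>y. indicator (cell p L x) y * f y) = (\<lambda>_. 0)" by blast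
  then show ?thesis by (simp only: cell_average_def) simp
qed

text \<open>The sparse set is a union of cells, so adjointness replaces \<open>f\<close> on it by
  its average, which is below \<tau> there and vanishes outside the big cube.\<close>

lemma low_density_integral:
  fixes f :: "real ^ 'd \<Rightarrow> real"
  assumes L: "0 < L" "L \<le> R" and f: "integrable lborel f" "\<And>x. 0 \<le> f x" "\<And>y. y \<notin> cube q R \<Longrightarrow> f y = 0"
    and \<tau>: "0 \<le> \<tau>"
  shows "(\<integral>x. f x * indicator {x. cell_average p L f x < \<tau>} x \<partial>lborel) \<le> \<tau> * (3 * R) ^ CARD('d)"
proof -
  have [measurable]: "f \<in> borel_measurable borel" using f by simp
  let ?Z = "{x. cell_average p L f x < \<tau>}"
  have [measurable]: "?Z \<in> sets borel" by measurable
  have "cell_average p L (indicator ?Z) x = indicator ?Z x" for x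
    by (rule cell_average_cell_constant[OF L(1)]) (simp add: indicator_def cell_average_cell)
  then have "(\<integral>x. f x * indicator ?Z x \<partial>lborel) = (\<integral>x. cell_average p L f x * indicator ?Z x \<partial>lborel)"
    using cell_average_adjoint[OF L(1) f(1), of "indicator ?Z" 1 p] by simp
  also have "\<dots> \<le> (\<integral>x. \<tau> * indicator (big_cube q R) x \<partial>lborel)"
  proof (rule integral_mono)
    show "integrable lborel (\<lambda>x. cell_average p L f x * indicator ?Z x)"
      by (rule integrable_mult_bounded[OF integrable_cell_average[OF L(1) f(1)], of _ 1]) auto
    show "integrable lborel (\<lambda>x. \<tau> * indicator (big_cube q R) x)"
      using integrable_indicator_cube by (rule integrable_mult_right)
    show "cell_average p L f x * indicator ?Z x \<le> \<tau> * indicator (big_cube q R) x" for x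
      using cell_average_outside[OF L f(3), where x=x and p=p] \<tau> by (auto simp: indicator_def)
  qed
  also have "\<dots> = \<tau> * (3 * R) ^ CARD('d)"
    using measure_cube[of "3 * R" "q - (\<chi> i. R)"] L by simp
  finally show ?thesis .
qed

text \<open>Depth \<open>s\<close> in the sup norm; strictness on the upper side only matches the
  half-open cells, so a shift by a vector of norm at most \<open>s\<close> stays in the
  cell.\<close>

definition cell_interior :: "real ^ 'd \<Rightarrow> real \<Rightarrow> real \<Rightarrow> (real ^ 'd) set" where
  "cell_interior p L s = {x. \<forall>i. s \<le> x $ i - (p $ i + L * cell_index p L x i) \<and> x $ i - (p $ i + L * cell_index p L x i) < L - s}"

lemma cell_interior_shift:
  fixes x :: "real ^ 'd"
  assumes L: "0 < L" and x: "x \<in> cell_interior p L s" and y: "norm y \<le> s"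
  shows "x + y \<in> cell p L x"
  unfolding cell_eq_box[OF L]
proof (intro CollectI allI)
  fix i
  have "\<bar>y $ i\<bar> \<le> s" using component_le_norm_cart[of y i] y by linarith
  moreover have "s \<le> x $ i - (p $ i + L * cell_index p L x i) \<and> x $ i - (p $ i + L * cell_index p L x i) < L - s"
    using x by (simp add: cell_interior_def)
  ultimately show "p $ i + L * cell_index p L x i \<le> (x + y) $ i \<and> (x + y) $ i < p $ i + L * cell_index p L x i + L"
    by (auto simp: abs_le_iff)
qed

lemma cell_interior_borel [measurable]: "cell_interior (p :: real ^ 'd) L s \<in> sets borel"
proof -
  have [measurable]: "(\<lambda>x::real ^ 'd. x $ i) \<in> borel_measurable borel" for i
    by (intro borel_measurable_continuous_onI continuous_intros)
  show ?thesis unfolding cell_interior_def by measurable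
qed

text \<open>The deep part of a cell is a cube of side L - 2s; Bernoulli's inequality bounds the
  missing proportion 1 - (1 - 2s/L)^d linearly.\<close>

lemma cell_average_cell_boundary:
  fixes p :: "real ^ 'd"
  assumes L: "0 < L" and s: "0 \<le> s" "2 * s \<le> L"
  shows "cell_average p L (indicator (- cell_interior p L s)) x \<le> 2 * real CARD('d) * (s / L)"
proof -
  let ?I = "cell_interior p L s" and ?d = "CARD('d)"
  define lo where "lo = (\<chi> i. p $ i + L * cell_index p L x i)"
  have eq: "cell p L x \<inter> ?I = {y. \<forall>i. lo $ i + s \<le> y $ i \<and> y $ i < lo $ i + L - s}"
  proof -
    have idx: "p $ i + L * cell_index p L y i = lo $ i" if "y \<in> cell p L x" for y i
      using that by (simp add: cell_def lo_def)
    have cell: "y \<in> cell p L x \<longleftrightarrow> (\<forall>i. lo $ i \<le> y $ i \<and> y $ i < lo $ i + L)" for y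
      using cell_eq_box[OF L, of p x] by (simp add: lo_def)
    show ?thesis
    proof (intro set_eqI iffI)
      fix y assume y: "y \<in> cell p L x \<inter> ?I"
      then have "s \<le> y $ i - lo $ i \<and> y $ i - lo $ i < L - s" for i
      proof -
        have "s \<le> y $ i - (p $ i + L * cell_index p L y i) \<and> y $ i - (p $ i + L * cell_index p L y i) < L - s"
          using y by (simp add: cell_interior_def)
        then show ?thesis using idx[of y i] y by simp
      qed
      then show "y \<in> {y. \<forall>i. lo $ i + s \<le> y $ i \<and> y $ i < lo $ i + L - s}"
        by (simp add: algebra_simps)
    next
      fix y assume y: "y \<in> {y. \<forall>i. lo $ i + s \<le> y $ i \<and> y $ i < lo $ i + L - s}"
      then have *: "lo $ i + s \<le> y $ i" "y $ i < lo $ i + L - s" for i by auto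
      have "lo $ i \<le> y $ i \<and> y $ i < lo $ i + L" for i using *[of i] s by linarith
      then have c: "y \<in> cell p L x" using cell by blast
      moreover have "s \<le> y $ i - lo $ i \<and> y $ i - lo $ i < L - s" for i
        using *[of i] by linarith
      then have "y \<in> ?I" using idx[OF c] by (simp add: cell_interior_def)
      ultimately show "y \<in> cell p L x \<inter> ?I" by blast
    qed
  qed
  have "emeasure lborel (cell p L x \<inter> ?I) = ennreal (\<Prod>i\<in>UNIV. (lo + (\<chi> i. L - s)) $ i - (lo + (\<chi> i. s)) $ i)"
    by (rule emeasure_halfopen_box_cart) (use s in \<open>auto simp: eq mem_box_cart add_diff_eq less_imp_le\<close>)
  then have "emeasure lborel (cell p L x \<inter> ?I) = ennreal ((L - 2 * s) ^ ?d)" by simp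
  then have meas: "measure lborel (cell p L x \<inter> ?I) = (L - 2 * s) ^ ?d" using s by (simp add: measure_def)
  have avg: "cell_average p L (indicator ?I) x = ((L - 2 * s) / L) ^ ?d"
    using meas by (simp add: cell_average_def indicator_inter_arith[symmetric] power_divide)
  have "1 + real ?d * (- (2 * s / L)) \<le> (1 + - (2 * s / L)) ^ ?d"
    by (rule Bernoulli_inequality) (use s L in \<open>simp add: field_simps\<close>)
  also have "1 + - (2 * s / L) = (L - 2 * s) / L" using L by (simp add: field_simps)
  finally have bern: "1 - 2 * real ?d * (s / L) \<le> ((L - 2 * s) / L) ^ ?d" by (simp add: mult_ac)
  have "indicator (- ?I) = (\<lambda>y. 1 - indicator ?I y :: real)" by (auto simp: indicator_def)
  then have "cell_average p L (indicator (- ?I)) x = 1 - cell_average p L (indicator ?I) x"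
    using cell_average_diff[OF L, of "\<lambda>_. 1" "indicator ?I" 1 1 p x] by (simp add: cell_average_one[OF L])
  then show ?thesis using avg bern by simp
qed

text \<open>The cube need not be a union of cells, so it is enlarged to the union \<open>W\<close>
  of the cells it meets; adjointness then averages the boundary cell by cell.\<close>

lemma cell_boundary_integral:
  fixes p :: "real ^ 'd"
  assumes L: "0 < L" "L \<le> R" and s: "0 \<le> s" "2 * s \<le> L"
  shows "(\<integral>x. indicator (cube q R) x * indicator (- cell_interior p L s) x \<partial>lborel)
    \<le> 2 * real CARD('d) * (s / L) * (3 * R) ^ CARD('d)"
proof -
  let ?D = "- cell_interior p L s" and ?C = "2 * real CARD('d) * (s / L)"
  define W where "W = {x. cell p L x \<inter> cube q R \<noteq> {}}"
  have inv: "y \<in> W" if "x \<in> W" "y \<in> cell p L x" for x y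
    using that by (simp add: W_def cell_eq)
  have [measurable]: "W \<in> sets borel" using inv by (rule cell_invariant_borel)
  have [measurable]: "?D \<in> sets borel" by measurable
  have sub: "cube q R \<subseteq> W" unfolding W_def using self_in_cell by blast
  have sup: "W \<subseteq> big_cube q R" unfolding W_def using cell_meets_cube[OF L] by blast
  have iW: "integrable lborel (indicator W :: real ^ 'd \<Rightarrow> real)"
  proof (rule Bochner_Integration.integrable_bound[OF integrable_indicator_cube])
    show "AE x in lborel. norm (indicator W x :: real) \<le> norm (indicator (big_cube q R) x :: real)"
      using sup by (intro AE_I2) (auto simp: indicator_def)
  qed measurable
  have C: "0 \<le> ?C" using L s by simp
  have "(\<integral>x. indicator (cube q R) x * indicator ?D x \<partial>lborel) \<le> (\<integral>x. (indicator W x :: real) * indicator ?D x \<partial>lborel)"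
  proof (rule integral_mono)
    show "integrable lborel (\<lambda>x. indicator (cube q R) x * indicator ?D x :: real)"
      by (rule integrable_mult_bounded[OF integrable_indicator_cube, of _ 1]) auto
    show "integrable lborel (\<lambda>x. indicator W x * indicator ?D x :: real)"
      by (rule integrable_mult_bounded[OF iW, of _ 1]) auto
    show "indicator (cube q R) x * indicator ?D x \<le> (indicator W x * indicator ?D x :: real)" for x
      using sub by (auto simp: indicator_def)
  qed
  also have "\<dots> = (\<integral>x. cell_average p L (indicator W) x * indicator ?D x \<partial>lborel)"
  proof -
    have "cell_average p L (indicator W) x = indicator W x" for x
    proof (rule cell_average_cell_constant[OF L(1)])
      fix y assume "y \<in> cell p L x"
      then have "y \<in> W \<longleftrightarrow> x \<in> W" using inv[of x y] inv[of y x] cell_sym[of y p L x] by blast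
      then show "indicator W y = indicator W x" by (simp add: indicator_def)
    qed
    then show ?thesis by simp
  qed
  also have "\<dots> = (\<integral>x. indicator W x * cell_average p L (indicator ?D) x \<partial>lborel)"
    by (rule cell_average_adjoint[OF L(1) iW, of _ 1, symmetric]) auto
  also have "\<dots> \<le> (\<integral>x. ?C * indicator (big_cube q R) x \<partial>lborel)"
  proof (rule integral_mono)
    show "integrable lborel (\<lambda>x. indicator W x * cell_average p L (indicator ?D) x)"
      by (rule integrable_mult_bounded[OF iW, of _ 1]) (auto intro!: cell_average_bound[OF L(1)])
    show "integrable lborel (\<lambda>x. ?C * indicator (big_cube q R) x)"
      using integrable_indicator_cube by (rule integrable_mult_right)
    show "indicator W x * cell_average p L (indicator ?D) x \<le> ?C * indicator (big_cube q R) x" for x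
      using cell_average_cell_boundary[OF L(1) s, of p x] sup C by (auto simp: indicator_def)
  qed
  also have "\<dots> = ?C * (3 * R) ^ CARD('d)"
    using measure_cube[of "3 * R" "q - (\<chi> i. R)"] L by simp
  finally show ?thesis .
qed

context random_orthogonal
begin

text \<open>A base point in \<open>X\<close> lies in \<open>A\<close> and, for every
  \<open>k\<close>, deep in a cell of density at least \<tau>. No rotation moves the shifted points
  out of these cells, so the integrand is at least \<tau>^n for all \<open>w\<close>, and
  \<open>X\<close> fills at least \<delta> / 2 of the volume.\<close>

lemma structured_lower_bound:
  fixes v :: "'n::finite \<Rightarrow> real ^ 'd"
  assumes A [measurable]: "A \<in> sets borel" and R: "0 < R" and \<delta>: "0 < \<delta>" "\<delta> \<le> 1"
    and dens: "\<delta> * R ^ CARD('d) \<le> measure lborel (A \<inter> cube q R)"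
    and v: "\<And>k. norm (v k) = 1" and L: "\<And>k. 0 < L k" "\<And>k. L k \<le> R"
    and s: "\<And>k. 0 < s k" "\<And>k. s k \<le> \<delta> / (8 * real CARD('d) * real CARD('n) * 3 ^ CARD('d)) * L k"
  defines "\<tau> \<equiv> \<delta> / (4 * real CARD('n) * 3 ^ CARD('d))"
  shows "\<tau> ^ CARD('n) * (\<delta> / 2 * R ^ CARD('d))
    \<le> count_form v s (indicator (A \<inter> cube q R)) (\<lambda>k. cell_average p (L k) (indicator (A \<inter> cube q R)))"
proof -
  let ?n = "CARD('n)" and ?d = "CARD('d)"
  define f where "f = (indicator (A \<inter> cube q R) :: real ^ 'd \<Rightarrow> real)"
  let ?E = "\<lambda>k. cell_average p (L k) f"
  let ?Z = "\<lambda>k. {x. ?E k x < \<tau>}" and ?D = "\<lambda>k. - cell_interior p (L k) (s k)"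
  define X where "X = {x \<in> A \<inter> cube q R. \<forall>k. \<tau> \<le> ?E k x \<and> x \<in> cell_interior p (L k) (s k)}"
  interpret LM: pair_sigma_finite "lborel :: (real ^ 'd) measure" M ..
  have \<tau>: "0 < \<tau>" using \<delta> by (simp add: \<tau>_def)
  have fm [measurable]: "f \<in> borel_measurable borel" by (simp add: f_def)
  have if': "integrable lborel f"
    unfolding f_def
  proof (rule Bochner_Integration.integrable_bound[OF integrable_indicator_cube])
    show "AE x in lborel. norm (indicator (A \<inter> cube q R) x :: real) \<le> norm (indicator (cube q R) x :: real)"
      by (intro AE_I2) (auto simp: indicator_def)
  qed measurable
  have f01: "0 \<le> f x" "f x \<le> 1" for x by (auto simp: f_def)
  have E01: "0 \<le> ?E k x" "?E k x \<le> 1" for k x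
    using cell_average_unit_interval[OF L(1) fm f01] by auto
  have [measurable]: "X \<in> sets borel" "?Z k \<in> sets borel" "?D k \<in> sets borel" for k
    unfolding X_def by measurable
  have iX: "integrable lborel (indicator X :: real ^ 'd \<Rightarrow> real)"
  proof (rule Bochner_Integration.integrable_bound[OF integrable_indicator_cube])
    show "AE x in lborel. norm (indicator X x :: real) \<le> norm (indicator (cube q R) x :: real)"
      by (intro AE_I2) (auto simp: indicator_def X_def)
  qed measurable
  have s2: "2 * s k \<le> L k" and sL: "s k / L k \<le> \<delta> / (8 * real ?d * real ?n * 3 ^ ?d)" for k
  proof -
    show *: "s k / L k \<le> \<delta> / (8 * real ?d * real ?n * 3 ^ ?d)" using s(2)[of k] L(1)[of k] by (simp add: pos_divide_le_eq)
    have "(2::real) \<le> 8 * 1 * 1 * 1" by simp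
    also have "\<dots> \<le> 8 * real ?d * real ?n * 3 ^ ?d"
      by (intro mult_mono) (auto simp: Suc_le_eq)
    finally have "\<delta> / (8 * real ?d * real ?n * 3 ^ ?d) \<le> 1 / 2"
      using \<delta> by (simp add: field_simps)
    with * have "s k / L k \<le> 1 / 2" by linarith
    then show "2 * s k \<le> L k" using L(1)[of k] by (simp add: field_simps)
  qed
  have iZ: "integrable lborel (\<lambda>x. f x * indicator (?Z k) x)" for k
    by (rule integrable_mult_bounded[OF if', of _ 1]) auto
  have iD: "integrable lborel (\<lambda>x. indicator (cube q R) x * indicator (?D k) x :: real)" for k
    by (rule integrable_mult_bounded[OF integrable_indicator_cube, of _ 1]) auto
  \<comment> \<open>Each of the 2n exceptional sets, sparse or near the cell boundary for some
    \<open>k\<close>, may take \<delta> / (4n) of the volume, in total \<delta> / 2. This fixes both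
    \<tau> and the bound on \<open>s k / L k\<close>.\<close>
  have Z_le: "(\<integral>x. f x * indicator (?Z k) x \<partial>lborel) \<le> \<delta> / (4 * real ?n) * R ^ ?d" for k
  proof -
    have "(\<integral>x. f x * indicator (?Z k) x \<partial>lborel) \<le> \<tau> * (3 * R) ^ ?d"
      by (rule low_density_integral[OF L if' f01(1), where q=q]) (use \<tau> in \<open>auto simp: f_def\<close>)
    also have "\<dots> = \<delta> / (4 * real ?n) * R ^ ?d" by (simp add: \<tau>_def power_mult_distrib)
    finally show ?thesis .
  qed
  have D_le: "(\<integral>x. indicator (cube q R) x * indicator (?D k) x \<partial>lborel) \<le> \<delta> / (4 * real ?n) * R ^ ?d" for k
  proof -
    have "(\<integral>x. indicator (cube q R) x * indicator (?D k) x \<partial>lborel) \<le> 2 * real ?d * (s k / L k) * (3 * R) ^ ?d"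
      by (rule cell_boundary_integral[OF L less_imp_le[OF s(1)] s2])
    also have "\<dots> \<le> 2 * real ?d * (\<delta> / (8 * real ?d * real ?n * 3 ^ ?d)) * (3 * R) ^ ?d"
      using sL[of k] R by (intro mult_right_mono mult_left_mono) auto
    also have "\<dots> = \<delta> / (4 * real ?n) * R ^ ?d" by (simp add: power_mult_distrib)
    finally show ?thesis .
  qed
  define zf where "zf = (\<lambda>k x. f x * indicator (?Z k) x)"
  define df where "df = (\<lambda>k x. indicator (cube q R) x * indicator (?D k) x :: real)"
  have nn: "0 \<le> zf k x" "0 \<le> df k x" for k x
    using f01 by (simp_all add: zf_def df_def)
  have izf: "integrable lborel (zf k)" and idf: "integrable lborel (df k)" for k
    using iZ iD by (simp_all add: zf_def df_def)
  have pointwise: "f x \<le> indicator X x + ((\<Sum>k\<in>UNIV. zf k x) + (\<Sum>k\<in>UNIV. df k x))" for x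
  proof -
    have nns: "0 \<le> (\<Sum>k\<in>UNIV. zf k x)" "0 \<le> (\<Sum>k\<in>UNIV. df k x)"
      using nn by (simp_all add: sum_nonneg)
    have zle: "zf k x \<le> (\<Sum>k\<in>UNIV. zf k x)" and dle: "df k x \<le> (\<Sum>k\<in>UNIV. df k x)" for k
      using nn by (intro member_le_sum; simp)+
    show ?thesis
    proof (cases "x \<in> A \<inter> cube q R \<and> x \<notin> X")
      case True
      then have fx: "f x = 1" "x \<in> cube q R" by (auto simp: f_def)
      have X0: "0 \<le> (indicator X x :: real)" by simp
      from True obtain k where "x \<in> ?Z k \<or> x \<in> ?D k" by (auto simp: X_def not_le)
      then show ?thesis
      proof
        assume "x \<in> ?Z k"
        then have "zf k x = 1" using fx by (simp add: zf_def)
        then show ?thesis using zle[of k] nns fx X0 by linarith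
      next
        assume "x \<in> ?D k"
        then have "df k x = 1" using fx by (simp add: df_def)
        then show ?thesis using dle[of k] nns fx X0 by linarith
      qed
    next
      case False
      then have "f x \<le> indicator X x" by (auto simp: f_def indicator_def)
      then show ?thesis using nns by linarith
    qed
  qed
  have "\<delta> * R ^ ?d - (\<delta> / 4 * R ^ ?d + \<delta> / 4 * R ^ ?d) \<le> measure lborel X"
  proof -
    have "\<delta> * R ^ ?d \<le> (\<integral>x. f x \<partial>lborel)" using dens by (simp add: f_def)
    also have "\<dots> \<le> (\<integral>x. indicator X x + ((\<Sum>k\<in>UNIV. zf k x) + (\<Sum>k\<in>UNIV. df k x)) \<partial>lborel)"
      by (rule integral_mono[OF if' _ pointwise]) (use iX izf idf in simp)
    also have "\<dots> = measure lborel X + ((\<Sum>k\<in>UNIV. \<integral>x. zf k x \<partial>lborel) + (\<Sum>k\<in>UNIV. \<integral>x. df k x \<partial>lborel))"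
      using iX izf idf by simp
    also have "\<dots> \<le> measure lborel X + ((\<Sum>k\<in>(UNIV::'n set). \<delta> / (4 * real ?n) * R ^ ?d) + (\<Sum>k\<in>(UNIV::'n set). \<delta> / (4 * real ?n) * R ^ ?d))"
      using Z_le D_le by (intro add_left_mono add_mono sum_mono) (auto simp: zf_def df_def)
    finally show ?thesis by simp
  qed
  then have X: "\<delta> / 2 * R ^ ?d \<le> measure lborel X" by (simp add: field_simps)
  have "\<tau> ^ ?n * (\<delta> / 2 * R ^ ?d) \<le> \<tau> ^ ?n * measure lborel X"
    using X \<tau> by (intro mult_left_mono) auto
  also have "\<dots> = (\<integral>z. indicator X (fst z) * \<tau> ^ ?n \<partial>(lborel \<Otimes>\<^sub>M M))"
  proof -
    have "integrable (lborel \<Otimes>\<^sub>M M) (\<lambda>z. indicator X (fst z) * 1 :: real)"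
      by (rule integrable_first_factor[OF iX]) auto
    from LM.integral_fst'[OF this] show ?thesis
      using prob_space by simp
  qed
  also have "\<dots> \<le> count_form v s f ?E"
    unfolding count_form_def
  proof (rule integral_mono)
    have "\<tau> \<le> 1" 
    proof -
      have "(1::real) * 1 * 1 \<le> 4 * real ?n * 3 ^ ?d" by (intro mult_mono) (auto simp: Suc_le_eq)
      then show ?thesis using \<delta> by (simp add: \<tau>_def field_simps)
    qed
    then show "integrable (lborel \<Otimes>\<^sub>M M) (\<lambda>z. indicator X (fst z) * \<tau> ^ ?n)"
      by (intro integrable_first_factor[OF iX]) (use \<tau> in \<open>auto simp: power_le_one\<close>)
    show "integrable (lborel \<Otimes>\<^sub>M M) (\<lambda>z. f (fst z) * (\<Prod>l\<in>UNIV. ?E l (fst z + s l *\<^sub>R T (snd z) (v l))))"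
      by (rule integrable_first_factor[OF if']) (use E01 in \<open>auto intro!: abs_prod_le_1\<close>)
    fix z assume "z \<in> space (lborel \<Otimes>\<^sub>M M :: ((real ^ 'd) \<times> 'w) measure)"
    then have w: "snd z \<in> space M" by (auto simp: space_pair_measure)
    show "indicator X (fst z) * \<tau> ^ ?n \<le> f (fst z) * (\<Prod>l\<in>UNIV. ?E l (fst z + s l *\<^sub>R T (snd z) (v l)))"
    proof (cases "fst z \<in> X")
      case True
      have "\<tau> \<le> ?E l (fst z + s l *\<^sub>R T (snd z) (v l))" for l
      proof -
        have "norm (s l *\<^sub>R T (snd z) (v l)) \<le> s l"
          using T_orthogonal[OF w] v[of l] s(1)[of l] by (simp add: orthogonal_transformation)
        then have "fst z + s l *\<^sub>R T (snd z) (v l) \<in> cell p (L l) (fst z)"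
          using True by (intro cell_interior_shift[OF L(1)]) (auto simp: X_def)
        then show ?thesis using True by (simp add: cell_average_cell X_def)
      qed
      then have "(\<Prod>l\<in>(UNIV::'n set). \<tau>) \<le> (\<Prod>l\<in>UNIV. ?E l (fst z + s l *\<^sub>R T (snd z) (v l)))"
        using \<tau> by (intro prod_mono) auto
      moreover have "f (fst z) = 1" using True by (simp add: X_def f_def)
      ultimately show ?thesis using True by simp
    next
      case False
      then show ?thesis using E01 f01 by (auto intro!: mult_nonneg_nonneg prod_nonneg)
    qed
  qed
  finally show ?thesis unfolding f_def .
qed

end

section \<open>Energy decrement and conclusion\<close>

text \<open>AM-GM with weight \<alpha> against the indicator of the big cube, outside which both
  averages vanish, trades the L1 norm for a mean square, and the Pythagorean identity makes that an
  energy drop.\<close>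

lemma cell_average_L1_diff:
  fixes f :: "real ^ 'd \<Rightarrow> real"
  assumes L: "0 < L" "0 < N" "L' = real N * L" "L' \<le> R"
    and f: "integrable lborel f" "\<And>x. \<bar>f x\<bar> \<le> 1" "\<And>y. y \<notin> cube q R \<Longrightarrow> f y = 0" and \<alpha>: "0 < \<alpha>"
  shows "(\<integral>x. \<bar>cell_average p L f x - cell_average p L' f x\<bar> \<partial>lborel)
    \<le> (\<alpha> * (3 * R) ^ CARD('d)
        + ((\<integral>x. (cell_average p L f x)\<^sup>2 \<partial>lborel) - (\<integral>x. (cell_average p L' f x)\<^sup>2 \<partial>lborel)) / \<alpha>) / 2"
proof -
  let ?E = "cell_average p L f" and ?E' = "cell_average p L' f"
  let ?Q = "indicator (big_cube q R) :: real ^ 'd \<Rightarrow> real"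
  have L': "0 < L'" "L \<le> R" "0 \<le> R"
  proof -
    show "0 < L'" using L by simp
    have "1 * L \<le> real N * L" using L by (intro mult_right_mono) auto
    then show "L \<le> R" "0 \<le> R" using L by linarith+
  qed
  have [measurable]: "f \<in> borel_measurable borel" using f by simp
  have iE: "integrable lborel ?E" "integrable lborel ?E'"
    using integrable_cell_average f(1) L(1) L'(1) by blast+
  have i2: "integrable lborel (\<lambda>x. (?E x - ?E' x)\<^sup>2)"
  proof -
    have "\<bar>?E x - ?E' x\<bar> \<le> 2" for x
      using cell_average_bound[OF L(1), of f 1 p x] cell_average_bound[OF L'(1), of f 1 p x] f(2)
      by (simp add: abs_le_iff)
    then show ?thesis
      using integrable_mult_bounded(1)[of lborel "\<lambda>x. ?E x - ?E' x" "\<lambda>x. ?E x - ?E' x" 2] iE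
      by (simp add: power2_eq_square)
  qed
  have "(\<integral>x. \<bar>?E x - ?E' x\<bar> \<partial>lborel) \<le> (\<integral>x. (\<alpha> * ?Q x + (?E x - ?E' x)\<^sup>2 / \<alpha>) / 2 \<partial>lborel)"
  proof (rule integral_mono)
    show "integrable lborel (\<lambda>x. (\<alpha> * ?Q x + (?E x - ?E' x)\<^sup>2 / \<alpha>) / 2)"
      using i2 integrable_indicator_cube[of "q - (\<chi> i. R)" "3 * R"] by simp
    show "\<bar>?E x - ?E' x\<bar> \<le> (\<alpha> * ?Q x + (?E x - ?E' x)\<^sup>2 / \<alpha>) / 2" for x
    proof (cases "x \<in> big_cube q R")
      case True
      then show ?thesis using two_abs_mult_le[OF \<alpha>, of 1 "?E x - ?E' x"] by simp
    next
      case False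
      then have "?E x = 0" "?E' x = 0"
        using cell_average_outside[OF L(1) L'(2) f(3), where x=x and p=p]
          cell_average_outside[OF L'(1) L(4) f(3), where x=x and p=p] by auto
      then show ?thesis using False by simp
    qed
  qed (use iE in simp)
  also have "\<dots> = (\<alpha> * (3 * R) ^ CARD('d) + (\<integral>x. (?E x - ?E' x)\<^sup>2 \<partial>lborel) / \<alpha>) / 2"
    using i2 integrable_indicator_cube[of "q - (\<chi> i. R)" "3 * R"] measure_cube[of "3 * R" "q - (\<chi> i. R)"] L'(3)
    by simp
  finally show ?thesis
    unfolding cell_average_energy_diff[OF L(1-3) f(1,2), of p] .
qed

lemma cell_average_energy_mono:
  fixes f :: "real ^ 'd \<Rightarrow> real"
  assumes "0 < L" "0 < N" "L' = real N * L" "integrable lborel f" "\<And>x. \<bar>f x\<bar> \<le> 1"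
  shows "(\<integral>x. (cell_average p L' f x)\<^sup>2 \<partial>lborel) \<le> (\<integral>x. (cell_average p L f x)\<^sup>2 \<partial>lborel)"
proof -
  have "0 \<le> (\<integral>x. (cell_average p L f x - cell_average p L' f x)\<^sup>2 \<partial>lborel)" by simp
  then show ?thesis unfolding cell_average_energy_diff[OF assms, of p] by simp
qed

lemma cell_average_energy_le:
  fixes f :: "real ^ 'd \<Rightarrow> real"
  assumes L: "0 < L" and f: "integrable lborel f" "\<And>x. 0 \<le> f x" "\<And>x. f x \<le> 1"
  shows "(\<integral>x. (cell_average p L f x)\<^sup>2 \<partial>lborel) \<le> (\<integral>x. f x \<partial>lborel)"
proof -
  have fm [measurable]: "f \<in> borel_measurable borel" using f by simp
  have f1: "\<bar>f x\<bar> \<le> 1" for x using f(2)[of x] f(3)[of x] by simp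
  note E01 = cell_average_unit_interval[OF L fm f(2,3), where p=p]
  have "(\<integral>x. (cell_average p L f x)\<^sup>2 \<partial>lborel) = (\<integral>x. cell_average p L f x * f x \<partial>lborel)"
    by (rule cell_average_energy_eq[OF L, of 1 L]) (use f f1 in auto)
  also have "\<dots> \<le> (\<integral>x. f x \<partial>lborel)"
  proof (rule integral_mono)
    show "integrable lborel (\<lambda>x. cell_average p L f x * f x)"
      by (rule integrable_mult_bounded[OF f(1), of _ 1]) (use E01 in auto)
    show "cell_average p L f x * f x \<le> f x" for x
      using mult_right_mono[OF E01(2), of "f x" x] f(2) by simp
  qed fact
  finally show ?thesis .
qed

text \<open>Integer exponents allow sides on both sides of 1. Of two such sides the larger is an
  integer multiple of the smaller, so grids with a common corner nest.\<close>

definition dyadic :: "int \<Rightarrow> real" where "dyadic m = 2 powr real_of_int m"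

lemma dyadic_pos [simp]: "0 < dyadic m" by (simp add: dyadic_def)

lemma dyadic_le_iff [simp]: "dyadic m \<le> dyadic m' \<longleftrightarrow> m \<le> m'" by (simp add: dyadic_def)

lemma dyadic_multiple:
  assumes "m \<le> m'"
  obtains N :: nat where "0 < N" "dyadic m' = real N * dyadic m"
proof
  show "0 < (2::nat) ^ nat (m' - m)" by simp
  show "dyadic m' = real (2 ^ nat (m' - m)) * dyadic m"
    using assms by (simp add: dyadic_def powr_realpow[symmetric] powr_add[symmetric])
qed

lemma ex_dyadic_below:
  assumes "0 < y"
  obtains m where "dyadic m \<le> y" "y < 2 * dyadic m"
proof
  let ?m = "\<lfloor>log 2 y\<rfloor>"
  have "2 powr real_of_int ?m \<le> 2 powr (log 2 y)" by simp
  then show "dyadic ?m \<le> y" using assms by (simp add: dyadic_def)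
  have "2 powr (log 2 y) < 2 powr (real_of_int ?m + 1)" by (simp add: powr_less_cancel_iff)
  then show "y < 2 * dyadic ?m" using assms by (simp add: dyadic_def powr_add)
qed

text \<open>One dilation of t has to enlarge all lengths \<open>t powr a k * b k\<close> by the
  factor \<open>C\<close>, although the exponents differ. For one \<open>k\<close>, the dilation
  \<open>C powr (1 / a k)\<close> does it; their sum, with \<open>C\<close> raised to at least 1,
  dominates them all.\<close>

lemma ex_large_powr:
  fixes a :: "'n::finite \<Rightarrow> real"
  assumes "\<And>k. 0 < a k"
  obtains Q where "1 \<le> Q" "\<And>k. C \<le> Q powr a k"
proof -
  define C' where "C' = max C 1"
  define Q where "Q = (\<Sum>k\<in>UNIV. C' powr (1 / a k))"
  have le: "C' powr (1 / a k) \<le> Q" for k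
    unfolding Q_def by (rule member_le_sum) auto
  have "1 \<le> C' powr (1 / a k)" for k
    using assms[of k] ge_one_powr_ge_zero[of C' "1 / a k"] by (simp add: C'_def less_imp_le)
  then have "1 \<le> Q" using le order_trans by blast
  moreover have "C \<le> Q powr a k" for k
  proof -
    have "C \<le> C'" by (simp add: C'_def)
    also have "C' = (C' powr (1 / a k)) powr a k"
      using assms[of k] by (simp add: powr_powr C'_def)
    also have "\<dots> \<le> Q powr a k"
      using le[of k] assms[of k] by (intro powr_mono2) auto
    finally show ?thesis .
  qed
  ultimately show ?thesis using that by blast
qed

lemma ex_average_le:
  fixes g :: "nat \<Rightarrow> real"
  assumes "0 < J" "(\<Sum>j<J. g j) \<le> C"
  obtains j where "j < J" "g j \<le> C / real J"
proof -
  have "\<exists>j<J. g j \<le> C / real J"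
  proof (rule ccontr)
    assume "\<not> ?thesis"
    then have "(\<Sum>j<J. C / real J) < (\<Sum>j<J. g j)"
      using \<open>0 < J\<close> by (intro sum_strict_mono) (auto simp: not_le)
    then show False using assms by simp
  qed
  then show ?thesis using that by blast
qed

context random_orthogonal
begin

text \<open>Excludes only the copies placed by the maps \<open>T w\<close>, which is enough for the
  counting integrand to vanish pointwise; a scale that is not bad supplies an explicit
  \<open>x\<close> and \<open>w\<close>.\<close>

definition is_bad_scale :: "(real ^ 'd) set \<Rightarrow> ('n::finite \<Rightarrow> real ^ 'd) \<Rightarrow> ('n \<Rightarrow> real) \<Rightarrow> bool" where
  "is_bad_scale A v s \<longleftrightarrow> (\<forall>x\<in>A. \<forall>w\<in>space M. \<exists>k. x + s k *\<^sub>R T w (v k) \<notin> A)"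

lemma count_form_bad_scale:
  assumes "is_bad_scale A v s" "\<And>x. x \<notin> A \<Longrightarrow> f x = 0"
  shows "count_form v s f (\<lambda>_. f) = 0"
proof -
  have "f (fst z) * (\<Prod>l\<in>UNIV. f (fst z + s l *\<^sub>R T (snd z) (v l))) = 0"
    if "z \<in> space (lborel \<Otimes>\<^sub>M M)" for z
  proof (cases "fst z \<in> A")
    case True
    moreover have "snd z \<in> space M" using that by (auto simp: space_pair_measure)
    ultimately obtain k where "fst z + s k *\<^sub>R T (snd z) (v k) \<notin> A"
      using assms(1) by (auto simp: is_bad_scale_def)
    then show ?thesis using assms(2) by auto
  qed (simp add: assms(2))
  then have "count_form v s f (\<lambda>_. f) = (\<integral>z. 0 \<partial>((lborel :: (real ^ 'd) measure) \<Otimes>\<^sub>M M))"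
    unfolding count_form_def by (intro Bochner_Integration.integral_cong refl)
  then show ?thesis by simp
qed

theorem bad_scales_bounded:
  fixes v :: "'n::finite \<Rightarrow> real ^ 'd"
  assumes A [measurable]: "A \<in> sets borel"
    and \<delta>: "0 < \<delta>" "\<delta> \<le> 1"
    and dens: "\<And>R0. \<exists>R\<ge>R0. \<exists>q. \<delta> * R ^ CARD('d) \<le> measure lborel (A \<inter> cube q R)"
    and v: "\<And>k. norm (v k) = 1"
    and frame: "\<And>k. \<exists>e1 e2. norm e1 = 1 \<and> norm e2 = 1 \<and> e1 \<bullet> e2 = 0 \<and> v k \<bullet> e2 = 0 \<and> 0 < v k \<bullet> e1
      \<and> (\<forall>l. l \<noteq> k \<longrightarrow> v l \<bullet> e1 = 0 \<and> v l \<bullet> e2 = 0)"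
    and a: "\<And>k. 0 < a k" and b: "\<And>k. 0 < b k"
  shows "\<exists>t0>0. \<forall>t\<ge>t0. \<not> is_bad_scale A v (\<lambda>k. t powr a k * b k)"
proof (rule ccontr)
  assume "\<not> ?thesis"
  then have bad: "\<exists>t\<ge>t0. is_bad_scale A v (\<lambda>k. t powr a k * b k)" if "0 < t0" for t0
    using that by auto
  let ?n = "CARD('n)" and ?d = "CARD('d)"
  define \<tau> where "\<tau> = \<delta> / (4 * real ?n * 3 ^ ?d)"
  \<comment> \<open>\<open>cs\<close> is the lower bound of the main term per unit volume. With
    \<epsilon> and \<alpha> as below, the total error is at most cs / 4 from the fine scales plus
    half of cs / 2 + cs / 2 from the AM-GM bound, so 3/4 of \<open>cs\<close>.\<close>
  define cs where "cs = \<tau> ^ ?n * (\<delta> / 2)"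
  define \<epsilon> where "\<epsilon> = cs / (12 * ?n)"
  define \<epsilon>0 where "\<epsilon>0 = \<delta> / (8 * real ?d * real ?n * 3 ^ ?d)"
  define \<alpha> where "\<alpha> = cs / (2 * real ?n * 3 ^ ?d)"
  have n0: "0 < real ?n" by simp
  have pos: "0 < \<tau>" "0 < cs" "0 < \<epsilon>" "0 < \<epsilon>0" "0 < \<alpha>"
    using \<delta> by (simp_all add: \<tau>_def cs_def \<epsilon>_def \<epsilon>0_def \<alpha>_def)
  have "(1::real) * 1 * 1 * 1 \<le> 8 * real ?d * real ?n * 3 ^ ?d"
    by (intro mult_mono) (auto simp: Suc_le_eq)
  then have \<epsilon>01: "\<epsilon>0 \<le> 1" using \<delta> by (simp add: \<epsilon>0_def)
  have "\<exists>\<eta>>0. replacement_scale v k \<epsilon> \<eta>" for k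
  proof -
    obtain e1 e2 where e: "norm e1 = 1" "norm e2 = 1" "e1 \<bullet> e2 = 0" "v k \<bullet> e2 = 0" "0 < v k \<bullet> e1"
      and l: "\<And>l. l \<noteq> k \<Longrightarrow> v l \<bullet> e1 = 0" "\<And>l. l \<noteq> k \<Longrightarrow> v l \<bullet> e2 = 0"
      using frame[of k] by blast
    show ?thesis
      by (rule ex_replacement_scale[where v=v and k=k, OF e]) (use l \<open>0 < \<epsilon>\<close> in auto)
  qed
  then obtain \<eta>f where \<eta>f: "\<And>k. 0 < \<eta>f k" "\<And>k. replacement_scale v k \<epsilon> (\<eta>f k)"
    by metis
  \<comment> \<open>The 1 is inserted so that \<eta> is at most 1; with
    \<open>\<epsilon>0 \<le> 1\<close> this keeps the fine side below the coarse one.\<close>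
  define \<eta> where "\<eta> = Min (insert 1 (range \<eta>f))"
  have \<eta>: "0 < \<eta>" "\<eta> \<le> 1" "\<And>k. \<eta> \<le> \<eta>f k"
    unfolding \<eta>_def using \<eta>f(1) by (auto intro!: Min_le simp del: Min_insert)
  \<comment> \<open>The factor 4 / (\<epsilon>0 * \<eta>) separates consecutive ranges of scales:
    the coarse side for a length s is at most 2 s / \<epsilon>0, and the fine side for the next
    length s' exceeds \<eta> s' / 2.\<close>
  obtain Q where Q: "1 \<le> Q" "\<And>k. 4 / (\<epsilon>0 * \<eta>) \<le> Q powr a k"
    using ex_large_powr[of a] a by blast
  have "\<exists>t. \<forall>j. (1 \<le> t j \<and> is_bad_scale A v (\<lambda>k. t j powr a k * b k)) \<and> t j * Q \<le> t (Suc j)"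
  proof (rule dependent_nat_choice)
    show "\<exists>x\<ge>1. is_bad_scale A v (\<lambda>k. x powr a k * b k)" using bad[of 1] by simp
    fix x :: real and j :: nat assume "1 \<le> x \<and> is_bad_scale A v (\<lambda>k. x powr a k * b k)"
    then have "1 * 1 \<le> x * Q" using Q(1) by (intro mult_mono) auto
    then have xQ: "1 \<le> x * Q" by simp
    then obtain y where "x * Q \<le> y" "is_bad_scale A v (\<lambda>k. y powr a k * b k)"
      using bad[of "x * Q"] by auto
    then show "\<exists>y. (1 \<le> y \<and> is_bad_scale A v (\<lambda>k. y powr a k * b k)) \<and> x * Q \<le> y"
      using xQ by (intro exI[of _ y]) auto
  qed
  then obtain t where t: "\<And>j. 1 \<le> t j" "\<And>j. is_bad_scale A v (\<lambda>k. t j powr a k * b k)" "\<And>j. t j * Q \<le> t (Suc j)"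
    by blast
  define s where "s = (\<lambda>j k. t j powr a k * b k)"
  have s0: "0 < s j k" for j k using t(1)[of j] b[of k] by (simp add: s_def)
  have s_step: "4 / (\<epsilon>0 * \<eta>) * s j k \<le> s (Suc j) k" for j k
  proof -
    have "4 / (\<epsilon>0 * \<eta>) * (t j powr a k) \<le> Q powr a k * (t j powr a k)"
      using Q(2) by (intro mult_right_mono) auto
    also have "\<dots> = (t j * Q) powr a k"
      using t(1)[of j] Q(1) by (simp add: powr_mult mult.commute)
    also have "\<dots> \<le> t (Suc j) powr a k"
      using t(3)[of j] t(1)[of j] Q(1) a[of k] by (intro powr_mono2) auto
    finally have "4 / (\<epsilon>0 * \<eta>) * (t j powr a k) * b k \<le> t (Suc j) powr a k * b k"
      using b[of k] by (intro mult_right_mono) auto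
    then show ?thesis by (simp add: s_def mult.assoc)
  qed
  \<comment> \<open>\<open>ml\<close> indexes the fine side, below \<eta> s by less than a factor 2;
    \<open>mL\<close> indexes the coarse side, above s / \<epsilon>0 by at most a factor 2.\<close>
  have "\<exists>m. dyadic m \<le> \<eta> * s j k \<and> \<eta> * s j k < 2 * dyadic m" for j k
    using ex_dyadic_below[of "\<eta> * s j k"] s0 \<eta>(1) by (metis mult_pos_pos)
  then obtain ml where ml: "\<And>j k. dyadic (ml j k) \<le> \<eta> * s j k" "\<And>j k. \<eta> * s j k < 2 * dyadic (ml j k)"
    by metis
  have "\<exists>m. s j k / \<epsilon>0 \<le> dyadic m \<and> dyadic m \<le> 2 * (s j k / \<epsilon>0)" for j k
  proof -
    have "0 < s j k / \<epsilon>0" using s0 pos by simp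
    then obtain m where m: "dyadic m \<le> s j k / \<epsilon>0" "s j k / \<epsilon>0 < 2 * dyadic m"
      by (rule ex_dyadic_below)
    moreover have "dyadic (m + 1) = 2 * dyadic m" by (simp add: dyadic_def powr_add)
    ultimately show ?thesis by (intro exI[of _ "m + 1"]) linarith
  qed
  then obtain mL where mL: "\<And>j k. s j k / \<epsilon>0 \<le> dyadic (mL j k)" "\<And>j k. dyadic (mL j k) \<le> 2 * (s j k / \<epsilon>0)"
    by metis
  have m1: "ml j k \<le> mL j k" for j k
  proof -
    have "dyadic (ml j k) \<le> \<eta> * s j k" by (rule ml)
    also have "\<dots> \<le> 1 * s j k" using \<eta> s0[of j k] by (intro mult_right_mono) auto
    also have "\<dots> \<le> s j k / \<epsilon>0" using \<epsilon>01 pos s0[of j k] by (simp add: pos_le_divide_eq)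
    also have "\<dots> \<le> dyadic (mL j k)" by (rule mL)
    finally show ?thesis by simp
  qed
  have m2: "mL j k \<le> ml (Suc j) k" for j k
  proof -
    have "dyadic (mL j k) \<le> 2 * (s j k / \<epsilon>0)" by (rule mL)
    also have "\<dots> = \<eta> * (4 / (\<epsilon>0 * \<eta>) * s j k) / 2" using \<eta>(1) by simp
    also have "\<dots> \<le> \<eta> * s (Suc j) k / 2"
      using s_step[of j k] \<eta>(1) by (intro divide_right_mono mult_left_mono) auto
    also have "\<dots> \<le> dyadic (ml (Suc j) k)" using ml(2)[of "Suc j" k] by simp
    finally show ?thesis by simp
  qed
  \<comment> \<open>\<open>J\<close> depends on n and the constants only; the cube is chosen
    afterwards, large enough for every coarse side with index below \<open>J\<close>.\<close>
  obtain J :: nat where J: "2 * real ?n / (\<alpha> * cs) < real J" using reals_Archimedean2 by blast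
  moreover have "0 < 2 * real ?n / (\<alpha> * cs)" using pos by simp
  ultimately have J0: "0 < J" by (metis of_nat_0_less_iff order_less_trans)
  define R0 where "R0 = Max (insert 1 ((\<lambda>(j, k). dyadic (mL j k)) ` ({..<J} \<times> UNIV)))"
  obtain R q where R: "R0 \<le> R" and dq: "\<delta> * R ^ ?d \<le> measure lborel (A \<inter> cube q R)"
    using dens by blast
  have R0: "1 \<le> R0" "\<And>j k. j < J \<Longrightarrow> dyadic (mL j k) \<le> R0"
    unfolding R0_def by (auto intro!: Max_ge)
  have Rpos: "0 < R" using R R0(1) by linarith
  have LR: "dyadic (mL j k) \<le> R" if "j < J" for j k using R0(2)[OF that, of k] R by linarith
  define f where "f = (indicator (A \<inter> cube q R) :: real ^ 'd \<Rightarrow> real)"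
  have fm [measurable]: "f \<in> borel_measurable borel" by (simp add: f_def)
  have if': "integrable lborel f"
    unfolding f_def
  proof (rule Bochner_Integration.integrable_bound[OF integrable_indicator_cube])
    show "AE x in lborel. norm (indicator (A \<inter> cube q R) x :: real) \<le> norm (indicator (cube q R) x :: real)"
      by (intro AE_I2) (auto simp: indicator_def)
  qed measurable
  have f01: "0 \<le> f x" "f x \<le> 1" "\<bar>f x\<bar> \<le> 1" for x by (auto simp: f_def)
  have fB: "f x \<le> indicator (cube q R) x" for x by (auto simp: f_def indicator_def)
  have f_out: "f x = 0" if "x \<notin> cube q R" for x using that by (simp add: f_def)
  have f_int: "(\<integral>x. f x \<partial>lborel) \<le> R ^ ?d"
    using integral_mono[OF if' integrable_indicator_cube fB] measure_cube[of R q] Rpos by simp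
  define En where "En = (\<lambda>m. \<integral>x. (cell_average 0 (dyadic m) f x)\<^sup>2 \<partial>lborel)"
  have En_mono: "En m' \<le> En m" if mm: "m \<le> m'" for m m'
  proof -
    obtain N :: nat where "0 < N" "dyadic m' = real N * dyadic m" using dyadic_multiple[OF mm] by blast
    then show ?thesis unfolding En_def by (intro cell_average_energy_mono[OF dyadic_pos _ _ if' f01(3)])
  qed
  have En_le: "En m \<le> R ^ ?d" for m
    using cell_average_energy_le[OF dyadic_pos if' f01(1,2), of 0 m] f_int by (simp add: En_def)
  have En_nn: "0 \<le> En m" for m by (simp add: En_def)
  \<comment> \<open>By \<open>m2\<close> the ranges of scales for successive \<open>j\<close> do not
    overlap, so their energy drops telescope.\<close>
  have tele: "(\<Sum>j<i. En (ml j k) - En (mL j k)) \<le> En (ml 0 k) - En (ml i k)" for i k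
  proof (induction i)
    case (Suc i)
    then show ?case using En_mono[OF m2[of i k]] by simp
  qed simp
  \<comment> \<open>The drops are summed over \<open>k\<close> as well, so that a single
    \<open>j\<close> serves every factor at once.\<close>
  have "(\<Sum>j<J. \<Sum>k\<in>UNIV. En (ml j k) - En (mL j k)) \<le> ?n * R ^ ?d"
  proof -
    have "(\<Sum>j<J. \<Sum>k\<in>UNIV. En (ml j k) - En (mL j k)) = (\<Sum>k\<in>UNIV. \<Sum>j<J. En (ml j k) - En (mL j k))"
      by (rule sum.swap)
    also have "\<dots> \<le> (\<Sum>k\<in>(UNIV :: 'n set). R ^ ?d)"
    proof (rule sum_mono)
      fix k
      show "(\<Sum>j<J. En (ml j k) - En (mL j k)) \<le> R ^ ?d"
        using tele[of k J] En_le[of "ml 0 k"] En_nn[of "ml J k"] by linarith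
    qed
    finally show ?thesis by simp
  qed
  then obtain j where j: "j < J" "(\<Sum>k\<in>UNIV. En (ml j k) - En (mL j k)) \<le> ?n * R ^ ?d / real J"
    using ex_average_le[OF J0] by blast
  define E where "E = (\<lambda>k. 3 * \<epsilon> * R ^ ?d + (\<alpha> * (3 * R) ^ ?d + (En (ml j k) - En (mL j k)) / \<alpha>) / 2)"
  let ?g = "\<lambda>k. cell_average 0 (dyadic (mL j k)) f"
  have "\<bar>count_form v (s j) f (\<lambda>_. f) - count_form v (s j) f ?g\<bar> \<le> (\<Sum>k\<in>UNIV. E k)"
  proof (rule count_form_telescope[OF if' f01(1,2)])
    show "?g k \<in> borel_measurable borel" for k by measurable
    show "0 \<le> ?g k x" "?g k x \<le> 1" for k x
      using cell_average_unit_interval[OF dyadic_pos fm f01(1,2)] by auto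
    fix k and \<Phi> :: "'n \<Rightarrow> real ^ 'd \<Rightarrow> real"
    assume \<Phi>: "\<And>l. \<Phi> l \<in> borel_measurable borel" "\<And>l x. 0 \<le> \<Phi> l x" "\<And>l x. \<Phi> l x \<le> 1"
    obtain N :: nat where N: "0 < N" "dyadic (mL j k) = real N * dyadic (ml j k)"
      using dyadic_multiple[OF m1[of j k]] by blast
    have "dyadic (ml j k) \<le> \<eta> * s j k" by (rule ml)
    also have "\<dots> \<le> \<eta>f k * s j k" using \<eta>(3) s0[of j k] by (intro mult_right_mono) auto
    finally have le: "dyadic (ml j k) \<le> \<eta>f k * s j k" .
    have "\<bar>replacement_error v (s j) f \<Phi> k (\<lambda>x. f x - ?g k x)\<bar>
        \<le> 3 * \<epsilon> * measure lborel (cube q R)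
          + (\<integral>x. \<bar>cell_average 0 (dyadic (ml j k)) f x - ?g k x\<bar> \<partial>lborel)"
      by (rule \<eta>f(2)[of k, unfolded replacement_scale_def, rule_format, where s="s j", OF s0 dyadic_pos le N if'])
         (use f01 fB \<Phi> emeasure_cube[of R q] Rpos in auto)
    also have "measure lborel (cube q R) = R ^ ?d" using measure_cube[of R q] Rpos by simp
    also have "(\<integral>x. \<bar>cell_average 0 (dyadic (ml j k)) f x - ?g k x\<bar> \<partial>lborel)
        \<le> (\<alpha> * (3 * R) ^ ?d + (En (ml j k) - En (mL j k)) / \<alpha>) / 2"
      unfolding En_def by (rule cell_average_L1_diff[OF dyadic_pos N LR[OF j(1)] if' f01(3) f_out \<open>0 < \<alpha>\<close>])
    finally show "\<bar>replacement_error v (s j) f \<Phi> k (\<lambda>x. f x - ?g k x)\<bar> \<le> E k"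
      by (simp add: E_def)
  qed
  moreover have "count_form v (s j) f (\<lambda>_. f) = 0"
    unfolding s_def by (rule count_form_bad_scale[OF t(2)]) (simp add: f_def)
  moreover have "cs * R ^ ?d \<le> count_form v (s j) f ?g"
  proof -
    have "s j k \<le> \<epsilon>0 * dyadic (mL j k)" for k
      using mL(1)[of j k] pos(4) by (simp add: pos_divide_le_eq mult.commute)
    from structured_lower_bound[where p=0 and L="\<lambda>k. dyadic (mL j k)" and s="s j",
        OF A Rpos \<delta> dq v dyadic_pos LR[OF j(1)] s0 this[unfolded \<epsilon>0_def]]
    show ?thesis by (simp add: cs_def \<tau>_def f_def mult.assoc)
  qed
  moreover have "(\<Sum>k\<in>UNIV. E k) \<le> 3 / 4 * cs * R ^ ?d"
  proof -
    have "(\<Sum>k\<in>UNIV. E k) = ?n * (3 * \<epsilon> * R ^ ?d) + (?n * (\<alpha> * (3 * R) ^ ?d) + (\<Sum>k\<in>UNIV. En (ml j k) - En (mL j k)) / \<alpha>) / 2"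
      unfolding E_def by (simp add: sum.distrib sum_divide_distrib add_divide_distrib)
    also have "\<dots> \<le> ?n * (3 * \<epsilon> * R ^ ?d) + (?n * (\<alpha> * (3 * R) ^ ?d) + (?n * R ^ ?d / real J) / \<alpha>) / 2"
      using j(2) pos(5) by (intro add_left_mono divide_right_mono) auto
    also have "?n * (3 * \<epsilon> * R ^ ?d) = cs / 4 * R ^ ?d" by (simp add: \<epsilon>_def)
    also have "?n * (\<alpha> * (3 * R) ^ ?d) = cs / 2 * R ^ ?d" by (simp add: \<alpha>_def power_mult_distrib)
    also have "(?n * R ^ ?d / real J) / \<alpha> \<le> cs / 2 * R ^ ?d"
    proof -
      have "2 * real ?n \<le> real J * (\<alpha> * cs)" using J pos by (simp add: pos_divide_less_eq less_imp_le)
      then have "real ?n / real J / \<alpha> \<le> cs / 2" using J0 pos by (simp add: field_simps)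
      then have "real ?n / real J / \<alpha> * R ^ ?d \<le> cs / 2 * R ^ ?d" using Rpos by (intro mult_right_mono) auto
      then show ?thesis by simp
    qed
    finally show ?thesis by simp
  qed
  moreover have "0 < cs * R ^ ?d" using pos Rpos by simp
  ultimately show False by linarith
qed

end

text \<open>\<open>e1\<close> is the normalised part of \<open>v k\<close> orthogonal to the other
  vectors, nonzero by independence. \<open>e2\<close> is orthogonal to all the vectors, hence to
  \<open>e1\<close>, which lies in their span; it exists because n vectors cannot span a space of
  larger dimension.\<close>

lemma ex_orthogonal_frame:
  fixes v :: "'n::finite \<Rightarrow> 'a::euclidean_space"
  assumes dim: "CARD('n) < DIM('a)" and indep: "v k \<notin> span (v ` (UNIV - {k}))"
  shows "\<exists>e1 e2. norm e1 = 1 \<and> norm e2 = 1 \<and> e1 \<bullet> e2 = 0 \<and> v k \<bullet> e2 = 0 \<and> 0 < v k \<bullet> e1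
      \<and> (\<forall>l. l \<noteq> k \<longrightarrow> v l \<bullet> e1 = 0 \<and> v l \<bullet> e2 = 0)"
proof -
  let ?S = "v ` (UNIV - {k})"
  obtain y z where yz: "y \<in> span ?S" "\<And>w. w \<in> span ?S \<Longrightarrow> orthogonal z w" "v k = y + z"
    using orthogonal_subspace_decomp_exists[of ?S "v k"] by blast
  have z: "z \<noteq> 0" using yz indep by auto
  have "dim (range v) \<le> card (range v)" by (rule dim_le_card) (auto intro: span_base)
  also have "\<dots> \<le> CARD('n)" by (rule card_image_le) simp
  finally have "dim (range v) < DIM('a)" using dim by simp
  then obtain e where e: "e \<noteq> 0" "\<And>y. y \<in> span (range v) \<Longrightarrow> orthogonal e y"
    using orthogonal_to_subspace_exists[of "range v"] by metis
  have "span ?S \<subseteq> span (range v)" by (rule span_mono) auto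
  then have "v k - y \<in> span (range v)" using yz(1) by (intro span_diff) (auto intro: span_base)
  then have ez: "e \<bullet> z = 0" using e(2) yz(3) by (simp add: orthogonal_def)
  have ev: "e \<bullet> v l = 0" for l using e(2)[of "v l"] by (simp add: orthogonal_def span_base)
  have "z \<bullet> v l = 0" if "l \<noteq> k" for l
    using yz(2)[of "v l"] that by (simp add: orthogonal_def span_base)
  then have zl: "v l \<bullet> z = 0" if "l \<noteq> k" for l using that by (simp add: inner_commute)
  have "y \<bullet> z = 0" using yz(2)[OF yz(1)] by (simp add: orthogonal_def inner_commute)
  then have "v k \<bullet> z = z \<bullet> z" by (simp add: yz(3) inner_add_left)
  then have "0 < v k \<bullet> z" using z by simp
  then show ?thesis
    using z e(1) ez ev zl
    by (intro exI[of _ "(1 / norm z) *\<^sub>R z"] exI[of _ "(1 / norm e) *\<^sub>R e"])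
       (auto simp: inner_commute)
qed

text \<open>A Lebesgue measurable set contains a Borel set with null difference, and a copy inside
  the subset is a copy inside \<open>A\<close>. If the limsup exceeds \<open>c\<close>, then so does
  the supremum over cubes for arbitrarily large \<open>R\<close>.\<close>

lemma upper_banach_density_pos_cubes:
  fixes A :: "(real ^ 'd) set"
  assumes A: "A \<in> sets lebesgue" and dens: "upper_banach_density A > 0"
  obtains C and \<delta> :: real where "C \<in> sets borel" "C \<subseteq> A" "0 < \<delta>" "\<delta> \<le> 1"
    "\<And>R0. \<exists>R\<ge>R0. \<exists>q. \<delta> * R ^ CARD('d) \<le> measure lborel (C \<inter> cube q R)"
proof -
  obtain C N N' where C: "A = C \<union> N" "N \<subseteq> N'" "N' \<in> null_sets lborel" "C \<in> sets (lborel :: (real ^ 'd) measure)"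
    using A by (rule sets_completionE)
  have [measurable]: "C \<in> sets borel" "N' \<in> sets borel" using C by auto
  have em: "emeasure lebesgue (A \<inter> cube q R) \<le> emeasure lborel (C \<inter> cube q R)" for q R
  proof -
    have "emeasure lebesgue (A \<inter> cube q R) \<le> emeasure lebesgue ((C \<inter> cube q R) \<union> N')"
      using C by (intro emeasure_mono) auto
    also have "\<dots> = emeasure lborel ((C \<inter> cube q R) \<union> N')" by simp
    also have "\<dots> = emeasure lborel (C \<inter> cube q R)"
      using C(3) by (intro emeasure_Un_null_set) auto
    finally show ?thesis .
  qed
  let ?g = "\<lambda>R::real. SUP x::real ^ 'd. emeasure lebesgue (A \<inter> (+) x ` cbox 0 (\<chi> i. R)) / ennreal (R ^ CARD('d))"
  obtain c where c: "0 < c" "c < Limsup at_top ?g"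
    using dens dense unfolding upper_banach_density_def by blast
  \<comment> \<open>Capping at 1 turns the extended real \<open>c\<close> into a finite density and
    yields the bound \<open>\<delta> \<le> 1\<close> at once.\<close>
  define \<delta> where "\<delta> = enn2real (min 1 c)"
  have c': "min 1 c < top" by (simp add: min_less_iff_disj)
  then have "ennreal \<delta> = min 1 c" by (simp add: \<delta>_def)
  then have \<delta>: "0 < \<delta>" "ennreal \<delta> \<le> c" "ennreal \<delta> \<le> ennreal 1"
    using c(1) c' by (simp_all add: \<delta>_def enn2real_positive_iff)
  have "\<exists>R\<ge>R0. \<exists>q. \<delta> * R ^ CARD('d) \<le> measure lborel (C \<inter> cube q R)" for R0
  proof -
    have "\<not> eventually (\<lambda>R. ?g R \<le> c) at_top"
    proof
      assume "eventually (\<lambda>R. ?g R \<le> c) at_top"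
      then have "Limsup at_top ?g \<le> c" by (rule Limsup_bounded)
      then show False using c(2) by simp
    qed
    then obtain R where R: "max R0 1 \<le> R" "\<not> ?g R \<le> c"
      unfolding eventually_at_top_linorder by blast
    from R(2) have "c < ?g R" by (simp only: not_le)
    then obtain q where q: "c < emeasure lebesgue (A \<inter> (+) q ` cbox 0 (\<chi> i. R)) / ennreal (R ^ CARD('d))"
      unfolding less_SUP_iff by blast
    have img: "(+) q ` cbox 0 (\<chi> i. R) = cube q R"
      using cbox_translation[of q 0 "\<chi> i. R"] by simp
    have Rp: "0 < R" using R(1) by simp
    have fin: "emeasure lborel (C \<inter> cube q R) \<noteq> \<infinity>"
    proof -
      have "emeasure lborel (C \<inter> cube q R) \<le> emeasure lborel (cube q R)" by (intro emeasure_mono) auto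
      then show ?thesis using emeasure_cube[of R q] Rp by (auto simp: top_unique)
    qed
    have "ennreal \<delta> * ennreal (R ^ CARD('d)) \<le> c * ennreal (R ^ CARD('d))"
      using \<delta>(2) by (rule mult_right_mono) simp
    also have "\<dots> \<le> emeasure lebesgue (A \<inter> cube q R) / ennreal (R ^ CARD('d)) * ennreal (R ^ CARD('d))"
      using q unfolding img by (intro mult_right_mono) auto
    also have "\<dots> = emeasure lebesgue (A \<inter> cube q R)"
      using Rp by (simp add: ennreal_divide_times ennreal_mult_divide_eq)
    also have "\<dots> \<le> emeasure lborel (C \<inter> cube q R)" by (rule em)
    also have "\<dots> = ennreal (measure lborel (C \<inter> cube q R))"
      using fin by (intro emeasure_eq_ennreal_measure) auto
    finally have "ennreal (\<delta> * R ^ CARD('d)) \<le> ennreal (measure lborel (C \<inter> cube q R))"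
      using \<delta>(1) Rp by (simp add: ennreal_mult)
    then have "\<delta> * R ^ CARD('d) \<le> measure lborel (C \<inter> cube q R)"
      by (simp add: ennreal_le_iff)
    then show ?thesis using R(1) by auto
  qed
  moreover have "\<delta> \<le> 1" using \<delta>(3) by (simp add: ennreal_le_iff del: ennreal_1)
  ultimately show ?thesis using that[of C \<delta>] C \<delta>(1) by auto
qed

theorem theorem1:
  fixes a b :: "'n::finite \<Rightarrow> real"
    and u :: "'n \<Rightarrow> real ^ 'n"
    and A :: "(real ^ 'd) set"
  assumes dim: "CARD('d) = CARD('n) + 1"
    and a_pos: "\<And>k. a k > 0"
    and b_pos: "\<And>k. b k > 0"
    and u_unit: "\<And>k. norm (u k) = 1"
    and u_indep: "inj u" "independent (range u)"
    and A_meas: "A \<in> sets lebesgue"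
    and A_dens: "upper_banach_density A > 0"
  shows "\<exists>t\<^sub>0>0. \<forall>t\<ge>t\<^sub>0.
    (\<exists>(x :: real ^ 'd) (y :: 'n \<Rightarrow> real ^ 'd).
       insert x (range (\<lambda>k. x + y k)) \<subseteq> A \<and>
       (\<forall>k l. y k \<bullet> y l =
          ((t powr a k * b k) *\<^sub>R u k) \<bullet> ((t powr a l * b l) *\<^sub>R u l))) \<and>
    contains_isometric_copy A (insert 0 (range (\<lambda>k. (t powr a k * b k) *\<^sub>R u k)))"
proof -
  obtain C \<delta> where C: "C \<in> sets borel" "C \<subseteq> A" "0 < \<delta>" "\<delta> \<le> 1"
    "\<And>R0. \<exists>R\<ge>R0. \<exists>q. \<delta> * R ^ CARD('d) \<le> measure lborel (C \<inter> cube q R)"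
    using upper_banach_density_pos_cubes[OF A_meas A_dens] by blast
  \<comment> \<open>A linear isometry carries the vectors to the larger space, keeping norms and
    independence.\<close>
  obtain \<iota> :: "real ^ 'n \<Rightarrow> real ^ 'd" where \<iota>: "linear \<iota>" "\<And>x. norm (\<iota> x) = norm x"
    using isometry_subset_subspace[OF subspace_UNIV subspace_UNIV,
        where 'a="real ^ 'n" and 'b="real ^ 'd"] dim by (auto simp: dim_UNIV)
  have inj\<iota>: "inj \<iota>"
    using \<iota> by (metis linear_injective_0 norm_eq_zero)
  define v where "v = (\<lambda>k. \<iota> (u k))"
  have v_unit: "norm (v k) = 1" for k by (simp add: v_def \<iota> u_unit)
  have v_indep: "v k \<notin> span (v ` (UNIV - {k}))" for k
  proof
    assume "v k \<in> span (v ` (UNIV - {k}))"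
    also have "v ` (UNIV - {k}) = \<iota> ` (u ` (UNIV - {k}))" by (auto simp: v_def)
    also have "span (\<iota> ` (u ` (UNIV - {k}))) = \<iota> ` span (u ` (UNIV - {k}))"
      using \<iota>(1) by (rule linear_span_image)
    finally have "u k \<in> span (u ` (UNIV - {k}))"
      using inj\<iota> by (auto simp: v_def inj_image_mem_iff)
    also have "u ` (UNIV - {k}) = range u - {u k}"
      using u_indep(1) by (auto simp: inj_eq)
    finally show False using u_indep(2) by (auto simp: dependent_def)
  qed
  obtain M :: "(real ^ 'd ^ 'd) measure" and T :: "real ^ 'd ^ 'd \<Rightarrow> real ^ 'd \<Rightarrow> real ^ 'd"
    where "random_orthogonal M T"
    using ex_random_orthogonal by blast
  then interpret random_orthogonal M T .
  have "\<exists>t0>0. \<forall>t\<ge>t0. \<not> is_bad_scale C v (\<lambda>k. t powr a k * b k)"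
  proof (rule bad_scales_bounded[OF C(1,3,4,5) v_unit _ a_pos b_pos])
    show "\<exists>e1 e2. norm e1 = 1 \<and> norm e2 = 1 \<and> e1 \<bullet> e2 = 0 \<and> v k \<bullet> e2 = 0 \<and> 0 < v k \<bullet> e1
      \<and> (\<forall>l. l \<noteq> k \<longrightarrow> v l \<bullet> e1 = 0 \<and> v l \<bullet> e2 = 0)" for k
      by (rule ex_orthogonal_frame[OF _ v_indep]) (simp add: dim)
  qed
  then obtain t0 where t0: "0 < t0" "\<And>t. t0 \<le> t \<Longrightarrow> \<not> is_bad_scale C v (\<lambda>k. t powr a k * b k)" by blast
  show ?thesis
  proof (intro exI[of _ t0] conjI t0(1) allI impI)
    fix t assume "t0 \<le> t"
    then obtain x w where x: "x \<in> C" and w: "w \<in> space M" and xw: "\<And>k. x + (t powr a k * b k) *\<^sub>R T w (v k) \<in> C"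
      using t0(2)[of t] unfolding is_bad_scale_def by blast
    \<comment> \<open>One linear isometry yields both conclusions: its values at the scaled vectors
      are the required y, and its translate by \<open>x\<close> is the isometric copy.\<close>
    define \<sigma> where "\<sigma> = (\<lambda>z. T w (\<iota> z))"
    have \<sigma>_lin: "linear \<sigma>"
      unfolding \<sigma>_def
      using linear_compose[OF \<iota>(1) orthogonal_transformation_linear[OF T_orthogonal[OF w]]] by (simp add: comp_def)
    have \<sigma>_norm: "norm (\<sigma> z) = norm z" for z
      using T_orthogonal[OF w] \<iota>(2) by (simp add: \<sigma>_def orthogonal_transformation)
    have \<sigma>_inner: "\<sigma> z \<bullet> \<sigma> z' = z \<bullet> z'" for z z'
      using \<sigma>_norm[of "z + z'"] \<sigma>_norm[of z] \<sigma>_norm[of z']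
      by (simp add: dot_norm linear_add[OF \<sigma>_lin, symmetric])
    let ?p = "\<lambda>k. (t powr a k * b k) *\<^sub>R u k"
    have \<sigma>_p: "\<sigma> (?p k) = (t powr a k * b k) *\<^sub>R T w (v k)" for k
      using linear_scale[OF \<sigma>_lin] by (simp add: \<sigma>_def v_def)
    have mem: "x \<in> A" "x + \<sigma> (?p k) \<in> A" for k
      using x xw[of k] C(2) \<sigma>_p[of k] by auto
    show "\<exists>x y. insert x (range (\<lambda>k. x + y k)) \<subseteq> A \<and> (\<forall>k l. y k \<bullet> y l = ?p k \<bullet> ?p l)"
      by (intro exI[of _ x] exI[of _ "\<lambda>k. \<sigma> (?p k)"]) (use mem \<sigma>_inner in auto)
    show "contains_isometric_copy A (insert 0 (range ?p))"
      unfolding contains_isometric_copy_def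
    proof (intro exI[of _ "\<lambda>z. x + \<sigma> z"] conjI ballI)
      show "(\<lambda>z. x + \<sigma> z) ` insert 0 (range ?p) \<subseteq> A"
        using mem linear_0[OF \<sigma>_lin] by auto
      show "dist (x + \<sigma> z) (x + \<sigma> z') = dist z z'" for z z'
        by (simp add: dist_norm linear_diff[OF \<sigma>_lin, symmetric] \<sigma>_norm)
    qed
  qed
qed

end
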